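(* Let $n\ge3$, let $\Omega\subset\mathbb{R}^{n-1}$ be open, let $q:\Omega\to\mathbb{R}$ be smooth, and let $S=\{(y',q(y')):y'\in\Omega\}\subset\mathbb{R}^n$ be a connected, smooth, strictly convex hypersurface. Let $A$ be a real symmetric invertible $n\times n$ matrix with $k\in\{2,3,\dots,n-1\}$ positive eigenvalues and $n-k$ negative eigenvalues (counted with multiplicity). Let $\mathcal{R}:\mathcal{E}'(\mathbb{R}^n\setminus S)\to\mathcal{D}'(\Omega\times(0,\infty))$ be the Radon transform $$\mathcal{R}f(y',t)=\int_{\mathbb{R}}\int_{\mathbb{R}^n}|\nabla_x\psi|\,f(x)\,e^{i\psi(y',t,x,\omega)}\,dx\,d\omega,\qquad \psi(y',t,x,\omega)=\omega\big(t-x_T^TAx_T\big),\quad x_T=x-(y',q(y')).$$ Then $\mathcal{R}$ is a Fourier integral operator associated to a canonical relation $C$ for which the left projection $\pi_L$ has a cusp singularity and the right projection $\pi_R$ has a fold singularity.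
   Context: Points of $\mathbb{R}^n$ are regarded as column vectors. The functions/distributions $f$ have support disjoint from $S$, and $t>0$ throughout. The integral defining $\mathcal{R}$ is understood as an oscillatory integral. $S$ is strictly convex if its second fundamental form is definite at every point (with respect to a chosen orientation); for the graph of $q$ this means $\operatorname{Hess}(q)$ is everywhere positive definite or everywhere negative definite. A Fourier integral operator (FIO) with nondegenerate phase function $\varphi(u,v;\theta)$ and symbol amplitude $a$ is an operator $\mathcal{E}'(V)\to\mathcal{D}'(U)$ with kernel $\int e^{i\varphi}a\,d\theta$ (as usual, modulo smooth kernels); its canonical relation is $\{(u,d_u\varphi;v,-d_v\varphi): d_\theta\varphi=0\}$. Canonical relation of $\mathcal{R}$: $C=\{(y',t,d_{y'}\psi,\omega;\,x,-d_x\psi):\ \partial_\omega\psi=0\}$, a smooth $2n$-dimensional manifold globally parametrized by $(y',x,\omega)$ with $y'\in\Omega$, $x\in\mathbb{R}^n\setminus S$, $\omega\in\mathbb{R}\setminus\{0\}$, and $t=x_T^TAx_T>0$. With $B$ the $(n-1)\times n$ matrix $B=(I_{n-1}\,|\,\nabla q(y'))$, the projections are $$\pi_L(y',x,\omega)=(y',\,x_T^TAx_T,\,2\omega BAx_T,\,\omega)\in T^*(\Omega\times(0,\infty)),\qquad \pi_R(y',x,\omega)=(x,\,2\omega Ax_T)\in T^*\mathbb{R}^n .$$ For a smooth map $f$ between manifolds of equal dimension (in local coordinates), let $S_1(f)=\{p:\det(df_p)=0,\ d(\det(df))_p\ne0\}$, a smooth hypersurface on which $df$ has corank $1$. Fold: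 $p\in S_1(f)$ is a fold point if $\ker(df_p)$ is transversal to $T_pS_1(f)$. "$f$ has a fold singularity" means every point where $\det(df)=0$ lies in $S_1(f)$ and is a fold point. Cusp: let $p\in S_1(f)$ with $\ker(df_p)\subset T_pS_1(f)$. Let $v$ be a (nowhere vanishing, smooth) vector field along $S_1(f)$ near $p$ with $v\in\ker(df)$ at all points of $S_1(f)$, and let $K$ be a smooth function with $K|_{S_1(f)}=0$ and $dK|_{S_1(f)}\neq0$. Then the function $v(K)=dK(v)$ on $S_1(f)$ vanishes at $p$, and $p$ is a cusp point if this zero is simple, i.e. the differential at $p$ of the function $dK(v)$ on $S_1(f)$ is nonzero. "$f$ has a cusp singularity" means every point where $\det(df)=0$ lies in $S_1(f)$ and is either a fold point or a cusp point (the cusp points being exactly those where $\ker(df_p)\subset T_pS_1(f)$). *)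

theory Defs
  imports "HOL-Analysis.Analysis" "HOL-Computational_Algebra.Polynomial"
begin

section \<open>Smooth functions\<close>

fun iter_pd :: "'a::euclidean_space list \<Rightarrow> ('a \<Rightarrow> 'b::real_normed_vector) \<Rightarrow> 'a \<Rightarrow> 'b" where
  "iter_pd [] f = f"
| "iter_pd (b # bs) f = (\<lambda>x. frechet_derivative (iter_pd bs f) (at x) b)"

text \<open>
  A function is smooth on a set if it is smooth on some open neighbourhood of it. For an open
  set this is the usual notion. The general form is needed because the complement of the graph
  of \<open>q\<close> over an open set \<open>\<Omega>\<close> is not open unless the graph is closed.
\<close>

definition smooth_on :: "'a::euclidean_space set \<Rightarrow> ('a \<Rightarrow> 'b::real_normed_vector) \<Rightarrow> bool" where
  "smooth_on X f \<longleftrightarrow>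
     (\<exists>W. open W \<and> X \<subseteq> W \<and> (\<forall>bs. set bs \<subseteq> Basis \<longrightarrow> iter_pd bs f differentiable_on W))"

definition grad :: "('a::euclidean_space \<Rightarrow> real) \<Rightarrow> 'a \<Rightarrow> 'a" where
  "grad f x = (\<Sum>b\<in>Basis. frechet_derivative f (at x) b *\<^sub>R b)"

section \<open>Distributions\<close>

definition derivs_bounded ::
  "nat \<Rightarrow> 'a::euclidean_space set \<Rightarrow> ('a \<Rightarrow> complex) \<Rightarrow> real \<Rightarrow> bool" where
  "derivs_bounded N K h M \<longleftrightarrow>
     (\<forall>bs. set bs \<subseteq> Basis \<and> length bs \<le> N \<longrightarrow> (\<forall>x\<in>K. norm (iter_pd bs h x) \<le> M))"

definition test_functions :: "'a::euclidean_space set \<Rightarrow> ('a \<Rightarrow> complex) set" where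
  "test_functions X = {g. smooth_on UNIV g \<and> compact (closure {x. g x \<noteq> 0}) \<and>
                          closure {x. g x \<noteq> 0} \<subseteq> X}"

definition linear_functional_on ::
  "('a \<Rightarrow> complex) set \<Rightarrow> (('a \<Rightarrow> complex) \<Rightarrow> complex) \<Rightarrow> bool" where
  "linear_functional_on F T \<longleftrightarrow>
     (\<forall>g\<in>F. \<forall>h\<in>F. T (\<lambda>x. g x + h x) = T g + T h) \<and>
     (\<forall>c. \<forall>g\<in>F. T (\<lambda>x. c * g x) = c * T g)"

definition distributions ::
  "'a::euclidean_space set \<Rightarrow> (('a \<Rightarrow> complex) \<Rightarrow> complex) set" where
  "distributions U =
     {T. linear_functional_on (test_functions U) T \<and>
         (\<forall>K. compact K \<and> K \<subseteq> U \<longrightarrow>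
            (\<exists>N C. \<forall>g\<in>test_functions K. \<forall>M\<ge>0.
               derivs_bounded N K g M \<longrightarrow> norm (T g) \<le> C * M))}"

text \<open>
  Compactly supported distributions in \<open>V\<close>: the continuous linear functionals on the space of
  smooth functions on \<open>V\<close>. For open \<open>V\<close> only \<open>W = V\<close> matters in the continuity condition and
  this is the textbook dual of \<open>C\<^sup>\<infinity>(V)\<close>. For arbitrary \<open>V\<close> the elements are the compactly supported
  distributions on the whole space whose support is contained in \<open>V\<close>, paired with functions that
  are smooth near \<open>V\<close>.
\<close>

definition compact_distributions ::
  "'a::euclidean_space set \<Rightarrow> (('a \<Rightarrow> complex) \<Rightarrow> complex) set" where
  "compact_distributions V =
     {f. linear_functional_on {h. smooth_on V h} f \<and>
         (\<forall>W. open W \<and> V \<subseteq> W \<longrightarrow>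
            (\<exists>K N C. compact K \<and> K \<subseteq> W \<and>
               (\<forall>h. smooth_on W h \<longrightarrow>
                  (\<forall>M\<ge>0. derivs_bounded N K h M \<longrightarrow> norm (f h) \<le> C * M))))}"

section \<open>Oscillatory integrals and Fourier integral operators\<close>

text \<open>
  The oscillatory integral of \<open>exp (i \<phi> u \<theta>) b u \<theta>\<close> over all \<open>u\<close> and \<open>\<theta>\<close>, regularized by cut-offs
  \<open>\<rho> (\<epsilon> \<theta>)\<close>, \<open>\<epsilon> \<rightarrow> 0+\<close>; the limit must not depend on the cut-off.
\<close>

definition has_osc_integral ::
  "('u::euclidean_space \<Rightarrow> 'th::euclidean_space \<Rightarrow> real) \<Rightarrow> ('u \<Rightarrow> 'th \<Rightarrow> complex) \<Rightarrow> complex \<Rightarrow> bool"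
  where
  "has_osc_integral \<phi> b I \<longleftrightarrow>
     (\<forall>\<rho>\<in>test_functions UNIV. \<rho> 0 = 1 \<longrightarrow>
        ((\<lambda>\<epsilon>. LINT \<theta>|lborel. (LINT u|lborel.
              \<rho> (\<epsilon> *\<^sub>R \<theta>) * exp (\<i> * of_real (\<phi> u \<theta>)) * b u \<theta>)) \<longlongrightarrow> I) (at_right 0))"

definition osc_integral ::
  "('u::euclidean_space \<Rightarrow> 'th::euclidean_space \<Rightarrow> real) \<Rightarrow> ('u \<Rightarrow> 'th \<Rightarrow> complex) \<Rightarrow> complex" where
  "osc_integral \<phi> b = (THE I. has_osc_integral \<phi> b I)"

text \<open>
  The value at \<open>v\<close> of the transpose, applied to the test function \<open>g\<close>, of the operator with
  Schwartz kernel \<open>\<integral> exp (i \<phi> u v \<theta>) a((u, v), \<theta>) d\<theta>\<close>. The operator itself maps a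
  compactly supported distribution \<open>f\<close> to the distribution sending \<open>g\<close> to the pairing of \<open>f\<close>
  with \<open>osc_transpose \<phi> a g\<close>.
\<close>

definition osc_transpose ::
  "('u::euclidean_space \<Rightarrow> 'v \<Rightarrow> 'th::euclidean_space \<Rightarrow> real) \<Rightarrow> (('u \<times> 'v) \<times> 'th \<Rightarrow> complex) \<Rightarrow>
   ('u \<Rightarrow> complex) \<Rightarrow> 'v \<Rightarrow> complex" where
  "osc_transpose \<phi> a g v = osc_integral (\<lambda>u \<theta>. \<phi> u v \<theta>) (\<lambda>u \<theta>. a ((u, v), \<theta>) * g u)"

definition symbol_class ::
  "real \<Rightarrow> ('w::euclidean_space) set \<Rightarrow> ('w \<times> 'th::euclidean_space \<Rightarrow> complex) set" where
  "symbol_class m W =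
     {a. smooth_on (W \<times> UNIV) a \<and>
         (\<forall>K as bs. compact K \<and> K \<subseteq> W \<and> set as \<subseteq> Basis \<and> set bs \<subseteq> Basis \<longrightarrow>
            (\<exists>C. \<forall>w\<in>K. \<forall>\<theta>.
               norm (iter_pd (map (\<lambda>b. (0, b)) as @ map (\<lambda>b. (b, 0)) bs) a (w, \<theta>))
                 \<le> C * (1 + norm \<theta>) powr (m - length as)))}"

text \<open>
  Nondegenerate operator phase functions over an open set \<open>W\<close> of pairs \<open>(u, v)\<close>. The two
  noncriticality conditions, in \<open>(u, \<theta>)\<close> for fixed \<open>v\<close> and in \<open>(v, \<theta>)\<close> for fixed \<open>u\<close>, are the ones
  under which the operator acts from compactly supported distributions to distributions.
  The last condition is linear independence of the differentials of the partial derivatives of \<open>\<phi>\<close>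
  in \<open>\<theta>\<close>.
\<close>

definition nondegenerate_phase ::
  "('u::euclidean_space \<times> 'v::euclidean_space) set \<Rightarrow>
   ('u \<Rightarrow> 'v \<Rightarrow> 'th::euclidean_space \<Rightarrow> real) \<Rightarrow> bool" where
  "nondegenerate_phase W \<phi> \<longleftrightarrow>
     smooth_on (W \<times> (UNIV - {0})) (\<lambda>((u, v), \<theta>). \<phi> u v \<theta>) \<and>
     (\<forall>(u, v)\<in>W. \<forall>\<theta>. \<theta> \<noteq> 0 \<longrightarrow>
        (\<forall>l>0. \<phi> u v (l *\<^sub>R \<theta>) = l * \<phi> u v \<theta>) \<and>
        (grad (\<lambda>u. \<phi> u v \<theta>) u \<noteq> 0 \<or> grad (\<phi> u v) \<theta> \<noteq> 0) \<and>
        (grad (\<lambda>v. \<phi> u v \<theta>) v \<noteq> 0 \<or> grad (\<phi> u v) \<theta> \<noteq> 0) \<and>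
        (grad (\<phi> u v) \<theta> = 0 \<longrightarrow>
           (\<forall>c::'th. (\<forall>w. (\<Sum>b\<in>Basis. (c \<bullet> b) *
                        frechet_derivative (\<lambda>((u, v), \<theta>). grad (\<phi> u v) \<theta> \<bullet> b)
                          (at ((u, v), \<theta>)) w) = 0) \<longrightarrow> c = 0)))"

text \<open>
  Covectors are identified with vectors through the inner product, so that a cotangent vector is
  a pair of a base point and a gradient.
\<close>

definition canonical_relation ::
  "'u::euclidean_space set \<Rightarrow> 'v::euclidean_space set \<Rightarrow>
   ('u \<Rightarrow> 'v \<Rightarrow> 'th::euclidean_space \<Rightarrow> real) \<Rightarrow> (('u \<times> 'u) \<times> ('v \<times> 'v)) set" where
  "canonical_relation U V \<phi> =
     {((u, grad (\<lambda>u. \<phi> u v \<theta>) u), (v, - grad (\<lambda>v. \<phi> u v \<theta>) v)) | u v \<theta>.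
        u \<in> U \<and> v \<in> V \<and> \<theta> \<noteq> 0 \<and> grad (\<phi> u v) \<theta> = 0}"

text \<open>
  \<open>T\<close> is a Fourier integral operator with nondegenerate phase function \<open>\<phi>\<close>: modulo a smooth
  kernel \<open>r\<close>, its kernel is \<open>\<integral> exp (i \<phi>) a d\<theta>\<close> for a symbol \<open>a\<close>. It is associated to
  \<open>canonical_relation U V \<phi>\<close>. For open \<open>V\<close> one may take \<open>W = U \<times> V\<close>.
\<close>

definition fourier_integral_operator ::
  "'u::euclidean_space set \<Rightarrow> 'v::euclidean_space set \<Rightarrow>
   ('u \<Rightarrow> 'v \<Rightarrow> 'th::euclidean_space \<Rightarrow> real) \<Rightarrow>
   ((('v \<Rightarrow> complex) \<Rightarrow> complex) \<Rightarrow> (('u \<Rightarrow> complex) \<Rightarrow> complex)) \<Rightarrow> bool" where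
  "fourier_integral_operator U V \<phi> T \<longleftrightarrow>
     open U \<and>
     (\<exists>W a m r. open W \<and> U \<times> V \<subseteq> W \<and> nondegenerate_phase W \<phi> \<and>
        a \<in> symbol_class m W \<and> smooth_on W r \<and>
        (\<forall>f\<in>compact_distributions V.
           T f \<in> distributions U \<and>
           (\<forall>g\<in>test_functions U.
              smooth_on V (osc_transpose \<phi> a g) \<and>
              T f g = f (\<lambda>v. osc_transpose \<phi> a g v + (LINT u|lborel. r (u, v) * g u)))))"

section \<open>Fold and cusp singularities\<close>

text \<open>
  Leibniz formula for the determinant of a linear map between Euclidean spaces of equal dimension,
  with respect to the standard bases matched by some bijection \<open>\<beta>\<close>; another choice of \<open>\<beta>\<close> can only
  change the sign, uniformly in the map.
\<close>

definition eucl_det :: "('a::euclidean_space \<Rightarrow> 'b::euclidean_space) \<Rightarrow> real" where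
  "eucl_det L =
     (let \<beta> = (SOME \<beta>. bij_betw \<beta> (Basis :: 'b set) (Basis :: 'a set)) in
      \<Sum>\<pi> | \<pi> permutes (Basis :: 'b set). of_int (sign \<pi>) * (\<Prod>b\<in>Basis. L (\<beta> (\<pi> b)) \<bullet> b))"

definition jac_det :: "('a::euclidean_space \<Rightarrow> 'b::euclidean_space) \<Rightarrow> 'a \<Rightarrow> real" where
  "jac_det f p = eucl_det (frechet_derivative f (at p))"

definition ker_d :: "('a::euclidean_space \<Rightarrow> 'b::real_normed_vector) \<Rightarrow> 'a \<Rightarrow> 'a set" where
  "ker_d f p = {v. frechet_derivative f (at p) v = 0}"

definition S1 :: "'a::euclidean_space set \<Rightarrow> ('a \<Rightarrow> 'b::euclidean_space) \<Rightarrow> 'a set" where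
  "S1 M f = {p\<in>M. jac_det f p = 0 \<and> frechet_derivative (jac_det f) (at p) \<noteq> (\<lambda>_. 0)}"

text \<open>
  Near each of its points \<open>S1 M f\<close> is the regular zero set of \<open>jac_det f\<close>, so its tangent space at
  \<open>p\<close> is \<open>ker_d (jac_det f) p\<close>.
\<close>

definition fold_point :: "'a::euclidean_space set \<Rightarrow> ('a \<Rightarrow> 'b::euclidean_space) \<Rightarrow> 'a \<Rightarrow> bool" where
  "fold_point M f p \<longleftrightarrow>
     p \<in> S1 M f \<and> {a + b | a b. a \<in> ker_d f p \<and> b \<in> ker_d (jac_det f) p} = UNIV"

text \<open>
  The differential at \<open>p\<close> of the function \<open>dK(v)\<close> on \<open>S1 M f\<close> is the restriction to the tangent space
  of the differential of its ambient extension. Whether it vanishes does not depend on the choice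
  of \<open>v\<close> and \<open>K\<close>.
\<close>

definition cusp_point :: "'a::euclidean_space set \<Rightarrow> ('a \<Rightarrow> 'b::euclidean_space) \<Rightarrow> 'a \<Rightarrow> bool" where
  "cusp_point M f p \<longleftrightarrow>
     p \<in> S1 M f \<and> ker_d f p \<subseteq> ker_d (jac_det f) p \<and>
     (\<exists>N v K. open N \<and> p \<in> N \<and> N \<subseteq> M \<and>
        smooth_on N (v :: 'a \<Rightarrow> 'a) \<and> smooth_on N (K :: 'a \<Rightarrow> real) \<and>
        (\<forall>s\<in>S1 M f \<inter> N. v s \<noteq> 0 \<and> v s \<in> ker_d f s \<and>
           K s = 0 \<and> frechet_derivative K (at s) \<noteq> (\<lambda>_. 0)) \<and>
        (\<exists>w\<in>ker_d (jac_det f) p.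
           frechet_derivative (\<lambda>s. frechet_derivative K (at s) (v s)) (at p) w \<noteq> 0))"

text \<open>For open \<open>P\<close> one may take \<open>M = P\<close> in the next two definitions.\<close>

definition fold_singularity :: "'a::euclidean_space set \<Rightarrow> ('a \<Rightarrow> 'b::euclidean_space) \<Rightarrow> bool" where
  "fold_singularity P f \<longleftrightarrow>
     DIM('a) = DIM('b) \<and>
     (\<exists>M. open M \<and> P \<subseteq> M \<and> smooth_on M f \<and>
        (\<forall>p\<in>P. jac_det f p = 0 \<longrightarrow> fold_point M f p))"

definition cusp_singularity :: "'a::euclidean_space set \<Rightarrow> ('a \<Rightarrow> 'b::euclidean_space) \<Rightarrow> bool" where
  "cusp_singularity P f \<longleftrightarrow>
     DIM('a) = DIM('b) \<and>
     (\<exists>M. open M \<and> P \<subseteq> M \<and> smooth_on M f \<and>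
        (\<forall>p\<in>P. jac_det f p = 0 \<longrightarrow> fold_point M f p \<or> cusp_point M f p))"

definition smooth_parametrization ::
  "'a::euclidean_space set \<Rightarrow> ('a \<Rightarrow> 'b::euclidean_space) \<Rightarrow> 'b set \<Rightarrow> bool" where
  "smooth_parametrization P \<kappa> C \<longleftrightarrow>
     smooth_on P \<kappa> \<and> (\<forall>p\<in>P. inj (frechet_derivative \<kappa> (at p))) \<and>
     (\<exists>\<kappa>'. homeomorphism P C \<kappa> \<kappa>')"

section \<open>Eigenvalues\<close>

definition charpoly :: "real ^ 'n ^ 'n \<Rightarrow> real poly" where
  "charpoly A = det (\<chi> i j. (if i = j then [:0, 1:] else 0) - [:A $ i $ j:])"

definition eigenvalue :: "real ^ 'n ^ 'n \<Rightarrow> real \<Rightarrow> bool" where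
  "eigenvalue A l \<longleftrightarrow> (\<exists>v. v \<noteq> 0 \<and> A *v v = l *\<^sub>R v)"

definition num_pos_eigenvalues :: "real ^ 'n ^ 'n \<Rightarrow> nat" where
  "num_pos_eigenvalues A = (\<Sum>l | eigenvalue A l \<and> 0 < l. order l (charpoly A))"

definition num_neg_eigenvalues :: "real ^ 'n ^ 'n \<Rightarrow> nat" where
  "num_neg_eigenvalues A = (\<Sum>l | eigenvalue A l \<and> l < 0. order l (charpoly A))"

section \<open>The hypersurface and the Radon transform\<close>

text \<open>
  The ambient space of dimension \<open>n = CARD('m) + 1\<close> is \<open>real ^ 'm option\<close>, the coordinate \<open>None\<close>
  being the last one and the coordinates \<open>Some i\<close> the first \<open>n - 1\<close>.
\<close>

definition graph_point :: "(real ^ 'm \<Rightarrow> real) \<Rightarrow> real ^ 'm \<Rightarrow> real ^ ('m::finite option)" where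
  "graph_point q y = (\<chi> i. case i of None \<Rightarrow> q y | Some j \<Rightarrow> y $ j)"

definition hypersurface ::
  "(real ^ 'm) set \<Rightarrow> (real ^ 'm \<Rightarrow> real) \<Rightarrow> (real ^ ('m::finite option)) set" where
  "hypersurface \<Omega> q = graph_point q ` \<Omega>"

definition hessian :: "('a::euclidean_space \<Rightarrow> real) \<Rightarrow> 'a \<Rightarrow> 'a \<Rightarrow> 'a \<Rightarrow> real" where
  "hessian q y v w = frechet_derivative (\<lambda>z. frechet_derivative q (at z) v) (at y) w"

definition strictly_convex_graph :: "'a::euclidean_space set \<Rightarrow> ('a \<Rightarrow> real) \<Rightarrow> bool" where
  "strictly_convex_graph \<Omega> q \<longleftrightarrow>
     (\<forall>y\<in>\<Omega>. \<forall>v. v \<noteq> 0 \<longrightarrow> hessian q y v v > 0) \<or>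
     (\<forall>y\<in>\<Omega>. \<forall>v. v \<noteq> 0 \<longrightarrow> hessian q y v v < 0)"

definition quad :: "(real ^ 'm \<Rightarrow> real) \<Rightarrow> real ^ ('m option) ^ ('m::finite option) \<Rightarrow>
    real ^ 'm \<Rightarrow> real ^ ('m option) \<Rightarrow> real" where
  "quad q A y x = (x - graph_point q y) \<bullet> (A *v (x - graph_point q y))"

definition radon_phase :: "(real ^ 'm \<Rightarrow> real) \<Rightarrow> real ^ ('m option) ^ ('m::finite option) \<Rightarrow>
    (real ^ 'm) \<times> real \<Rightarrow> real ^ ('m option) \<Rightarrow> real \<Rightarrow> real" where
  "radon_phase q A = (\<lambda>(y, t) x \<omega>. \<omega> * (t - quad q A y x))"

text \<open>
  Weak form of \<open>R f(y, t) = \<integral> \<integral> norm (grad\<^sub>x \<psi>) f(x) exp (i \<psi>) dx d\<omega>\<close>. The phase has no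
  singularity at \<open>\<omega> = 0\<close>, but the amplitude \<open>norm (grad\<^sub>x \<psi>)\<close> is not smooth there: it is a symbol only
  after a cut-off near \<open>\<omega> = 0\<close>, which changes the kernel by a smooth function.
\<close>

definition radon_transform ::
  "(real ^ 'm \<Rightarrow> real) \<Rightarrow> real ^ ('m option) ^ ('m::finite option) \<Rightarrow>
   ((real ^ ('m option) \<Rightarrow> complex) \<Rightarrow> complex) \<Rightarrow> (((real ^ 'm) \<times> real \<Rightarrow> complex) \<Rightarrow> complex)" where
  "radon_transform q A f =
     (\<lambda>g. f (osc_transpose (radon_phase q A)
               (\<lambda>((u, x), \<omega>). of_real (norm (grad (\<lambda>x. radon_phase q A u x \<omega>) x))) g))"

text \<open>
  Global coordinates \<open>(y, x, \<omega>)\<close> on the canonical relation, with \<open>t = quad q A y x\<close>. The projections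
  of the relation to the two cotangent bundles are \<open>fst\<close> and \<open>snd\<close>.
\<close>

definition relation_params ::
  "(real ^ 'm) set \<Rightarrow> (real ^ 'm \<Rightarrow> real) \<Rightarrow> real ^ ('m option) ^ ('m::finite option) \<Rightarrow>
   ((real ^ 'm) \<times> (real ^ ('m option)) \<times> real) set" where
  "relation_params \<Omega> q A =
     {(y, x, \<omega>). y \<in> \<Omega> \<and> x \<notin> hypersurface \<Omega> q \<and> \<omega> \<noteq> 0 \<and> quad q A y x > 0}"

definition relation_chart ::
  "(real ^ 'm \<Rightarrow> real) \<Rightarrow> real ^ ('m option) ^ ('m::finite option) \<Rightarrow>
   (real ^ 'm) \<times> (real ^ ('m option)) \<times> real \<Rightarrow>
   (((real ^ 'm) \<times> real) \<times> ((real ^ 'm) \<times> real)) \<times> ((real ^ ('m option)) \<times> (real ^ ('m option)))" where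
  "relation_chart q A = (\<lambda>(y, x, \<omega>). let u = (y, quad q A y x) in
     ((u, grad (\<lambda>u. radon_phase q A u x \<omega>) u),
      (x, - grad (\<lambda>x. radon_phase q A u x \<omega>) x)))"

end

theory Submission
  imports Defs
begin

text \<open>
  Write \<open>\<gamma> y\<close> for the point of the graph over \<open>y\<close>, \<open>z = x - \<gamma> y\<close> for the offset, \<open>Q = z \<bullet> A z\<close>,
  \<open>\<nu> = (- \<nabla>q, 1)\<close> for the normal at \<open>\<gamma> y\<close> and \<open>h = z \<bullet> \<nu>\<close> for the height of \<open>x\<close> over the tangent plane.

  The operator. The phase \<open>\<omega> (t - Q)\<close> is nondegenerate because of its term \<open>\<omega> t\<close>, and for \<open>x \<noteq> \<gamma> y\<close> the
  amplitude \<open>\<bar>\<omega>\<bar> \<bar>2 A z\<bar>\<close> becomes a symbol of order one once \<open>\<bar>\<omega>\<bar>\<close> is smoothed at the origin. Pair the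
  kernel with a test function \<open>g\<close> of \<open>(y, t)\<close>. Since the phase is linear in \<open>t\<close>, integration by parts
  trades the operator \<open>1 - \<partial>\<^sub>t\<partial>\<^sub>t\<close> on \<open>g\<close> for a factor \<open>1 + \<omega>\<^sup>2\<close>; two such steps make the frequency
  integral converge absolutely and leave
  \<open>\<integral> k (t - Q) \<bar>2 A z\<bar> (1 - \<partial>\<^sub>t\<partial>\<^sub>t)\<^sup>2 g dy dt\<close> with a continuous \<open>k\<close>. After the shift \<open>t = Q + \<tau>\<close> only
  smooth factors depend on \<open>x\<close>, so this is a smooth function of \<open>x\<close> off the part of the graph over the
  support of \<open>g\<close>, and each of its derivatives is bounded by finitely many derivatives of \<open>g\<close>
  (\<open>iter_pd_Jsum\<close>, \<open>Jsum_derivs_bounded\<close>). Hence \<open>R f\<close> is a distribution. The frequencies that the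
  smoothing removes lie in a compact interval and contribute a smooth kernel (\<open>transposed_split\<close>).

  The canonical relation. The parameters \<open>(y, x, \<omega>)\<close> are among the coordinates of the covectors, so the
  parametrization has a linear left inverse (\<open>radon_smooth_parametrization\<close>).

  The projections. The offset splits as \<open>z = h e + d\<gamma> u\<close> with the vertical unit vector \<open>e\<close> and the base
  part \<open>u\<close> of \<open>z\<close>. Inserting this into the row of \<open>dt\<close> in the differential of the left projection, or
  into the column of \<open>d\<omega>\<close> in that of the right projection, shows that this row or column is \<open>h\<close> times
  a regular one, up to a combination of the others. So both Jacobian determinants are \<open>h\<close> times a
  nonvanishing function (\<open>left_determinant\<close>, \<open>right_determinant\<close>), and \<open>h\<close> is a defining function of both
  critical sets. On \<open>h = 0\<close> the offset is the nonzero tangent vector \<open>d\<gamma> u\<close>, and the kernels are lines.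
  On the right the kernel is spanned by \<open>(u, 0, \<omega>)\<close>, and \<open>dh\<close> takes there the value \<open>- u \<bullet> Hess q u\<close>,
  nonzero by strict convexity: a fold. On the left it is spanned by \<open>(0, A\<^sup>-\<^sup>1 \<nu>, 0)\<close>, where \<open>dh\<close> takes
  the value \<open>F = \<nu> \<bullet> A\<^sup>-\<^sup>1 \<nu>\<close>: a fold unless \<open>F = 0\<close>. If \<open>F = 0\<close>, the base part \<open>w\<close> of \<open>A\<^sup>-\<^sup>1 \<nu>\<close> is not
  zero, for otherwise \<open>F\<close> would be its last component and \<open>A\<^sup>-\<^sup>1 \<nu>\<close> would vanish; so
  \<open>dF = - 2 w \<bullet> Hess q\<close> is not zero by strict convexity, and this persists along the critical set
  because \<open>h\<close> has a nonzero derivative in \<open>x\<close> alone: a cusp (\<open>radon_left_cusp\<close>).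
\<close>

section \<open>A calculus of smooth functions\<close>

abbreviation pd :: "'a::euclidean_space \<Rightarrow> ('a \<Rightarrow> 'b::real_normed_vector) \<Rightarrow> 'a \<Rightarrow> 'b" where
  "pd b f \<equiv> (\<lambda>x. frechet_derivative f (at x) b)"

lemma frechet_derivative_eqI:
  "(f has_derivative D) (at x) \<Longrightarrow> frechet_derivative f (at x) = D"
  by (metis frechet_derivative_at)

lemma has_derivative_frechet:
  "f differentiable_on W \<Longrightarrow> open W \<Longrightarrow> x \<in> W \<Longrightarrow> (f has_derivative frechet_derivative f (at x)) (at x)"
  using at_within_open[of x W] by (auto simp: differentiable_on_def frechet_derivative_works)

lemma frechet_derivative_cong_open:
  assumes "open W" "x \<in> W" "\<And>y. y \<in> W \<Longrightarrow> f y = g y"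
  shows "frechet_derivative f (at x) = frechet_derivative g (at x)"
proof -
  have "(f has_derivative D) (at x) \<longleftrightarrow> (g has_derivative D) (at x)" for D
    using has_derivative_transform_within_open[OF _ assms(1,2)] assms(3) by metis
  then show ?thesis by (simp add: frechet_derivative_def)
qed

lemma iter_pd_cong_open:
  assumes "open W" "\<And>y. y \<in> W \<Longrightarrow> f y = g y" "x \<in> W"
  shows "iter_pd bs f x = iter_pd bs g x"
  using assms(3)
proof (induction bs arbitrary: x)
  case Nil
  then show ?case using assms(2) by simp
next
  case (Cons b bs)
  then show ?case using frechet_derivative_cong_open[OF assms(1)] by (metis iter_pd.simps(2))
qed

lemma iter_pd_append: "iter_pd (as @ bs) f = iter_pd as (iter_pd bs f)"
  by (induction as) auto

lemma smooth_on_open_iff: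
  "open W \<Longrightarrow> smooth_on W f \<longleftrightarrow> (\<forall>bs. set bs \<subseteq> Basis \<longrightarrow> iter_pd bs f differentiable_on W)"
  unfolding smooth_on_def by (meson differentiable_on_subset subset_refl)

lemma smooth_on_subset: "smooth_on W f \<Longrightarrow> X \<subseteq> W \<Longrightarrow> smooth_on X f"
  unfolding smooth_on_def by (meson subset_trans)

lemma differentiable_onI:
  "(\<And>x. x \<in> W \<Longrightarrow> (f has_derivative D x) (at x)) \<Longrightarrow> f differentiable_on W"
  by (meson differentiable_at_imp_differentiable_on differentiable_def)

lemma differentiable_on_cong:
  assumes "f differentiable_on W" "\<And>x. x \<in> W \<Longrightarrow> g x = f x"
  shows "g differentiable_on W"
  unfolding differentiable_on_def
proof
  fix x assume "x \<in> W"
  then show "g differentiable (at x within W)"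
    using assms differentiable_transform_within[of f x W 1 g] by (auto simp: differentiable_on_def)
qed

text \<open>
  Every closure property below comes from exhibiting a family of differentiable functions that
  contains the partial derivatives of its members. This avoids formulas for higher derivatives.
\<close>

lemma smooth_on_coinduct:
  assumes W: "open W" and f: "f \<in> F"
    and diff: "\<And>f. f \<in> F \<Longrightarrow> f differentiable_on W"
    and step: "\<And>f b. f \<in> F \<Longrightarrow> b \<in> Basis \<Longrightarrow> \<exists>g\<in>F. \<forall>x\<in>W. frechet_derivative f (at x) b = g x"
  shows "smooth_on W f"
proof -
  have "\<exists>g\<in>F. \<forall>x\<in>W. iter_pd bs f x = g x" if "set bs \<subseteq> Basis" for bs
    using that
  proof (induction bs)
    case Nil
    then show ?case using f by auto
  next
    case (Cons b bs)
    then obtain g where g: "g \<in> F" "\<forall>x\<in>W. iter_pd bs f x = g x" by auto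
    obtain h where h: "h \<in> F" "\<forall>x\<in>W. frechet_derivative g (at x) b = h x"
      using step[OF g(1), of b] Cons.prems by auto
    have "frechet_derivative (iter_pd bs f) (at x) = frechet_derivative g (at x)" if "x \<in> W" for x
      using frechet_derivative_cong_open[OF W that] g(2) by blast
    then show ?case using h by auto
  qed
  note * = this
  have "iter_pd bs f differentiable_on W" if "set bs \<subseteq> Basis" for bs
  proof -
    obtain g where "g \<in> F" "\<forall>x\<in>W. iter_pd bs f x = g x"
      using *[OF \<open>set bs \<subseteq> Basis\<close>] by blast
    then show ?thesis using differentiable_on_cong[OF diff, of g] by simp
  qed
  then show ?thesis using W by (simp add: smooth_on_open_iff)
qed

lemma smooth_on_differentiable: "smooth_on W f \<Longrightarrow> f differentiable_on W"
  unfolding smooth_on_def using differentiable_on_subset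
  by (metis empty_set empty_subsetI iter_pd.simps(1))

lemma smooth_on_continuous: "smooth_on W f \<Longrightarrow> continuous_on W f"
  by (simp add: differentiable_imp_continuous_on smooth_on_differentiable)

lemma smooth_on_has_derivative:
  "smooth_on W f \<Longrightarrow> open W \<Longrightarrow> x \<in> W \<Longrightarrow> (f has_derivative frechet_derivative f (at x)) (at x)"
  using has_derivative_frechet smooth_on_differentiable by blast

lemma smooth_on_iter_pd:
  assumes "smooth_on W f" "set as \<subseteq> Basis"
  shows "smooth_on W (iter_pd as f)"
proof -
  obtain O' where "open O'" "W \<subseteq> O'" "\<And>bs. set bs \<subseteq> Basis \<Longrightarrow> iter_pd bs f differentiable_on O'"
    using assms(1) unfolding smooth_on_def by blast
  then show ?thesis
    unfolding smooth_on_def using assms(2)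
    by (intro exI[of _ O']) (auto simp flip: iter_pd_append)
qed

lemma smooth_on_pd: "smooth_on W f \<Longrightarrow> b \<in> Basis \<Longrightarrow> smooth_on W (pd b f)"
  using smooth_on_iter_pd[of W f "[b]"] by simp

lemma smooth_on_coinduct_upto:
  assumes W: "open W" and f: "f \<in> F"
    and diff: "\<And>f. f \<in> F \<Longrightarrow> f differentiable_on W"
    and step: "\<And>f b. f \<in> F \<Longrightarrow> b \<in> Basis \<Longrightarrow>
       \<exists>g. (g \<in> F \<or> smooth_on W g) \<and> (\<forall>x\<in>W. frechet_derivative f (at x) b = g x)"
  shows "smooth_on W f"
proof (rule smooth_on_coinduct[OF W, where F = "F \<union> {g. smooth_on W g}"])
  show "f \<in> F \<union> {g. smooth_on W g}" using f by blast
  show "f differentiable_on W" if "f \<in> F \<union> {g. smooth_on W g}" for f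
    using that diff smooth_on_differentiable by auto
  show "\<exists>g\<in>F \<union> {g. smooth_on W g}. \<forall>x\<in>W. frechet_derivative f (at x) b = g x"
    if "f \<in> F \<union> {g. smooth_on W g}" "b \<in> Basis" for f b
    using that step[of f b] smooth_on_pd[of W f b] by fastforce
qed

lemma smooth_on_cong:
  assumes "open W" "smooth_on W f" "\<And>x. x \<in> W \<Longrightarrow> g x = f x"
  shows "smooth_on W g"
proof (rule smooth_on_coinduct_upto[OF assms(1), where F = "{g}"])
  show "h differentiable_on W" if "h \<in> {g}" for h
    using that assms differentiable_on_cong[OF smooth_on_differentiable[OF assms(2)]] by auto
  show "\<exists>k. (k \<in> {g} \<or> smooth_on W k) \<and> (\<forall>x\<in>W. frechet_derivative h (at x) b = k x)"
    if "h \<in> {g}" "b \<in> Basis" for h b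
    using that frechet_derivative_cong_open[OF assms(1), of _ g f] assms(3) smooth_on_pd[OF assms(2), of b]
    by (intro exI[of _ "pd b f"]) auto
qed auto

lemma smooth_on_const: "smooth_on W (\<lambda>x. c)"
proof -
  have "smooth_on UNIV (\<lambda>x. c)"
    by (rule smooth_on_coinduct[where F = "range (\<lambda>c x. c)"]) auto
  then show ?thesis by (rule smooth_on_subset) auto
qed

lemma smooth_on_linear:
  assumes "bounded_linear f"
  shows "smooth_on W f"
proof -
  have "smooth_on UNIV f"
  proof (rule smooth_on_coinduct_upto[where F = "{f}"])
    show "\<exists>k. (k \<in> {f} \<or> smooth_on UNIV k) \<and> (\<forall>x\<in>UNIV. frechet_derivative h (at x) b = k x)"
      if "h \<in> {f}" for h b
      using that frechet_derivative_eqI[OF bounded_linear.has_derivative[OF assms has_derivative_ident]]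
      by (intro exI[of _ "\<lambda>x. f b"]) (auto intro: smooth_on_const)
  qed (use assms in \<open>auto simp: differentiable_on_def bounded_linear_imp_differentiable\<close>)
  then show ?thesis by (rule smooth_on_subset) auto
qed

lemma smooth_on_add:
  assumes "open W" "smooth_on W f" "smooth_on W g"
  shows "smooth_on W (\<lambda>x. f x + g x)"
proof (rule smooth_on_coinduct[OF assms(1), where F = "{\<lambda>x. f x + g x |f g. smooth_on W f \<and> smooth_on W g}"])
  show "h differentiable_on W" if "h \<in> {\<lambda>x. f x + g x |f g. smooth_on W f \<and> smooth_on W g}" for h
    using that smooth_on_differentiable by (fastforce intro: derivative_intros)
  show "\<exists>k\<in>{\<lambda>x. f x + g x |f g. smooth_on W f \<and> smooth_on W g}.
         \<forall>x\<in>W. frechet_derivative h (at x) b = k x"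
    if "h \<in> {\<lambda>x. f x + g x |f g. smooth_on W f \<and> smooth_on W g}" "b \<in> Basis" for h b
  proof -
    obtain f g where h: "h = (\<lambda>x. f x + g x)" "smooth_on W f" "smooth_on W g" using \<open>h \<in> _\<close> by blast
    have "frechet_derivative h (at x) b = pd b f x + pd b g x" if "x \<in> W" for x
      unfolding h(1)
      using frechet_derivative_eqI[OF has_derivative_add[OF smooth_on_has_derivative[OF h(2) assms(1) that]
              smooth_on_has_derivative[OF h(3) assms(1) that]]] by simp
    moreover have "smooth_on W (pd b f)" "smooth_on W (pd b g)"
      using h smooth_on_pd \<open>b \<in> Basis\<close> by blast+
    ultimately show ?thesis by (intro bexI[of _ "\<lambda>x. pd b f x + pd b g x"]) auto
  qed
qed (use assms in auto)

lemma smooth_on_sum: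
  assumes "open W" "\<And>i. i \<in> I \<Longrightarrow> smooth_on W (f i)"
  shows "smooth_on W (\<lambda>x. \<Sum>i\<in>I. f i x)"
  using assms(2)
  by (induction I rule: infinite_finite_induct) (auto intro: smooth_on_const smooth_on_add[OF assms(1)])

text \<open>
  The Leibniz rule and the chain rule turn a product or a composition into a finite sum of functions
  of the same form, and the family of all such sums is closed under differentiation.
\<close>

lemma sum_list_has_derivative:
  assumes "\<And>g. g \<in> set gs \<Longrightarrow> (g has_derivative D g) (at x)"
  shows "((\<lambda>x. \<Sum>g\<leftarrow>gs. g x) has_derivative (\<lambda>v. \<Sum>g\<leftarrow>gs. D g v)) (at x)"
  using assms by (induction gs) (auto intro: has_derivative_add)

lemma smooth_on_span:
  assumes W: "open W" and f: "f \<in> B" and diff: "\<And>f. f \<in> B \<Longrightarrow> f differentiable_on W"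
    and step: "\<And>f b. f \<in> B \<Longrightarrow> b \<in> Basis \<Longrightarrow>
       \<exists>gs. set gs \<subseteq> B \<and> (\<forall>x\<in>W. frechet_derivative f (at x) b = (\<Sum>g\<leftarrow>gs. g x))"
  shows "smooth_on W f"
proof (rule smooth_on_coinduct[OF W, where F = "{\<lambda>x. \<Sum>g\<leftarrow>gs. g x |gs. set gs \<subseteq> B}"])
  have "f = (\<lambda>x. \<Sum>g\<leftarrow>[f]. g x)" by simp
  then show "f \<in> {\<lambda>x. \<Sum>g\<leftarrow>gs. g x |gs. set gs \<subseteq> B}" using f by (intro CollectI exI[of _ "[f]"]) simp
  have D: "((\<lambda>x. \<Sum>g\<leftarrow>gs. g x) has_derivative (\<lambda>v. \<Sum>g\<leftarrow>gs. frechet_derivative g (at x) v)) (at x)"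
    if "set gs \<subseteq> B" "x \<in> W" for gs x
    using that has_derivative_frechet[OF diff W] by (intro sum_list_has_derivative) blast
  fix h assume "h \<in> {\<lambda>x. \<Sum>g\<leftarrow>gs. g x |gs. set gs \<subseteq> B}"
  then obtain gs where h: "h = (\<lambda>x. \<Sum>g\<leftarrow>gs. g x)" "set gs \<subseteq> B" by blast
  show "h differentiable_on W" unfolding h(1) by (rule differentiable_onI[OF D[OF h(2)]])
  fix b :: 'a assume b: "b \<in> Basis"
  have "\<forall>g\<in>B. \<exists>ks. set ks \<subseteq> B \<and> (\<forall>x\<in>W. frechet_derivative g (at x) b = (\<Sum>k\<leftarrow>ks. k x))"
    using step b by blast
  from bchoice[OF this] obtain G where
    G: "\<forall>g\<in>B. set (G g) \<subseteq> B \<and> (\<forall>x\<in>W. frechet_derivative g (at x) b = (\<Sum>k\<leftarrow>G g. k x))" by blast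
  let ?ks = "concat (map G gs)"
  have "frechet_derivative h (at x) b = (\<Sum>k\<leftarrow>?ks. k x)" if "x \<in> W" for x
  proof -
    have "(\<Sum>g\<leftarrow>gs. frechet_derivative g (at x) b) = (\<Sum>k\<leftarrow>?ks. k x)"
      using h(2) G that by (induction gs) auto
    then show ?thesis unfolding h(1) frechet_derivative_eqI[OF D[OF h(2) that]] .
  qed
  moreover have "set ?ks \<subseteq> B" using G h(2) by auto
  ultimately show "\<exists>k\<in>{\<lambda>x. \<Sum>g\<leftarrow>gs. g x |gs. set gs \<subseteq> B}. \<forall>x\<in>W. frechet_derivative h (at x) b = k x"
    by (intro bexI[of _ "\<lambda>x. \<Sum>k\<leftarrow>?ks. k x"] ballI CollectI exI[of _ ?ks] conjI refl)
qed

lemma smooth_on_bilinear: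
  assumes W: "open W" and pr: "bounded_bilinear pr" and "smooth_on W f" "smooth_on W g"
  shows "smooth_on W (\<lambda>x. pr (f x) (g x))"
proof (rule smooth_on_span[OF W, where B = "{\<lambda>x. pr (f x) (g x) |f g. smooth_on W f \<and> smooth_on W g}"])
  fix h assume "h \<in> {\<lambda>x. pr (f x) (g x) |f g. smooth_on W f \<and> smooth_on W g}"
  then obtain f g where h: "h = (\<lambda>x. pr (f x) (g x))" and f: "smooth_on W f" and g: "smooth_on W g" by blast
  have D: "(h has_derivative (\<lambda>v. pr (f x) (pd v g x) + pr (pd v f x) (g x))) (at x)" if "x \<in> W" for x
    unfolding h by (rule bounded_bilinear.FDERIV[OF pr smooth_on_has_derivative[OF f W that]
          smooth_on_has_derivative[OF g W that]])
  show "h differentiable_on W" by (rule differentiable_onI[OF D])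
  fix b :: 'a assume b: "b \<in> Basis"
  show "\<exists>gs. set gs \<subseteq> {\<lambda>x. pr (f x) (g x) |f g. smooth_on W f \<and> smooth_on W g} \<and>
          (\<forall>x\<in>W. frechet_derivative h (at x) b = (\<Sum>g\<leftarrow>gs. g x))"
    using f g smooth_on_pd[OF f b] smooth_on_pd[OF g b] frechet_derivative_eqI[OF D]
    by (intro exI[of _ "[\<lambda>x. pr (f x) (pd b g x), \<lambda>x. pr (pd b f x) (g x)]"]) auto
qed (use assms in blast)

lemmas smooth_on_mult = smooth_on_bilinear[OF _ bounded_bilinear_mult]
  and smooth_on_scaleR = smooth_on_bilinear[OF _ bounded_bilinear_scaleR]
  and smooth_on_inner = smooth_on_bilinear[OF _ bounded_bilinear_inner]

lemma smooth_on_compose: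
  assumes W: "open W" and Y: "open Y" and f: "smooth_on Y f" and g: "smooth_on W g" and gW: "g ` W \<subseteq> Y"
  shows "smooth_on W (\<lambda>x. f (g x))"
proof -
  \<comment> \<open>The real factor \<open>u\<close> collects the components of \<open>\<partial>g\<close> that the chain rule produces.\<close>
  let ?B = "{\<lambda>x. u x *\<^sub>R f (g x) |(u :: 'a \<Rightarrow> real) (f :: 'b \<Rightarrow> 'c). smooth_on W u \<and> smooth_on Y f}"
  have "smooth_on W (\<lambda>x. 1 *\<^sub>R f (g x))"
  proof (rule smooth_on_span[OF W, where B = ?B])
    show "(\<lambda>x. 1 *\<^sub>R f (g x)) \<in> ?B"
      using f smooth_on_const[of W 1] by (intro CollectI exI[of _ "\<lambda>_. 1"] exI[of _ f]) simp
    fix h assume "h \<in> ?B"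
    then obtain u f where h: "h = (\<lambda>x. u x *\<^sub>R f (g x))" and u: "smooth_on W (u :: 'a \<Rightarrow> real)"
      and f: "smooth_on Y (f :: 'b \<Rightarrow> 'c)" by blast
    have f': "(f has_derivative frechet_derivative f (at (g x))) (at (g x))" if "x \<in> W" for x
      using smooth_on_has_derivative[OF f Y, of "g x"] gW that by auto
    have D: "(h has_derivative (\<lambda>v. u x *\<^sub>R frechet_derivative f (at (g x)) (pd v g x) + pd v u x *\<^sub>R f (g x))) (at x)"
      if "x \<in> W" for x
      unfolding h
      by (rule has_derivative_scaleR[OF smooth_on_has_derivative[OF u W that]
            has_derivative_compose[OF smooth_on_has_derivative[OF g W that] f'[OF that]]])
    show "h differentiable_on W" by (rule differentiable_onI[OF D])
    fix b :: 'a assume b: "b \<in> Basis"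
    obtain cs where cs: "set cs = (Basis :: 'b set)" "distinct cs" using finite_distinct_list[OF finite_Basis] by blast
    let ?g = "\<lambda>c x. (u x * (pd b g x \<bullet> c)) *\<^sub>R pd c f (g x)"
    let ?gs = "(\<lambda>x. pd b u x *\<^sub>R f (g x)) # map ?g cs"
    have "?g c \<in> ?B" if "c \<in> Basis" for c
      using smooth_on_mult[OF W u smooth_on_inner[OF W smooth_on_pd[OF g b] smooth_on_const[of W c]]] smooth_on_pd[OF f that]
      by (intro CollectI exI[of _ "\<lambda>x. u x * (pd b g x \<bullet> c)"] exI[of _ "pd c f"]) simp
    moreover have "(\<lambda>x. pd b u x *\<^sub>R f (g x)) \<in> ?B"
      using smooth_on_pd[OF u b] f by (intro CollectI exI[of _ "pd b u"] exI[of _ f]) simp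
    ultimately have "set ?gs \<subseteq> ?B" using cs by auto
    moreover have "frechet_derivative h (at x) b = (\<Sum>g\<leftarrow>?gs. g x)" if "x \<in> W" for x
    proof -
      have l: "linear (frechet_derivative f (at (g x)))" using f'[OF that] has_derivative_linear by blast
      have "frechet_derivative f (at (g x)) (pd b g x) = (\<Sum>c\<in>Basis. (pd b g x \<bullet> c) *\<^sub>R pd c f (g x))"
        by (subst euclidean_representation[symmetric, of "pd b g x"])
           (simp only: linear_sum[OF l] linear_scale[OF l])
      then have "u x *\<^sub>R frechet_derivative f (at (g x)) (pd b g x) = (\<Sum>c\<in>Basis. ?g c x)"
        by (simp add: scaleR_sum_right)
      also have "\<dots> = (\<Sum>c\<leftarrow>cs. ?g c x)" using sum_list_distinct_conv_sum_set[OF cs(2)] cs(1) by metis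
      finally show ?thesis unfolding frechet_derivative_eqI[OF D[OF that]] by (simp add: comp_def add.commute)
    qed
    ultimately show "\<exists>gs. set gs \<subseteq> ?B \<and> (\<forall>x\<in>W. frechet_derivative h (at x) b = (\<Sum>g\<leftarrow>gs. g x))"
      by (intro exI[of _ ?gs] conjI ballI)
  qed
  then show ?thesis by simp
qed

lemma smooth_on_linear_compose:
  assumes "open W" "bounded_linear l" "smooth_on W (g :: 'a::euclidean_space \<Rightarrow> 'b::euclidean_space)"
  shows "smooth_on W (\<lambda>x. l (g x))"
  by (rule smooth_on_compose[OF assms(1) open_UNIV]) (use assms smooth_on_linear in auto)

lemma smooth_on_Pair:
  assumes "open W" "smooth_on W (f :: 'a::euclidean_space \<Rightarrow> 'b::euclidean_space)"
    "smooth_on W (g :: 'a \<Rightarrow> 'c::euclidean_space)"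
  shows "smooth_on W (\<lambda>x. (f x, g x))"
proof -
  have "smooth_on W (\<lambda>x. (f x, 0 :: 'c) + (0 :: 'b, g x))"
    by (intro smooth_on_add smooth_on_linear_compose[where l = "\<lambda>a. (a, 0)"]
        smooth_on_linear_compose[where l = "\<lambda>a. (0, a)"] assms bounded_linear_Pair
        bounded_linear_ident bounded_linear_zero)
  then show ?thesis by simp
qed

lemma smooth_on_diff:
  assumes "open W" "smooth_on W (f :: 'a::euclidean_space \<Rightarrow> 'b::real_normed_vector)" "smooth_on W g"
  shows "smooth_on W (\<lambda>x. f x - g x)"
proof -
  have "smooth_on W (\<lambda>x. f x + (-1) *\<^sub>R g x)"
    by (intro smooth_on_add smooth_on_scaleR assms smooth_on_const)
  then show ?thesis by simp
qed

lemma smooth_on_componentwise: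
  fixes f :: "'a::euclidean_space \<Rightarrow> 'b::euclidean_space"
  assumes "open W" "\<And>b. b \<in> Basis \<Longrightarrow> smooth_on W (\<lambda>x. f x \<bullet> b)"
  shows "smooth_on W f"
proof -
  have "smooth_on W (\<lambda>x. \<Sum>b\<in>Basis. (f x \<bullet> b) *\<^sub>R b)"
    by (intro smooth_on_sum smooth_on_scaleR assms smooth_on_const)
  then show ?thesis by (simp add: euclidean_representation)
qed

lemma smooth_on_pd_any:
  assumes "open W" "smooth_on W f"
  shows "smooth_on W (\<lambda>x. frechet_derivative f (at x) v)"
proof (rule smooth_on_cong[OF assms(1)])
  show "smooth_on W (\<lambda>x. \<Sum>b\<in>Basis. (v \<bullet> b) *\<^sub>R pd b f x)"
    by (intro smooth_on_sum smooth_on_scaleR assms smooth_on_const smooth_on_pd)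
  fix x assume "x \<in> W"
  then have l: "linear (frechet_derivative f (at x))"
    using assms has_derivative_linear smooth_on_has_derivative by blast
  show "frechet_derivative f (at x) v = (\<Sum>b\<in>Basis. (v \<bullet> b) *\<^sub>R pd b f x)"
    by (subst euclidean_representation[symmetric, of v]) (simp only: linear_sum[OF l] linear_scale[OF l])
qed

lemma smooth_on_real_derivatives:
  fixes f :: "nat \<Rightarrow> real \<Rightarrow> 'b::real_normed_vector"
  assumes "open W" "\<And>n x. x \<in> W \<Longrightarrow> (f n has_vector_derivative f (Suc n) x) (at x)"
  shows "smooth_on W (f n)"
proof (rule smooth_on_coinduct[OF assms(1), where F = "range f"])
  fix h assume "h \<in> range f"
  then obtain n where h: "h = f n" by blast
  show "h differentiable_on W"
    using assms(2) unfolding h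
    by (meson differentiableI_vector differentiable_at_imp_differentiable_on)
  fix b :: real assume "b \<in> Basis"
  then have "frechet_derivative h (at x) b = f (Suc n) x" if "x \<in> W" for x
    using frechet_derivative_eqI[OF assms(2)[OF that, unfolded has_vector_derivative_def]] h by simp
  then show "\<exists>g\<in>range f. \<forall>x\<in>W. frechet_derivative h (at x) b = g x" by blast
qed auto

lemma smooth_on_powr: "smooth_on {0<..} (\<lambda>x::real. x powr a)"
proof -
  define c where "c n = (\<Prod>i<n. (a - real i))" for n
  have "smooth_on {0<..} ((\<lambda>n x. c n * x powr (a - real n)) 0)"
  proof (rule smooth_on_real_derivatives)
    fix n and x :: real assume "x \<in> {0<..}"
    then have "((\<lambda>x. c n * x powr (a - real n)) has_real_derivative c n * ((a - real n) * x powr (a - real n - 1))) (at x)"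
      by (intro DERIV_cmult has_real_derivative_powr) auto
    moreover have "a - real n - 1 = a - real (Suc n)" by simp
    moreover have "c n * ((a - real n) * y) = c (Suc n) * y" for y by (simp add: c_def)
    ultimately show "((\<lambda>x. c n * x powr (a - real n)) has_vector_derivative c (Suc n) * x powr (a - real (Suc n))) (at x)"
      unfolding has_real_derivative_iff_has_vector_derivative[symmetric] by metis
  qed auto
  then show ?thesis by (simp add: c_def)
qed

lemma smooth_on_sqrt: "smooth_on {0<..} (sqrt :: real \<Rightarrow> real)"
  by (rule smooth_on_cong[OF _ smooth_on_powr[of "1/2"]]) (auto simp: powr_half_sqrt)

lemma smooth_on_inverse: "smooth_on {0<..} (inverse :: real \<Rightarrow> real)"
  by (rule smooth_on_cong[OF _ smooth_on_powr[of "-1"]]) (auto simp: powr_minus)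

lemma smooth_on_norm:
  fixes f :: "'a::euclidean_space \<Rightarrow> 'b::euclidean_space"
  assumes "open W" "smooth_on W f" "\<And>x. x \<in> W \<Longrightarrow> f x \<noteq> 0"
  shows "smooth_on W (\<lambda>x. norm (f x))"
  unfolding norm_eq_sqrt_inner
  by (rule smooth_on_compose[OF assms(1) _ smooth_on_sqrt]) (use assms in \<open>auto intro: smooth_on_inner\<close>)

section \<open>Differentiation under the integral sign\<close>

lemma integral_compact_support:
  fixes f :: "'u::euclidean_space \<Rightarrow> 'c::euclidean_space"
  assumes "continuous_on UNIV f" "\<And>u. u \<notin> cbox a b \<Longrightarrow> f u = 0"
  shows "integrable lborel f" "(LINT u|lborel. f u) = integral (cbox a b) f"
proof -
  have "integrable lborel (\<lambda>u. indicator (cbox a b) u *\<^sub>R f u)"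
    using assms(1) by (intro borel_integrable_compact) (auto intro: continuous_on_subset)
  moreover have "(\<lambda>u. indicator (cbox a b) u *\<^sub>R f u) = f"
    using assms(2) by (auto simp: fun_eq_iff indicator_def)
  ultimately show i: "integrable lborel f" by simp
  have "(LINT u|lborel. f u) = integral UNIV f" using integral_lborel[OF i] by simp
  also have "\<dots> = integral UNIV (\<lambda>u. if u \<in> cbox a b then f u else 0)"
    using assms(2) by (intro integral_cong) auto
  finally show "(LINT u|lborel. f u) = integral (cbox a b) f"
    by (simp add: Henstock_Kurzweil_Integration.integral_restrict_UNIV)
qed

lemma integrable_continuous_compact:
  fixes f :: "'u::euclidean_space \<Rightarrow> 'c::euclidean_space"
  assumes "continuous_on UNIV f" "compact C" "\<And>u. u \<notin> C \<Longrightarrow> f u = 0"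
  shows "integrable lborel f"
proof -
  obtain a b where "C \<subseteq> cbox a b"
    using assms(2) bounded_subset_cbox_symmetric compact_imp_bounded by metis
  then show ?thesis using integral_compact_support(1)[OF assms(1), of a b] assms(3) by blast
qed

text \<open>
  The common compact support turns the integral into one over a fixed box, where the Leibniz rule
  applies. That rule wants the derivative as a continuous function into the bounded linear maps;
  continuity is checked on the basis.
\<close>

lemma has_derivative_integral_param:
  fixes \<Phi> :: "'x::euclidean_space \<Rightarrow> 'u::euclidean_space \<Rightarrow> 'c::euclidean_space"
  assumes X: "open X" "x0 \<in> X" and C: "compact C" "\<And>x u. x \<in> X \<Longrightarrow> u \<notin> C \<Longrightarrow> \<Phi> x u = 0"
    and D: "\<And>x u. x \<in> X \<Longrightarrow> ((\<lambda>x. \<Phi> x u) has_derivative \<Phi>' x u) (at x)"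
    and cont: "\<And>x. x \<in> X \<Longrightarrow> continuous_on UNIV (\<Phi> x)"
    and contD: "\<And>b. b \<in> Basis \<Longrightarrow> continuous_on (X \<times> UNIV) (\<lambda>(x, u). \<Phi>' x u b)"
  shows "((\<lambda>x. LINT u|lborel. \<Phi> x u) has_derivative (\<lambda>h. LINT u|lborel. \<Phi>' x0 u h)) (at x0)"
proof -
  obtain a b where ab: "C \<subseteq> cbox a b"
    using C(1) bounded_subset_cbox_symmetric compact_imp_bounded by metis
  obtain \<delta> where \<delta>: "\<delta> > 0" "ball x0 \<delta> \<subseteq> X" using X open_contains_ball by blast
  let ?B = "ball x0 \<delta>"
  define F where "F x u = Blinfun (\<Phi>' x u)" for x u
  have F: "blinfun_apply (F x u) = \<Phi>' x u" if "x \<in> X" for x u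
    unfolding F_def using has_derivative_bounded_linear[OF D[OF that]] by (rule bounded_linear_Blinfun_apply)
  have contF: "continuous_on (X \<times> UNIV) (\<lambda>(x, u). F x u)"
    unfolding continuous_on_eq_continuous_within
  proof
    fix p assume "p \<in> X \<times> (UNIV :: 'u set)"
    then have "continuous (at p within X \<times> UNIV) (\<lambda>q. blinfun_apply (case q of (x, u) \<Rightarrow> F x u) i)"
      if "i \<in> Basis" for i
    proof -
      have "continuous (at p within X \<times> UNIV) (\<lambda>(x, u). \<Phi>' x u i)"
        using contD[OF that] \<open>p \<in> _\<close> continuous_on_eq_continuous_within by blast
      then show ?thesis
        by (rule continuous_transform_within[where \<delta> = 1]) (use F \<open>p \<in> _\<close> in auto)
    qed
    then show "continuous (at p within X \<times> UNIV) (\<lambda>(x, u). F x u)"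
      by (intro continuous_blinfun_componentwiseI1)
  qed
  have off: "u \<notin> cbox a b \<Longrightarrow> \<Phi> x u = 0" if "x \<in> X" for x u using C ab that by blast
  have off': "u \<notin> cbox a b \<Longrightarrow> \<Phi>' x0 u = (\<lambda>_. 0)" for u
  proof -
    assume u: "u \<notin> cbox a b"
    have "((\<lambda>x. 0) has_derivative \<Phi>' x0 u) (at x0)"
      using has_derivative_transform_within_open[OF D[OF X(2), of u] X] off u by auto
    then show ?thesis by (metis has_derivative_const has_derivative_unique)
  qed
  have "((\<lambda>x. integral (cbox a b) (\<Phi> x)) has_derivative integral (cbox a b) (F x0)) (at x0 within ?B)"
  proof (rule leibniz_rule)
    show "((\<lambda>x. \<Phi> x t) has_derivative blinfun_apply (F x t)) (at x within ?B)" if "x \<in> ?B" for x t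
      using D F \<delta> that by (metis has_derivative_at_withinI subsetD)
    show "\<Phi> x integrable_on cbox a b" if "x \<in> ?B" for x
      using cont[of x] \<delta> that by (intro integrable_continuous continuous_on_subset[OF cont]) auto
    show "continuous_on (?B \<times> cbox a b) (\<lambda>(x, t). F x t)"
      using contF \<delta> by (rule_tac continuous_on_subset) auto
  qed (use \<delta> in auto)
  then have "((\<lambda>x. integral (cbox a b) (\<Phi> x)) has_derivative integral (cbox a b) (F x0)) (at x0)"
    using \<delta>(1) at_within_open[of x0 ?B] by simp
  moreover have "integral (cbox a b) (\<Phi> x) = (LINT u|lborel. \<Phi> x u)" if "x \<in> X" for x
    using integral_compact_support(2)[OF cont[OF that] off[OF that]] by simp
  ultimately have "((\<lambda>x. LINT u|lborel. \<Phi> x u) has_derivative integral (cbox a b) (F x0)) (at x0)"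
    by (rule has_derivative_transform_within_open[OF _ X])
  moreover have "blinfun_apply (integral (cbox a b) (F x0)) = (\<lambda>h. LINT u|lborel. \<Phi>' x0 u h)"
  proof
    fix h
    have c: "continuous_on UNIV (F x0)"
    proof -
      have "continuous_on UNIV (\<lambda>u. (x0, u))" by (intro continuous_intros)
      then show ?thesis using continuous_on_compose2[OF contF, of UNIV "\<lambda>u. (x0, u)"] X by auto
    qed
    have "blinfun_apply (integral (cbox a b) (F x0)) h = integral (cbox a b) (\<lambda>u. \<Phi>' x0 u h)"
      using F[OF X(2)] c
      by (subst blinfun_apply_integral) (auto intro: integrable_continuous continuous_on_subset)
    also have "\<dots> = (LINT u|lborel. \<Phi>' x0 u h)"
    proof (rule integral_compact_support(2)[symmetric])
      have "continuous_on UNIV (\<lambda>u. blinfun_apply (F x0 u) h)" by (intro continuous_intros c)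
      then show "continuous_on UNIV (\<lambda>u. \<Phi>' x0 u h)" using F[OF X(2)] by simp
    qed (use off' in auto)
    finally show "blinfun_apply (integral (cbox a b) (F x0)) h = (LINT u|lborel. \<Phi>' x0 u h)" .
  qed
  ultimately show ?thesis by simp
qed

section \<open>Cut-off functions on the line\<close>

lemma smooth_on_Un:
  assumes "open V" "open W" "smooth_on V f" "smooth_on W f"
  shows "smooth_on (V \<union> W) f"
proof -
  have "iter_pd bs f differentiable_on (V \<union> W)" if "set bs \<subseteq> Basis" for bs
    using assms that
    by (auto simp: smooth_on_open_iff differentiable_on_eq_differentiable_at open_Un)
  then show ?thesis using assms smooth_on_open_iff[of "V \<union> W"] by blast
qed

text \<open>
  A family that contains the standard flat function \<open>exp (- 1 / x)\<close> and is closed under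
  differentiation.
\<close>

definition flat :: "real poly \<Rightarrow> real \<Rightarrow> real" where
  "flat p x = (if 0 < x then poly p (1 / x) * exp (- (1 / x)) else 0)"

lemma poly_div_exp_tendsto_0: "((\<lambda>x::real. poly p x / exp x) \<longlongrightarrow> 0) at_top"
proof -
  have "((\<lambda>x::real. \<Sum>i\<le>degree p. coeff p i * (x ^ i / exp x)) \<longlongrightarrow> (\<Sum>i\<le>degree p. coeff p i * 0)) at_top"
    by (intro tendsto_sum tendsto_mult tendsto_const tendsto_power_div_exp_0)
  then show ?thesis by (simp add: poly_altdef sum_divide_distrib)
qed

text \<open>
  At the origin the difference quotient from the right is a polynomial in \<open>1 / x\<close> times \<open>exp (- 1 / x)\<close>,
  which tends to zero since the exponential wins.
\<close>

lemma flat_has_derivative: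
  "(flat p has_real_derivative flat ([:0, 0, 1:] * (p - pderiv p)) x) (at x)"
proof -
  consider "x > 0" | "x < 0" | "x = 0" by linarith
  then show ?thesis
  proof cases
    case 1
    have "((\<lambda>x. poly p (1 / x) * exp (- (1 / x))) has_real_derivative
        flat ([:0, 0, 1:] * (p - pderiv p)) x) (at x)"
      using 1 by (auto intro!: derivative_eq_intros simp: flat_def field_simps power2_eq_square)
    then show ?thesis
      using 1 by (rule_tac has_field_derivative_transform_within_open[where S = "{0<..}"]) (auto simp: flat_def)
  next
    case 2
    have "((\<lambda>x. 0) has_real_derivative 0) (at x)" by simp
    then show ?thesis
      using 2 by (rule_tac has_field_derivative_transform_within_open[where S = "{..<0}" and f = "\<lambda>x. 0"])
        (auto simp: flat_def)
  next
    case 3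
    have "((\<lambda>h. poly (pCons 0 p) (inverse h) / exp (inverse h)) \<longlongrightarrow> 0) (at_right 0)"
      by (rule filterlim_compose[OF poly_div_exp_tendsto_0 filterlim_inverse_at_top_right])
    then have r: "((\<lambda>h. flat p h / h) \<longlongrightarrow> 0) (at_right 0)"
      by (rule Lim_transform_eventually)
         (auto simp: eventually_at_filter flat_def exp_minus field_simps)
    have "((\<lambda>h. 0 :: real) \<longlongrightarrow> 0) (at_left (0::real))" by simp
    then have l: "((\<lambda>h. flat p h / h) \<longlongrightarrow> 0) (at_left 0)"
      by (rule Lim_transform_eventually) (auto simp: eventually_at_filter flat_def)
    show ?thesis
      using filterlim_split_at[OF l r] 3 by (simp add: has_field_derivative_iff flat_def)
  qed
qed

lemma smooth_on_flat: "smooth_on UNIV (flat p)"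
proof (rule smooth_on_coinduct[where F = "range flat"])
  fix f assume "f \<in> range flat"
  then obtain p where f: "f = flat p" by blast
  show "f differentiable_on UNIV" unfolding f using flat_has_derivative
    by (meson differentiable_at_imp_differentiable_on real_differentiable_def)
  fix b :: real assume "b \<in> Basis"
  then have "frechet_derivative f (at x) b = flat ([:0, 0, 1:] * (p - pderiv p)) x" for x
    unfolding f using frechet_derivative_eqI[OF flat_has_derivative[unfolded has_field_derivative_def]] by simp
  then show "\<exists>g\<in>range flat. \<forall>x\<in>UNIV. frechet_derivative f (at x) b = g x" by blast
qed auto

text \<open>
  The argument enters through its square, so the absolute value causes no singularity at the
  origin. The value is 1 up to distance 1 and 0 from distance 2 on.
\<close>

definition cutoff :: "real \<Rightarrow> real" where
  "cutoff x = flat 1 (4 - x\<^sup>2) / (flat 1 (4 - x\<^sup>2) + flat 1 (x\<^sup>2 - 1))"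

lemma flat_1_nonneg: "flat 1 x \<ge> 0" and flat_1_pos: "flat 1 x > 0 \<longleftrightarrow> x > 0"
  by (auto simp: flat_def)

lemma cutoff_denom_pos: "flat 1 (4 - x\<^sup>2) + flat 1 (x\<^sup>2 - 1) > 0"
proof (cases "4 - x\<^sup>2 > 0")
  case True
  then show ?thesis using flat_1_pos[of "4 - x\<^sup>2"] flat_1_nonneg[of "x\<^sup>2 - 1"] by linarith
next
  case False
  then show ?thesis using flat_1_pos[of "x\<^sup>2 - 1"] flat_1_nonneg[of "4 - x\<^sup>2"] by linarith
qed

lemma cutoff_eq_1: "\<bar>x\<bar> \<le> 1 \<Longrightarrow> cutoff x = 1"
  using cutoff_denom_pos[of x] abs_square_le_1[of x] by (auto simp: cutoff_def flat_def split: if_splits)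

lemma cutoff_eq_0: "\<bar>x\<bar> \<ge> 2 \<Longrightarrow> cutoff x = 0"
  using abs_le_square_iff[of 2 x] by (auto simp: cutoff_def flat_def)

lemma cutoff_range: "0 \<le> cutoff x" "cutoff x \<le> 1"
  using cutoff_denom_pos[of x] flat_1_nonneg[of "x\<^sup>2 - 1"] flat_1_nonneg[of "4 - x\<^sup>2"]
  by (auto simp: cutoff_def field_simps)

lemma smooth_on_ident: "smooth_on W (\<lambda>x. x)"
  by (intro smooth_on_linear bounded_linear_ident)

lemma smooth_on_cutoff: "smooth_on UNIV cutoff"
proof -
  have sq: "smooth_on UNIV (\<lambda>x::real. x * x)"
    by (intro smooth_on_mult smooth_on_ident open_UNIV)
  have 1: "smooth_on UNIV (\<lambda>x::real. flat 1 (4 - x * x))"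
    by (rule smooth_on_compose[OF open_UNIV open_UNIV smooth_on_flat])
       (auto intro: smooth_on_diff smooth_on_const sq)
  have 2: "smooth_on UNIV (\<lambda>x::real. flat 1 (x * x - 1))"
    by (rule smooth_on_compose[OF open_UNIV open_UNIV smooth_on_flat])
       (auto intro: smooth_on_diff smooth_on_const sq)
  have "smooth_on UNIV (\<lambda>x. inverse (flat 1 (4 - x * x) + flat 1 (x * x - 1)))"
    by (rule smooth_on_compose[OF open_UNIV _ smooth_on_inverse smooth_on_add[OF open_UNIV 1 2]])
       (use cutoff_denom_pos in \<open>auto simp: power2_eq_square\<close>)
  from smooth_on_mult[OF open_UNIV 1 this] show ?thesis
    by (rule smooth_on_cong[rotated]) (auto simp: cutoff_def power2_eq_square divide_inverse)
qed

lemma cutoff_test_function: "(\<lambda>x. complex_of_real (cutoff x)) \<in> test_functions UNIV"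
proof -
  have "{x. complex_of_real (cutoff x) \<noteq> 0} \<subseteq> cball 0 2"
    using cutoff_eq_0 by (force simp: dist_real_def)
  then have "closure {x. complex_of_real (cutoff x) \<noteq> 0} \<subseteq> cball 0 2"
    by (simp add: closure_minimal)
  then have "compact (closure {x. complex_of_real (cutoff x) \<noteq> 0})"
    by (meson bounded_cball bounded_subset closed_closure compact_eq_bounded_closed)
  then show ?thesis
    using smooth_on_linear_compose[OF open_UNIV bounded_linear_of_real smooth_on_cutoff]
    by (simp add: test_functions_def)
qed

text \<open>
  The frequency factor of the symbol: \<open>\<bar>\<theta>\<bar>\<close> made smooth by removing the frequencies near zero.
\<close>

definition high_freq :: "real \<Rightarrow> complex" where
  "high_freq \<theta> = complex_of_real (\<bar>\<theta>\<bar> * (1 - cutoff \<theta>))"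

lemma smooth_on_high_freq: "smooth_on UNIV high_freq"
proof -
  have 1: "smooth_on W (\<lambda>x. 1 - cutoff x)" if "open W" for W
    using that by (intro smooth_on_diff smooth_on_const smooth_on_subset[OF smooth_on_cutoff]) auto
  have p: "smooth_on {0<..} high_freq"
  proof (rule smooth_on_cong)
    show "smooth_on {0<..} (\<lambda>x. complex_of_real (x * (1 - cutoff x)))"
      by (rule smooth_on_linear_compose[OF _ bounded_linear_of_real smooth_on_mult[OF _ smooth_on_ident 1]]) auto
  qed (auto simp: high_freq_def)
  have n: "smooth_on {..<0} high_freq"
  proof (rule smooth_on_cong)
    show "smooth_on {..<0} (\<lambda>x. complex_of_real ((-1) * (x * (1 - cutoff x))))"
      by (rule smooth_on_linear_compose[OF _ bounded_linear_of_real smooth_on_mult[OF _ smooth_on_const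
              smooth_on_mult[OF _ smooth_on_ident 1]]]) auto
  qed (auto simp: high_freq_def)
  have z: "smooth_on {-1<..<1} high_freq"
    by (rule smooth_on_cong[OF _ smooth_on_const[of _ 0]]) (auto simp: high_freq_def cutoff_eq_1)
  have "{0<..} \<union> {..<0} \<union> {-1<..<1} = (UNIV :: real set)" by auto
  then show ?thesis
    using smooth_on_Un[OF _ _ smooth_on_Un[OF _ _ p n] z] by (metis open_Un open_greaterThan open_greaterThanLessThan open_lessThan)
qed

lemma iter_pd_bounded_compact:
  assumes "smooth_on W f" "compact K" "K \<subseteq> W" "set bs \<subseteq> Basis"
  obtains C where "C \<ge> 0" "\<And>x. x \<in> K \<Longrightarrow> norm (iter_pd bs f x) \<le> C"
proof -
  have "continuous_on K (iter_pd bs f)"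
    using smooth_on_continuous[OF smooth_on_iter_pd[OF assms(1,4)]] assms(3) continuous_on_subset by blast
  then have "bounded (iter_pd bs f ` K)" using assms(2) compact_continuous_image compact_imp_bounded by blast
  then obtain C where "\<forall>y\<in>iter_pd bs f ` K. norm y \<le> C" by (auto simp: bounded_iff)
  then show thesis using that[of "max C 0"] by fastforce
qed

lemma iter_pd_linear_line:
  fixes c :: complex
  assumes "set bs \<subseteq> (Basis :: real set)"
  shows "iter_pd bs (\<lambda>x. c * of_real x) x =
     (if length bs = 0 then c * of_real x else if length bs = 1 then c else 0)"
  using assms
proof (induction bs arbitrary: x)
  case (Cons b bs)
  have "((\<lambda>x. c * of_real x) has_derivative (\<lambda>h. c * of_real h)) (at x)"
    by (auto intro!: derivative_eq_intros)
  from frechet_derivative_eqI[OF this] have *: "frechet_derivative (\<lambda>x. c * of_real x) (at x) 1 = c" by simp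
  have "iter_pd bs (\<lambda>x. c * of_real x) = (\<lambda>x. if length bs = 0 then c * of_real x else if length bs = 1 then c else 0)"
    using Cons by auto
  then show ?case using Cons.prems * by (cases "length bs = 0"; cases "length bs = 1") auto
qed simp

text \<open>
  Beyond the support of the cut-off the function is \<open>\<theta>\<close> or \<open>- \<theta>\<close>, with derivatives of absolute value 1
  and then 0; on the remaining compact interval continuity suffices.
\<close>

lemma high_freq_symbol_estimate:
  assumes bs: "set bs \<subseteq> (Basis :: real set)"
  obtains C where "C \<ge> 0" "\<And>\<theta>. norm (iter_pd bs high_freq \<theta>) \<le> C * (1 + norm \<theta>) powr (1 - real (length bs))"
proof -
  have far: "norm (iter_pd bs high_freq \<theta>) \<le> (1 + norm \<theta>) powr (1 - real (length bs))" if "\<bar>\<theta>\<bar> > 2" for \<theta>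
  proof -
    have "iter_pd bs high_freq \<theta> = iter_pd bs (\<lambda>x. of_real (sgn \<theta>) * of_real x) \<theta>"
    proof (rule iter_pd_cong_open[where W = "{x. \<bar>x\<bar> > 2 \<and> sgn x = sgn \<theta>}"])
      have "{x. \<bar>x\<bar> > 2 \<and> sgn x = sgn \<theta>} = (if \<theta> > 0 then {2<..} else {..<- 2})"
        using that by (auto simp: sgn_if split: if_splits)
      then show "open {x. \<bar>x\<bar> > 2 \<and> sgn x = sgn \<theta>}" by simp
    qed (use that in \<open>auto simp: high_freq_def cutoff_eq_0 abs_sgn mult.commute\<close>)
    also have "norm \<dots> \<le> (1 + norm \<theta>) powr (1 - real (length bs))"
      unfolding iter_pd_linear_line[OF bs] using that
      by (auto simp: norm_mult abs_sgn_eq length_Suc_conv)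
    finally show ?thesis .
  qed
  obtain C where C: "C \<ge> 0" "\<And>\<theta>. \<theta> \<in> {-2..2} \<Longrightarrow> norm (iter_pd bs high_freq \<theta>) \<le> C"
    using iter_pd_bounded_compact[OF smooth_on_high_freq, of "{-2..2}" bs] bs by auto
  have ne: "\<exists>L>0. \<forall>\<theta>\<in>{-2..2::real}. L \<le> (1 + norm \<theta>) powr (1 - real (length bs))"
  proof -
    have "continuous_on {-2..2::real} (\<lambda>\<theta>. (1 + norm \<theta>) powr (1 - real (length bs)))"
      by (intro continuous_intros) (auto simp: add_nonneg_eq_0_iff)
    from continuous_attains_inf[OF compact_Icc _ this]
    obtain t where "t \<in> {-2..2::real}" 
      "\<forall>\<theta>\<in>{-2..2::real}. (1 + norm t) powr (1 - real (length bs)) \<le> (1 + norm \<theta>) powr (1 - real (length bs))"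
      by auto
    then show ?thesis by (intro exI[of _ "(1 + norm t) powr (1 - real (length bs))"]) (auto simp: add_nonneg_eq_0_iff)
  qed
  then obtain L where L: "L > 0" "\<And>\<theta>. \<theta> \<in> {-2..2::real} \<Longrightarrow> L \<le> (1 + norm \<theta>) powr (1 - real (length bs))" by blast
  show thesis
  proof (rule that[of "1 + C / L"])
    fix \<theta> :: real
    show "norm (iter_pd bs high_freq \<theta>) \<le> (1 + C / L) * (1 + norm \<theta>) powr (1 - real (length bs))"
    proof (cases "\<bar>\<theta>\<bar> > 2")
      case True
      have "0 \<le> C / L * (1 + norm \<theta>) powr (1 - real (length bs))" using C L by simp
      then show ?thesis using far[OF True] by (simp add: distrib_right)
    next
      case False
      then have \<theta>: "\<theta> \<in> {-2..2}" by auto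
      have "C \<le> C / L * (1 + norm \<theta>) powr (1 - real (length bs))"
        using mult_left_mono[OF L(2)[OF \<theta>], of "C / L"] C(1) L(1) by simp
      moreover have "0 \<le> (1 + norm \<theta>) powr (1 - real (length bs))" by simp
      ultimately show ?thesis unfolding distrib_right using C(2)[OF \<theta>] by linarith
    qed
  qed (use C L in simp)
qed

section \<open>Fourier transforms of compactly supported densities\<close>

text \<open>
  Each derivative in \<open>s\<close> multiplies the density by \<open>i \<theta>\<close> and leaves it continuous with compact support.
\<close>

lemma smooth_on_fourier_compact:
  fixes g :: "real \<Rightarrow> complex"
  assumes g: "continuous_on UNIV g" and C: "compact C" "\<And>\<theta>. \<theta> \<notin> C \<Longrightarrow> g \<theta> = 0"
  shows "smooth_on UNIV (\<lambda>s::real. LINT \<theta>|lborel. g \<theta> * exp (\<i> * of_real (\<theta> * s)))"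
proof -
  let ?\<Phi> = "\<lambda>n (s::real) \<theta>. (\<i> * of_real \<theta>) ^ n * g \<theta> * exp (\<i> * of_real (\<theta> * s))"
  have "smooth_on UNIV ((\<lambda>n s. LINT \<theta>|lborel. ?\<Phi> n s \<theta>) 0)"
  proof (rule smooth_on_real_derivatives)
    fix n and s :: real
    have c: "continuous_on A (\<lambda>x. g (f x))" if "continuous_on A f" for A :: "'z::topological_space set" and f
      using that continuous_on_compose2[OF g] by blast
    have "((\<lambda>s. LINT \<theta>|lborel. ?\<Phi> n s \<theta>) has_derivative (\<lambda>h. LINT \<theta>|lborel. h *\<^sub>R ?\<Phi> (Suc n) s \<theta>)) (at s)"
    proof (rule has_derivative_integral_param[OF open_UNIV _ C(1)])
      show "((\<lambda>s. ?\<Phi> n s \<theta>) has_derivative (\<lambda>h. h *\<^sub>R ?\<Phi> (Suc n) s \<theta>)) (at s)" for s \<theta>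
      proof -
        have "((\<lambda>z. (\<i> * of_real \<theta>) ^ n * g \<theta> * exp (\<i> * (of_real \<theta> * z))) has_field_derivative
            ?\<Phi> (Suc n) s \<theta>) (at (of_real s))"
          by (auto intro!: derivative_eq_intros)
        from field_vector_diff_chain_at[OF has_vector_derivative_of_real[OF DERIV_ident] this]
        show ?thesis
          by (simp add: o_def has_vector_derivative_def)
      qed
      show "continuous_on UNIV (?\<Phi> n s)" for s by (intro continuous_intros g)
      show "continuous_on (UNIV \<times> UNIV) (\<lambda>(s, \<theta>). b *\<^sub>R ?\<Phi> (Suc n) s \<theta>)" for b
        unfolding case_prod_beta by (intro continuous_intros c)
    qed (use C in auto)
    then show "((\<lambda>s. LINT \<theta>|lborel. ?\<Phi> n s \<theta>) has_vector_derivative (LINT \<theta>|lborel. ?\<Phi> (Suc n) s \<theta>)) (at s)"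
      unfolding has_vector_derivative_def by simp
  qed simp
  then show ?thesis by simp
qed

section \<open>Oscillatory integrals with one frequency variable\<close>

text \<open>
  The function \<open>q\<close> is arbitrary off \<open>\<Omega>\<close>, but the integrands below vanish outside a closed set of points
  over \<open>\<Omega>\<close>. This lemma makes them continuous everywhere.
\<close>

lemma continuous_on_extend_zero:
  fixes f :: "'a::topological_space \<Rightarrow> 'b::real_normed_vector"
  assumes "open V" "closed K" "K \<subseteq> V" "continuous_on V f" "\<And>x. x \<notin> K \<Longrightarrow> f x = 0"
  shows "continuous_on UNIV f"
proof -
  have "continuous_on (- K) (\<lambda>x. 0 :: 'b)" by (rule continuous_on_const)
  then have "continuous_on (- K) f"
    by (rule continuous_on_eq) (use assms(5) in auto)
  then have "continuous_on (V \<union> - K) f" using assms by (intro continuous_on_open_Un) auto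
  then show ?thesis using assms(3) by (metis Compl_partition sup.absorb_iff1 sup_assoc sup_commute sup_top_left)
qed

lemma integrable_inverse_1_plus_square: "integrable lborel (\<lambda>x::real. 1 / (1 + x\<^sup>2))"
proof -
  have "(\<integral>\<^sup>+x. ennreal (1 / (1 + x\<^sup>2)) * indicator {0 ..} x \<partial>lborel) = pi / 2 - arctan 0"
  proof (rule nn_integral_FTC_atLeast)
    show "DERIV arctan x :> 1 / (1 + x\<^sup>2)" for x
      using DERIV_arctan[of x] by (simp add: divide_inverse)
    show "(arctan \<longlongrightarrow> pi / 2) at_top" by (rule tendsto_arctan_at_top)
  qed auto
  moreover have "(\<integral>\<^sup>+x. ennreal (indicator {0 ..} x * (1 / (1 + x\<^sup>2))) \<partial>lborel)
     = (\<integral>\<^sup>+x. ennreal (1 / (1 + x\<^sup>2)) * indicator {0 ..} x \<partial>lborel)"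
    by (intro nn_integral_cong) (auto split: split_indicator)
  ultimately have 1: "integrable lborel (\<lambda>x::real. indicator {0 ..} x * (1 / (1 + x\<^sup>2)))"
    by (intro integrableI_nonneg) auto
  from lborel_integrable_real_affine[OF 1, of "-1" 0]
  have "integrable lborel (\<lambda>x::real. indicator {0 ..} (-x) * (1 / (1 + x\<^sup>2)))" by simp
  from Bochner_Integration.integrable_add[OF 1 this] show ?thesis
    by (rule Bochner_Integration.integrable_bound) (auto split: split_indicator)
qed

definition osc_fourier :: "('u::euclidean_space \<Rightarrow> real) \<Rightarrow> ('u \<Rightarrow> complex) \<Rightarrow> real \<Rightarrow> complex" where
  "osc_fourier P h \<theta> = (LINT u|lborel. exp (\<i> * of_real (\<theta> * P u)) * h u)"

definition compactly_supported_in :: "'u::euclidean_space set \<Rightarrow> ('u \<Rightarrow> complex) \<Rightarrow> bool" where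
  "compactly_supported_in V h \<longleftrightarrow>
     continuous_on UNIV h \<and> (\<exists>K. compact K \<and> K \<subseteq> V \<and> (\<forall>u. u \<notin> K \<longrightarrow> h u = 0))"

lemma compactly_supported_mult:
  assumes "open V" "continuous_on V f" "compactly_supported_in V h"
  shows "compactly_supported_in V (\<lambda>u. f u * h u)"
proof -
  obtain K where K: "compact K" "K \<subseteq> V" "\<forall>u. u \<notin> K \<longrightarrow> h u = 0" and h: "continuous_on UNIV h"
    using assms(3) unfolding compactly_supported_in_def by blast
  have "continuous_on UNIV (\<lambda>u. f u * h u)"
    by (rule continuous_on_extend_zero[OF assms(1) compact_imp_closed[OF K(1)] K(2)])
       (use K assms(2) h in \<open>auto intro!: continuous_intros intro: continuous_on_subset\<close>)
  then show ?thesis unfolding compactly_supported_in_def using K by (intro conjI exI[of _ K]) auto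
qed

lemma compactly_supported_integrable:
  "compactly_supported_in V h \<Longrightarrow> integrable lborel h"
  unfolding compactly_supported_in_def using integrable_continuous_compact by metis

lemma continuous_on_osc_integrand:
  assumes V: "open V" and P: "continuous_on V P" and h: "compactly_supported_in V h"
  shows "continuous_on UNIV (\<lambda>p. exp (\<i> * of_real (fst p * P (snd p))) * h (snd p))"
proof -
  obtain K where K: "compact K" "K \<subseteq> V" "\<forall>u. u \<notin> K \<longrightarrow> h u = 0" and c: "continuous_on UNIV h"
    using h unfolding compactly_supported_in_def by blast
  show ?thesis
  proof (rule continuous_on_extend_zero[where V = "UNIV \<times> V" and K = "UNIV \<times> K"])
    show "continuous_on (UNIV \<times> V) (\<lambda>p. exp (\<i> * of_real (fst p * P (snd p))) * h (snd p))"
      by (intro continuous_intros continuous_on_compose2[OF P] continuous_on_compose2[OF c]) auto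
  qed (use K V compact_imp_closed[OF K(1)] in \<open>auto intro: open_Times closed_Times\<close>)
qed

lemma osc_integrand_supported:
  assumes "open V" "continuous_on V P" "compactly_supported_in V h"
  shows "compactly_supported_in V (\<lambda>u. exp (\<i> * of_real (\<theta> * P u)) * h u)"
  by (rule compactly_supported_mult[OF assms(1) _ assms(3)]) (intro continuous_intros assms(2))

lemma osc_fourier_measurable:
  assumes "open V" "continuous_on V P" "compactly_supported_in V h"
  shows "osc_fourier P h \<in> borel_measurable lborel"
proof -
  have "(\<lambda>p. exp (\<i> * of_real (fst p * P (snd p))) * h (snd p)) \<in> borel_measurable (lborel \<Otimes>\<^sub>M lborel)"
    using borel_measurable_continuous_onI[OF continuous_on_osc_integrand[OF assms]] by (simp add: lborel_prod)
  then show ?thesis unfolding osc_fourier_def[abs_def]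
    by (intro lborel.borel_measurable_lebesgue_integral) (simp add: case_prod_beta)
qed

lemma norm_exp_i_real: "norm (exp (\<i> * of_real x)) = 1"
  by (simp add: norm_exp_eq_Re)

lemma osc_fourier_bound: "norm (osc_fourier P h \<theta>) \<le> (LINT u|lborel. norm (h u))"
proof -
  have "norm (osc_fourier P h \<theta>) \<le> (LINT u|lborel. norm (exp (\<i> * of_real (\<theta> * P u)) * h u))"
    unfolding osc_fourier_def by (rule integral_norm_bound)
  then show ?thesis by (simp add: norm_mult norm_exp_i_real del: of_real_mult)
qed

text \<open>
  Integrating the frequency first: for an integrable weight the oscillatory integral is a genuine
  double integral, so Fubini applies and leaves the Fourier transform of the weight.
\<close>

lemma osc_fourier_Fubini:
  assumes V: "open V" "continuous_on V P" "compactly_supported_in V h"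
    and \<kappa>: "integrable lborel \<kappa>"
  shows "(LINT \<theta>|lborel. \<kappa> \<theta> * osc_fourier P h \<theta>)
       = (LINT u|lborel. (LINT \<theta>|lborel. \<kappa> \<theta> * exp (\<i> * of_real (\<theta> * P u))) * h u)"
proof -
  let ?F = "\<lambda>\<theta> u. \<kappa> \<theta> * (exp (\<i> * of_real (\<theta> * P u)) * h u)"
  have [measurable]: "\<kappa> \<in> borel_measurable borel" using \<kappa> by auto
  have [measurable]: "(\<lambda>p. exp (\<i> * of_real (fst p * P (snd p))) * h (snd p)) \<in> borel_measurable (lborel \<Otimes>\<^sub>M lborel)"
    using borel_measurable_continuous_onI[OF continuous_on_osc_integrand[OF V]] by (simp add: lborel_prod)
  have int: "integrable (lborel \<Otimes>\<^sub>M lborel) (case_prod ?F)"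
  proof (rule lborel_pair.Fubini_integrable)
    show "case_prod ?F \<in> borel_measurable (lborel \<Otimes>\<^sub>M lborel)"
      unfolding case_prod_beta by measurable
    have "(\<lambda>\<theta>. LINT u|lborel. norm (case_prod ?F (\<theta>, u))) = (\<lambda>\<theta>. norm (\<kappa> \<theta>) * (LINT u|lborel. norm (h u)))"
      by (simp add: norm_mult norm_exp_i_real del: of_real_mult)
    then show "integrable lborel (\<lambda>\<theta>. LINT u|lborel. norm (case_prod ?F (\<theta>, u)))"
      using \<kappa> by simp
    show "AE \<theta> in lborel. integrable lborel (\<lambda>u. case_prod ?F (\<theta>, u))"
      using compactly_supported_integrable[OF osc_integrand_supported[OF V]] by simp
  qed
  have "(LINT \<theta>|lborel. \<kappa> \<theta> * osc_fourier P h \<theta>) = (LINT \<theta>|lborel. LINT u|lborel. ?F \<theta> u)"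
    unfolding osc_fourier_def by simp
  also have "\<dots> = (LINT u|lborel. LINT \<theta>|lborel. ?F \<theta> u)"
    using lborel_pair.Fubini_integral[OF int] by simp
  also have "\<dots> = (LINT u|lborel. (LINT \<theta>|lborel. \<kappa> \<theta> * exp (\<i> * of_real (\<theta> * P u))) * h u)"
    by (simp only: mult.assoc[symmetric] integral_mult_left_zero)
  finally show ?thesis .
qed

lemma fourier_integrable_continuous:
  fixes \<kappa> :: "real \<Rightarrow> complex"
  assumes "integrable lborel \<kappa>"
  shows "continuous_on UNIV (\<lambda>s. LINT \<theta>|lborel. \<kappa> \<theta> * exp (\<i> * of_real (\<theta> * s)))"
  unfolding continuous_on_eq_continuous_within
proof
  fix s :: real
  have [measurable]: "\<kappa> \<in> borel_measurable borel" using assms by auto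
  show "continuous (at s within UNIV) (\<lambda>s. LINT \<theta>|lborel. \<kappa> \<theta> * exp (\<i> * of_real (\<theta> * s)))"
    unfolding continuous_within tendsto_at_iff_sequentially comp_def
  proof (intro allI impI)
    fix X :: "nat \<Rightarrow> real" assume X: "X \<longlonglongrightarrow> s"
    show "(\<lambda>n. LINT \<theta>|lborel. \<kappa> \<theta> * exp (\<i> * of_real (\<theta> * X n)))
       \<longlonglongrightarrow> (LINT \<theta>|lborel. \<kappa> \<theta> * exp (\<i> * of_real (\<theta> * s)))"
    proof (rule integral_dominated_convergence[where w = "\<lambda>\<theta>. norm (\<kappa> \<theta>)"])
      show "AE \<theta> in lborel. (\<lambda>n. \<kappa> \<theta> * exp (\<i> * of_real (\<theta> * X n))) \<longlonglongrightarrow> \<kappa> \<theta> * exp (\<i> * of_real (\<theta> * s))"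
        by (intro AE_I2 tendsto_intros X)
    qed (use assms in \<open>simp_all add: norm_mult norm_exp_i_real del: of_real_mult\<close>)
  qed
qed

lemma integral_derivative_compact_support:
  fixes f :: "real \<Rightarrow> complex"
  assumes f: "\<And>t. (f has_vector_derivative f' t) (at t)" and c: "continuous_on UNIV f'"
    and K: "compact K" "\<And>t. t \<notin> K \<Longrightarrow> f t = 0" "\<And>t. t \<notin> K \<Longrightarrow> f' t = 0"
  shows "(LINT t|lborel. f' t) = 0"
proof -
  obtain B where B: "\<And>t. t \<in> K \<Longrightarrow> norm t \<le> B"
    using compact_imp_bounded[OF K(1)] by (auto simp: bounded_iff)
  define R where "R = max B 0 + 1"
  have out: "t \<notin> K" if "\<bar>t\<bar> \<ge> R" for t using B[of t] that unfolding R_def by auto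
  have "(f' has_integral (f R - f (-R))) {-R..R}"
  proof (rule fundamental_theorem_of_calculus)
    show "- R \<le> R" by (simp add: R_def)
    show "(f has_vector_derivative f' t) (at t within {-R..R})" for t
      by (rule has_vector_derivative_at_within[OF f])
  qed
  moreover have "f R = 0" "f (-R) = 0" using out[of R] out[of "-R"] K(2) by (auto simp: R_def)
  ultimately have "integral (cbox (-R) R) f' = 0" by (simp add: integral_unique)
  moreover have "(LINT t|lborel. f' t) = integral (cbox (-R) R) f'"
  proof (rule integral_compact_support(2)[OF c])
    show "f' u = 0" if "u \<notin> cbox (-R) R" for u
      using out[of u] K(3) that by auto
  qed
  ultimately show ?thesis by simp
qed

section \<open>Test functions\<close>

lemma test_functions_support:
  assumes "g \<in> test_functions X"
  shows "\<exists>K. compact K \<and> K \<subseteq> X \<and> (\<forall>x. x \<notin> K \<longrightarrow> g x = 0)"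
proof (intro exI conjI allI impI)
  show "compact (closure {x. g x \<noteq> 0})" "closure {x. g x \<noteq> 0} \<subseteq> X"
    using assms by (simp_all add: test_functions_def)
  show "g x = 0" if "x \<notin> closure {x. g x \<noteq> 0}" for x
    using that closure_subset[of "{x. g x \<noteq> 0}"] by blast
qed

lemma test_functionsI:
  assumes "smooth_on UNIV g" "compact K" "K \<subseteq> X" "\<And>x. x \<notin> K \<Longrightarrow> g x = 0"
  shows "g \<in> test_functions X"
proof -
  have "closure {x. g x \<noteq> 0} \<subseteq> K"
    using assms by (intro closure_minimal compact_imp_closed) auto
  then have "compact (closure {x. g x \<noteq> 0})"
    using assms(2) bounded_subset closed_closure compact_eq_bounded_closed by blast
  moreover have "closure {x. g x \<noteq> 0} \<subseteq> X"
    using \<open>closure {x. g x \<noteq> 0} \<subseteq> K\<close> assms(3) by (rule subset_trans)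
  ultimately show ?thesis using assms(1) by (simp add: test_functions_def)
qed

lemma test_functions_smooth: "g \<in> test_functions X \<Longrightarrow> smooth_on UNIV g"
  by (simp add: test_functions_def)

lemma iter_pd_zero_off:
  assumes "closed K" "\<And>x. x \<notin> K \<Longrightarrow> f x = 0" "x \<notin> K"
  shows "iter_pd bs f x = 0"
proof -
  have "iter_pd bs f x = iter_pd bs (\<lambda>x. 0) x"
    using assms by (intro iter_pd_cong_open[of "- K"]) auto
  also have "iter_pd bs (\<lambda>x. 0 :: 'b) = (\<lambda>x. 0)" by (induction bs) auto
  finally show ?thesis .
qed

lemma test_functions_iter_pd:
  assumes "g \<in> test_functions X" "set bs \<subseteq> Basis"
  shows "iter_pd bs g \<in> test_functions X"
proof -
  obtain K where K: "compact K" "K \<subseteq> X" "\<And>x. x \<notin> K \<Longrightarrow> g x = 0"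
    using test_functions_support[OF assms(1)] by blast
  show ?thesis
    by (rule test_functionsI[OF smooth_on_iter_pd[OF test_functions_smooth[OF assms(1)] assms(2)] K(1,2)
        iter_pd_zero_off[OF compact_imp_closed[OF K(1)] K(3)]])
qed

lemma test_functions_lincomb:
  assumes "g \<in> test_functions X" "h \<in> test_functions X"
  shows "(\<lambda>x. a * g x + b * h x) \<in> test_functions X"
proof -
  obtain K where K: "compact K" "K \<subseteq> X" "\<And>x. x \<notin> K \<Longrightarrow> g x = 0" using test_functions_support[OF assms(1)] by blast
  obtain L where L: "compact L" "L \<subseteq> X" "\<And>x. x \<notin> L \<Longrightarrow> h x = 0" using test_functions_support[OF assms(2)] by blast
  show ?thesis
  proof (rule test_functionsI[of _ "K \<union> L" X])
    show "smooth_on UNIV (\<lambda>x. a * g x + b * h x)"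
      using assms by (intro smooth_on_add smooth_on_mult smooth_on_const open_UNIV test_functions_smooth)
  qed (use K L in auto)
qed

lemma test_functions_mono: "X \<subseteq> Y \<Longrightarrow> test_functions X \<subseteq> test_functions Y"
  unfolding test_functions_def by auto

lemma test_functions_supported:
  assumes "g \<in> test_functions X"
  shows "compactly_supported_in X g"
proof -
  obtain K where "compact K" "K \<subseteq> X" "\<And>x. x \<notin> K \<Longrightarrow> g x = 0"
    using test_functions_support[OF assms] by blast
  then show ?thesis
    using smooth_on_continuous[OF test_functions_smooth[OF assms]] unfolding compactly_supported_in_def by blast
qed

section \<open>Rapid decay in the frequency\<close>

abbreviation time_unit :: "'y::euclidean_space \<times> real" where "time_unit \<equiv> (0, 1)"

lemma time_unit_Basis: "time_unit \<in> Basis" by (simp add: Basis_prod_def)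

definition one_minus_dtt :: "('y::euclidean_space \<times> real \<Rightarrow> complex) \<Rightarrow> 'y \<times> real \<Rightarrow> complex" where
  "one_minus_dtt g u = g u - iter_pd [time_unit, time_unit] g u"

lemma one_minus_dtt_test:
  assumes "g \<in> test_functions X"
  shows "one_minus_dtt g \<in> test_functions X"
proof -
  have "(\<lambda>u. 1 * g u + (-1) * iter_pd [time_unit, time_unit] g u) \<in> test_functions X"
    by (rule test_functions_lincomb[OF assms test_functions_iter_pd[OF assms]]) (simp add: time_unit_Basis)
  then show ?thesis unfolding one_minus_dtt_def[abs_def] by simp
qed

lemma time_derivative:
  assumes "smooth_on UNIV (g :: 'y::euclidean_space \<times> real \<Rightarrow> complex)"
  shows "((\<lambda>t. g (y, t)) has_vector_derivative iter_pd [time_unit] g (y, t)) (at t)"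
proof -
  have g: "(g has_derivative frechet_derivative g (at (y, t))) (at (y, t))"
    using smooth_on_has_derivative[OF assms] by simp
  have "((\<lambda>t. (y, t)) has_derivative (\<lambda>s. (0, s))) (at t)" by (auto intro!: derivative_eq_intros)
  from has_derivative_compose[OF this g]
  have "((\<lambda>t. g (y, t)) has_derivative (\<lambda>s. frechet_derivative g (at (y, t)) (0, s))) (at t)" .
  moreover have "(\<lambda>s. frechet_derivative g (at (y, t)) (0, s)) = (\<lambda>s. s *\<^sub>R iter_pd [time_unit] g (y, t))"
  proof
    fix s
    from linear_scale[OF has_derivative_linear[OF g], of s "(0, 1)"]
    show "frechet_derivative g (at (y, t)) (0, s) = s *\<^sub>R iter_pd [time_unit] g (y, t)"
      by (simp only: scaleR_Pair scaleR_zero_right real_scaleR_def mult_1_right iter_pd.simps)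
  qed
  ultimately show ?thesis unfolding has_vector_derivative_def by (simp only:)
qed

text \<open>
  Integration by parts in \<open>t\<close>: the phase \<open>\<theta> (t - Q)\<close> is linear in \<open>t\<close>, so the operator
  \<open>1 - \<partial>\<^sub>t\<partial>\<^sub>t\<close> acts as multiplication by \<open>1 + \<theta>\<^sup>2\<close>. The primitive that is used has the derivative
  \<open>exp (i \<theta> (t - Q)) (g\<^sub>t\<^sub>t + \<theta>\<^sup>2 g)\<close>.
\<close>

lemma osc_fourier_one_minus_dtt:
  fixes g :: "'y::euclidean_space \<times> real \<Rightarrow> complex"
  assumes \<Omega>: "open \<Omega>" and Q: "continuous_on \<Omega> Q" and c: "continuous_on \<Omega> c"
    and g: "g \<in> test_functions (\<Omega> \<times> UNIV)"
  shows "of_real (1 + \<theta>\<^sup>2) * osc_fourier (\<lambda>u. snd u - Q (fst u)) (\<lambda>u. c (fst u) * g u) \<theta>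
       = osc_fourier (\<lambda>u. snd u - Q (fst u)) (\<lambda>u. c (fst u) * one_minus_dtt g u) \<theta>"
proof -
  let ?e = "\<lambda>u. exp (\<i> * of_real (\<theta> * (snd u - Q (fst u))))"
  let ?g2 = "iter_pd [time_unit, time_unit] g"
  let ?I = "\<lambda>g u. ?e u * (c (fst u) * g u)"
  have V: "open (\<Omega> \<times> (UNIV :: real set))" using \<Omega> by (intro open_Times) auto
  have supp: "compactly_supported_in (\<Omega> \<times> UNIV) (?I h)" if h: "h \<in> test_functions (\<Omega> \<times> UNIV)" for h
    by (rule osc_integrand_supported[OF V _ compactly_supported_mult[OF V _ test_functions_supported[OF h]]];
        intro continuous_intros continuous_on_compose2[OF Q] continuous_on_compose2[OF c]; auto)
  have g2: "?g2 \<in> test_functions (\<Omega> \<times> UNIV)"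
    using test_functions_iter_pd[OF g, of "[time_unit, time_unit]"] by (simp add: time_unit_Basis)
  define S where "S u = ?I ?g2 u + of_real (\<theta>\<^sup>2) * ?I g u" for u
  have iS: "integrable lborel (?I h)" if "h \<in> test_functions (\<Omega> \<times> UNIV)" for h
    using compactly_supported_integrable[OF supp[OF that]] .
  have cI: "continuous_on UNIV (?I h)" if "h \<in> test_functions (\<Omega> \<times> UNIV)" for h
    using supp[OF that] unfolding compactly_supported_in_def by blast
  have contS: "continuous_on UNIV S"
    unfolding S_def[abs_def]
    by (rule continuous_on_add[OF cI[OF g2] continuous_on_mult[OF continuous_on_const cI[OF g]]])
  obtain K where K: "compact K" "K \<subseteq> \<Omega> \<times> UNIV" "\<And>x. x \<notin> K \<Longrightarrow> g x = 0" using test_functions_support[OF g] by blast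
  have z: "iter_pd bs g u = 0" if "u \<notin> K" for bs u
    using iter_pd_zero_off[OF compact_imp_closed[OF K(1)] K(3) that] .
  have inner: "(LINT t|lborel. S (y, t)) = 0" for y
  proof -
    let ?f = "\<lambda>t. ?e (y, t) * (c y * (iter_pd [time_unit] g (y, t) - \<i> * of_real \<theta> * g (y, t)))"
    have der: "(?f has_vector_derivative S (y, t)) (at t)" for t
    proof -
      have e: "((\<lambda>t. ?e (y, t)) has_vector_derivative (\<i> * of_real \<theta> * ?e (y, t))) (at t)"
      proof -
        have "((\<lambda>z. exp (\<i> * (of_real \<theta> * (z - of_real (Q y))))) has_field_derivative
            (\<i> * of_real \<theta> * ?e (y, t))) (at (of_real t))"
          by (auto intro!: derivative_eq_intros)
        from field_vector_diff_chain_at[OF has_vector_derivative_of_real[OF DERIV_ident] this]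
        show ?thesis unfolding o_def by simp
      qed
      have g1: "((\<lambda>t. iter_pd [time_unit] g (y, t)) has_vector_derivative ?g2 (y, t)) (at t)"
        using time_derivative[OF smooth_on_iter_pd[OF test_functions_smooth[OF g]], of "[time_unit]"]
        by (simp add: time_unit_Basis)
      have "(?f has_vector_derivative
          (?e (y, t) * (c y * (?g2 (y, t) - \<i> * of_real \<theta> * iter_pd [time_unit] g (y, t)))
           + \<i> * of_real \<theta> * ?e (y, t) * (c y * (iter_pd [time_unit] g (y, t) - \<i> * of_real \<theta> * g (y, t))))) (at t)"
        by (intro has_vector_derivative_mult e has_vector_derivative_mult_right has_vector_derivative_diff g1
            time_derivative test_functions_smooth[OF g])
      moreover have "E * (C * (G2 - \<i> * T * G1)) + \<i> * T * E * (C * (G1 - \<i> * T * G)) = E * (C * G2) + T\<^sup>2 * (E * (C * G))"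
        for E C G2 G1 G T :: complex
        by (simp add: algebra_simps power2_eq_square)
      ultimately show ?thesis unfolding S_def fst_conv snd_conv of_real_power by metis
    qed
    show ?thesis
    proof (rule integral_derivative_compact_support[OF der])
      show "continuous_on UNIV (\<lambda>t. S (y, t))"
        by (rule continuous_on_compose2[OF contS]) (auto intro: continuous_intros)
      show "compact (snd ` K)" using K by (intro compact_continuous_image) (auto intro: continuous_intros)
      fix t assume "t \<notin> snd ` K"
      then have "(y, t) \<notin> K" by force
      then show "?f t = 0" "S (y, t) = 0"
        using z[of "(y, t)" "[time_unit]"] z[of "(y, t)" "[time_unit, time_unit]"] K(3)[of "(y, t)"] by (auto simp: S_def)
    qed
  qed
  have "integrable lborel S"
    unfolding S_def[abs_def] by (rule Bochner_Integration.integrable_add[OF iS[OF g2] integrable_mult_right[OF iS[OF g]]])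
  then have "(LINT u|lborel. S u) = (LINT y|lborel. LINT t|lborel. S (y, t))"
    using lborel_pair.integral_fst'[of S] by (simp add: lborel_prod)
  then have "(LINT u|lborel. S u) = 0" using inner by (simp only: integral_zero)
  moreover have "(LINT u|lborel. S u) = (LINT u|lborel. ?I ?g2 u) + of_real (\<theta>\<^sup>2) * (LINT u|lborel. ?I g u)"
    unfolding S_def
    by (subst Bochner_Integration.integral_add[OF iS[OF g2] integrable_mult_right[OF iS[OF g]]])
       (simp only: integral_mult_right_zero)
  moreover have "(LINT u|lborel. ?I (one_minus_dtt g) u) = (LINT u|lborel. ?I g u) - (LINT u|lborel. ?I ?g2 u)"
    unfolding one_minus_dtt_def right_diff_distrib[of "c _"] right_diff_distrib[of "exp _"]
    by (rule Bochner_Integration.integral_diff[OF iS[OF g] iS[OF g2]])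
  moreover have *: "s = 0 \<Longrightarrow> s = a2 + T * a \<Longrightarrow> b = a - a2 \<Longrightarrow> (1 + T) * a = b" for s a a2 b T :: complex
    by algebra
  ultimately have "(1 + of_real (\<theta>\<^sup>2)) * (LINT u|lborel. ?I g u) = (LINT u|lborel. ?I (one_minus_dtt g) u)"
    by (rule_tac *)
  then show ?thesis by (simp only: osc_fourier_def of_real_add of_real_1)
qed

section \<open>The value of the oscillatory integral\<close>

text \<open>
  Dividing by \<open>(1 + \<theta>\<^sup>2)\<^sup>2\<close> makes a factor of linear growth integrable, with one power of \<open>\<bar>\<theta>\<bar>\<close> to spare;
  a single factor \<open>1 + \<theta>\<^sup>2\<close> would not do.
\<close>

lemma osc_weight_bound:
  assumes "norm (z::complex) \<le> 1 + \<bar>\<theta>\<bar>"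
  shows "norm (z / of_real ((1 + \<theta>\<^sup>2)\<^sup>2)) \<le> 2 * (1 / (1 + \<theta>\<^sup>2))"
proof -
  have p: "1 + \<theta>\<^sup>2 > 0" by (simp add: add_pos_nonneg)
  have "0 \<le> (\<bar>\<theta>\<bar> - 1)\<^sup>2" by simp
  then have "2 * \<bar>\<theta>\<bar> \<le> \<theta>\<^sup>2 + 1" by (simp add: power2_diff)
  moreover have "0 \<le> \<theta>\<^sup>2" by simp
  ultimately have "1 + \<bar>\<theta>\<bar> \<le> 2 * (1 + \<theta>\<^sup>2)" by argo
  then have "norm z \<le> 2 * (1 + \<theta>\<^sup>2)" using assms by linarith
  then have "norm z / (1 + \<theta>\<^sup>2)\<^sup>2 \<le> 2 * (1 + \<theta>\<^sup>2) / (1 + \<theta>\<^sup>2)\<^sup>2" by (intro divide_right_mono) auto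
  also have "2 * T / T\<^sup>2 = 2 * (1 / T)" if "T > 0" for T :: real
    using that by (simp add: power2_eq_square)
  note this[OF p]
  finally show ?thesis by (simp add: norm_divide norm_power del: of_real_add of_real_power)
qed

lemma osc_weight_integrable:
  fixes \<sigma> :: "real \<Rightarrow> complex"
  assumes "continuous_on UNIV \<sigma>" "\<And>\<theta>. norm (\<sigma> \<theta>) \<le> 1 + \<bar>\<theta>\<bar>"
  shows "integrable lborel (\<lambda>\<theta>. \<sigma> \<theta> / of_real ((1 + \<theta>\<^sup>2)\<^sup>2))"
proof (rule Bochner_Integration.integrable_bound)
  show "integrable lborel (\<lambda>\<theta>::real. 2 * (1 / (1 + \<theta>\<^sup>2)))"
    by (intro integrable_mult_right integrable_inverse_1_plus_square)
  have "1 + \<theta>\<^sup>2 \<noteq> 0" for \<theta> :: real by (smt (verit) zero_le_power2)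
  then have "continuous_on UNIV (\<lambda>\<theta>. \<sigma> \<theta> / of_real ((1 + \<theta>\<^sup>2)\<^sup>2))"
    by (intro continuous_intros assms) (auto simp flip: of_real_add of_real_power)
  then show "(\<lambda>\<theta>. \<sigma> \<theta> / of_real ((1 + \<theta>\<^sup>2)\<^sup>2)) \<in> borel_measurable lborel"
    using borel_measurable_continuous_onI by simp
  show "AE \<theta> in lborel. norm (\<sigma> \<theta> / of_real ((1 + \<theta>\<^sup>2)\<^sup>2)) \<le> norm (2 * (1 / (1 + \<theta>\<^sup>2)))"
  proof (rule AE_I2)
    fix \<theta> :: real
    have "norm (2 * (1 / (1 + \<theta>\<^sup>2))) = 2 * (1 / (1 + \<theta>\<^sup>2))" by (simp add: add_nonneg_nonneg)
    then show "norm (\<sigma> \<theta> / of_real ((1 + \<theta>\<^sup>2)\<^sup>2)) \<le> norm (2 * (1 / (1 + \<theta>\<^sup>2)))"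
      using osc_weight_bound[OF assms(2)] by metis
  qed
qed

text \<open>
  Here the point \<open>x\<close> is fixed and suppressed: \<open>Q y\<close> and \<open>c y\<close> stand for the quadratic form and the
  amplitude at \<open>x\<close>.
\<close>

locale osc_setup =
  fixes \<Omega> :: "'y::euclidean_space set" and Q :: "'y \<Rightarrow> real" and c :: "'y \<Rightarrow> complex"
  assumes \<Omega>: "open \<Omega>" and Q: "continuous_on \<Omega> Q" and c: "continuous_on \<Omega> c"
begin

abbreviation P :: "'y \<times> real \<Rightarrow> real" where "P u \<equiv> snd u - Q (fst u)"

abbreviation ft :: "('y \<times> real \<Rightarrow> complex) \<Rightarrow> real \<Rightarrow> complex" where
  "ft h \<equiv> osc_fourier P (\<lambda>u. c (fst u) * h u)"

lemma V: "open (\<Omega> \<times> (UNIV :: real set))" using \<Omega> by (intro open_Times) auto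

lemma P: "continuous_on (\<Omega> \<times> UNIV) P"
  by (intro continuous_intros continuous_on_compose2[OF Q]) auto

lemma supp:
  fixes h :: "'y \<times> real \<Rightarrow> complex"
  assumes "h \<in> test_functions (\<Omega> \<times> UNIV)"
  shows "compactly_supported_in (\<Omega> \<times> UNIV) (\<lambda>u. c (fst u) * h u)"
proof (rule compactly_supported_mult[OF V _ test_functions_supported[OF assms]])
  show "continuous_on (\<Omega> \<times> (UNIV :: real set)) (\<lambda>u. c (fst u))"
    by (rule continuous_on_compose2[OF c continuous_on_fst[OF continuous_on_id]]) auto
qed

lemma ft_twice:
  assumes "g \<in> test_functions (\<Omega> \<times> UNIV)"
  shows "ft g \<theta> = ft (one_minus_dtt (one_minus_dtt g)) \<theta> / of_real ((1 + \<theta>\<^sup>2)\<^sup>2)"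
proof -
  have "1 + \<theta>\<^sup>2 \<noteq> 0" by (smt (verit) zero_le_power2)
  then have nz: "of_real (1 + \<theta>\<^sup>2) \<noteq> (0 :: complex)" by (simp only: of_real_eq_0_iff not_False_eq_True)
  have "of_real (1 + \<theta>\<^sup>2) * (of_real (1 + \<theta>\<^sup>2) * ft g \<theta>) = ft (one_minus_dtt (one_minus_dtt g)) \<theta>"
    using osc_fourier_one_minus_dtt[OF \<Omega> Q c assms] osc_fourier_one_minus_dtt[OF \<Omega> Q c one_minus_dtt_test[OF assms]]
    by simp
  moreover have "T \<noteq> 0 \<Longrightarrow> T * (T * a) = b \<Longrightarrow> a = b / T\<^sup>2" for T a b :: complex
    by (auto simp: power2_eq_square)
  ultimately show ?thesis using nz unfolding of_real_power by blast
qed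

lemma ft_decay:
  assumes "g \<in> test_functions (\<Omega> \<times> UNIV)"
  obtains C where "C \<ge> 0" "\<And>\<theta> z. norm (z::complex) \<le> 1 + \<bar>\<theta>\<bar> \<Longrightarrow> norm (z * ft g \<theta>) \<le> C * (2 * (1 / (1 + \<theta>\<^sup>2)))"
proof
  let ?C = "LINT u|lborel. norm (c (fst u) * one_minus_dtt (one_minus_dtt g) u)"
  show "?C \<ge> 0" by simp
  fix \<theta> and z :: complex assume "norm z \<le> 1 + \<bar>\<theta>\<bar>"
  then have "norm (z / of_real ((1 + \<theta>\<^sup>2)\<^sup>2)) * norm (ft (one_minus_dtt (one_minus_dtt g)) \<theta>)
      \<le> 2 * (1 / (1 + \<theta>\<^sup>2)) * ?C"
    by (intro mult_mono osc_weight_bound osc_fourier_bound) (auto simp: add_nonneg_nonneg)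
  then show "norm (z * ft g \<theta>) \<le> ?C * (2 * (1 / (1 + \<theta>\<^sup>2)))"
    unfolding ft_twice[OF assms] by (simp add: norm_mult norm_divide mult.commute)
qed

lemma ft_measurable:
  assumes "g \<in> test_functions (\<Omega> \<times> UNIV)"
  shows "ft g \<in> borel_measurable lborel"
  by (rule osc_fourier_measurable[OF V P supp[OF assms]])

lemma weighted_ft_integrable:
  fixes \<sigma> :: "real \<Rightarrow> complex"
  assumes g: "g \<in> test_functions (\<Omega> \<times> UNIV)" and \<sigma>: "continuous_on UNIV \<sigma>" "\<And>\<theta>. norm (\<sigma> \<theta>) \<le> 1 + \<bar>\<theta>\<bar>"
  shows "integrable lborel (\<lambda>\<theta>. \<sigma> \<theta> * ft g \<theta>)"
proof -
  obtain C where C: "C \<ge> 0" "\<And>\<theta> z. norm (z::complex) \<le> 1 + \<bar>\<theta>\<bar> \<Longrightarrow> norm (z * ft g \<theta>) \<le> C * (2 * (1 / (1 + \<theta>\<^sup>2)))"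
    by (rule ft_decay[OF g]) blast
  have [measurable]: "ft g \<in> borel_measurable borel" using ft_measurable[OF g] by simp
  have [measurable]: "\<sigma> \<in> borel_measurable borel" using \<sigma>(1) borel_measurable_continuous_onI by blast
  show ?thesis
  proof (rule Bochner_Integration.integrable_bound)
    show "integrable lborel (\<lambda>\<theta>::real. C * (2 * (1 / (1 + \<theta>\<^sup>2))))"
      by (intro integrable_mult_right integrable_inverse_1_plus_square)
    show "AE \<theta> in lborel. norm (\<sigma> \<theta> * ft g \<theta>) \<le> norm (C * (2 * (1 / (1 + \<theta>\<^sup>2))))"
    proof (rule AE_I2)
      fix \<theta> :: real
      have "0 \<le> C * (2 * (1 / (1 + \<theta>\<^sup>2)))" using C(1) by (simp add: add_nonneg_nonneg)
      then show "norm (\<sigma> \<theta> * ft g \<theta>) \<le> norm (C * (2 * (1 / (1 + \<theta>\<^sup>2))))"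
        using C(2)[OF \<sigma>(2), of \<theta>] by (metis abs_of_nonneg real_norm_def)
    qed
  qed measurable
qed

text \<open>
  By the decay of \<open>ft g\<close> the frequency integral converges absolutely, so every cut-off family can be
  removed by dominated convergence.
\<close>

theorem has_osc_integral_ft:
  fixes \<sigma> :: "real \<Rightarrow> complex"
  assumes g: "g \<in> test_functions (\<Omega> \<times> UNIV)" and \<sigma>: "continuous_on UNIV \<sigma>" "\<And>\<theta>. norm (\<sigma> \<theta>) \<le> 1 + \<bar>\<theta>\<bar>"
  shows "has_osc_integral (\<lambda>u \<theta>. \<theta> * P u) (\<lambda>u \<theta>. \<sigma> \<theta> * c (fst u) * g u) (LINT \<theta>|lborel. \<sigma> \<theta> * ft g \<theta>)"
  unfolding has_osc_integral_def
proof (intro ballI impI)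
  fix \<rho> :: "real \<Rightarrow> complex" assume \<rho>: "\<rho> \<in> test_functions UNIV" "\<rho> 0 = 1"
  have cr: "continuous_on UNIV \<rho>" using \<rho>(1) test_functions_smooth smooth_on_continuous by blast
  obtain K where K: "compact K" "\<forall>x. x \<notin> K \<longrightarrow> \<rho> x = 0" using test_functions_support[OF \<rho>(1)] by blast
  have "bounded (\<rho> ` K)"
    using K(1) cr by (intro compact_imp_bounded compact_continuous_image) (auto intro: continuous_on_subset)
  then obtain B0 where "\<And>x. x \<in> K \<Longrightarrow> norm (\<rho> x) \<le> B0" by (auto simp: bounded_iff)
  then have B: "norm (\<rho> x) \<le> max B0 0" for x using K(2) by (cases "x \<in> K") force+
  obtain C where C: "C \<ge> 0" "\<And>\<theta> z. norm (z::complex) \<le> 1 + \<bar>\<theta>\<bar> \<Longrightarrow> norm (z * ft g \<theta>) \<le> C * (2 * (1 / (1 + \<theta>\<^sup>2)))"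
    by (rule ft_decay[OF g]) blast
  have [measurable]: "ft g \<in> borel_measurable borel" using ft_measurable[OF g] by simp
  have [measurable]: "\<sigma> \<in> borel_measurable borel" using \<sigma>(1) borel_measurable_continuous_onI by blast
  have [measurable]: "\<rho> \<in> borel_measurable borel" using cr borel_measurable_continuous_onI by blast
  have inner: "(LINT u|lborel. \<rho> (\<epsilon> *\<^sub>R \<theta>) * exp (\<i> * of_real (\<theta> * P u)) * (\<sigma> \<theta> * c (fst u) * g u))
      = \<rho> (\<epsilon> * \<theta>) * (\<sigma> \<theta> * ft g \<theta>)" for \<epsilon> \<theta>
  proof -
    have "(LINT u|lborel. \<rho> (\<epsilon> *\<^sub>R \<theta>) * exp (\<i> * of_real (\<theta> * P u)) * (\<sigma> \<theta> * c (fst u) * g u))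
       = (LINT u|lborel. (\<rho> (\<epsilon> * \<theta>) * \<sigma> \<theta>) * (exp (\<i> * of_real (\<theta> * P u)) * (c (fst u) * g u)))"
      by (simp only: mult_ac real_scaleR_def)
    also have "\<dots> = (\<rho> (\<epsilon> * \<theta>) * \<sigma> \<theta>) * ft g \<theta>"
      unfolding osc_fourier_def by (rule integral_mult_right_zero)
    finally show ?thesis by (simp only: mult.assoc)
  qed
  show "((\<lambda>\<epsilon>. LINT \<theta>|lborel. (LINT u|lborel.
              \<rho> (\<epsilon> *\<^sub>R \<theta>) * exp (\<i> * of_real (\<theta> * P u)) * (\<sigma> \<theta> * c (fst u) * g u)))
          \<longlongrightarrow> (LINT \<theta>|lborel. \<sigma> \<theta> * ft g \<theta>)) (at_right 0)"
    unfolding inner tendsto_at_iff_sequentially comp_def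
  proof (intro allI impI)
    fix X :: "nat \<Rightarrow> real" assume X: "X \<longlonglongrightarrow> 0"
    show "(\<lambda>n. LINT \<theta>|lborel. \<rho> (X n * \<theta>) * (\<sigma> \<theta> * ft g \<theta>)) \<longlonglongrightarrow> (LINT \<theta>|lborel. \<sigma> \<theta> * ft g \<theta>)"
    proof (rule integral_dominated_convergence[where w = "\<lambda>\<theta>. max B0 0 * (C * (2 * (1 / (1 + \<theta>\<^sup>2))))"])
      show "integrable lborel (\<lambda>\<theta>::real. max B0 0 * (C * (2 * (1 / (1 + \<theta>\<^sup>2)))))"
        by (intro integrable_mult_right integrable_inverse_1_plus_square)
      show "AE \<theta> in lborel. (\<lambda>n. \<rho> (X n * \<theta>) * (\<sigma> \<theta> * ft g \<theta>)) \<longlonglongrightarrow> \<sigma> \<theta> * ft g \<theta>"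
      proof (rule AE_I2)
        fix \<theta> :: real
        have "(\<lambda>n. X n * \<theta>) \<longlonglongrightarrow> 0 * \<theta>" by (intro tendsto_intros X)
        then have "(\<lambda>n. \<rho> (X n * \<theta>)) \<longlonglongrightarrow> \<rho> 0"
          using continuous_on_tendsto_compose[OF cr] by fastforce
        then have "(\<lambda>n. \<rho> (X n * \<theta>) * (\<sigma> \<theta> * ft g \<theta>)) \<longlonglongrightarrow> \<rho> 0 * (\<sigma> \<theta> * ft g \<theta>)" by (rule tendsto_mult_right)
        then show "(\<lambda>n. \<rho> (X n * \<theta>) * (\<sigma> \<theta> * ft g \<theta>)) \<longlonglongrightarrow> \<sigma> \<theta> * ft g \<theta>" using \<rho>(2) by simp
      qed
      show "AE \<theta> in lborel. norm (\<rho> (X n * \<theta>) * (\<sigma> \<theta> * ft g \<theta>)) \<le> max B0 0 * (C * (2 * (1 / (1 + \<theta>\<^sup>2))))" for n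
        unfolding norm_mult[of "\<rho> _"] by (intro AE_I2 mult_mono B C(2) \<sigma>(2)) auto
    qed measurable
  qed
qed

text \<open>The cut-off family is not empty, so the limit is unique and \<open>osc_integral\<close> is its value.\<close>

lemma osc_integral_unique:
  fixes \<phi> :: "'u::euclidean_space \<Rightarrow> real \<Rightarrow> real"
  assumes "has_osc_integral \<phi> b I"
  shows "osc_integral \<phi> b = I"
  unfolding osc_integral_def
proof (rule the_equality[of "has_osc_integral \<phi> b", OF assms])
  fix J assume J: "has_osc_integral \<phi> b J"
  have "of_real (cutoff 0) = (1::complex)" by (simp add: cutoff_eq_1)
  note lim = this
  show "J = I"
    by (rule tendsto_unique[OF trivial_limit_at_right_real
        bspec[OF J[unfolded has_osc_integral_def] cutoff_test_function, rule_format, OF lim]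
        bspec[OF assms[unfolded has_osc_integral_def] cutoff_test_function, rule_format, OF lim]])
qed

text \<open>
  The same value as an absolutely convergent integral over \<open>y\<close> and the shifted time
  \<open>\<tau> = t - Q y\<close>: after the shift \<open>Q\<close> occurs only in the smooth factor, so that parameters on which
  \<open>Q\<close> depends smoothly can be differentiated although the kernel \<open>k\<close> is merely continuous.
\<close>

lemma osc_value_shifted:
  fixes \<sigma> :: "real \<Rightarrow> complex"
  assumes g: "g \<in> test_functions (\<Omega> \<times> UNIV)" and \<sigma>: "continuous_on UNIV \<sigma>" "\<And>\<theta>. norm (\<sigma> \<theta>) \<le> 1 + \<bar>\<theta>\<bar>"
  defines "k \<equiv> \<lambda>s::real. LINT \<theta>|lborel. \<sigma> \<theta> / of_real ((1 + \<theta>\<^sup>2)\<^sup>2) * exp (\<i> * of_real (\<theta> * s))"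
  shows "(LINT \<theta>|lborel. \<sigma> \<theta> * ft g \<theta>)
    = (LINT u|lborel. k (snd u) * (c (fst u) * one_minus_dtt (one_minus_dtt g) (fst u, Q (fst u) + snd u)))"
proof -
  let ?h = "one_minus_dtt (one_minus_dtt g)"
  have h: "?h \<in> test_functions (\<Omega> \<times> UNIV)" using g by (intro one_minus_dtt_test)
  have ck: "continuous_on UNIV k"
    unfolding k_def by (rule fourier_integrable_continuous[OF osc_weight_integrable[OF \<sigma>]])
  let ?F = "\<lambda>u. k (P u) * (c (fst u) * ?h u)"
  let ?G = "\<lambda>u. k (snd u) * (c (fst u) * ?h (fst u, Q (fst u) + snd u))"
  obtain K where K: "compact K" "K \<subseteq> \<Omega> \<times> UNIV" "\<forall>x. x \<notin> K \<longrightarrow> ?h x = 0" using test_functions_support[OF h] by blast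
  have iF: "integrable lborel ?F"
    by (rule compactly_supported_integrable[OF compactly_supported_mult[OF V _ supp[OF h]]])
       (rule continuous_on_compose2[OF ck P]; simp)
  have iG: "integrable lborel ?G"
  proof (rule integrable_continuous_compact)
    let ?L = "(\<lambda>u. (fst u, P u)) ` K"
    show L: "compact ?L"
      using K by (intro compact_continuous_image continuous_on_subset[OF _ K(2)] continuous_intros P)
    show z: "?G u = 0" if "u \<notin> ?L" for u
    proof -
      have "(fst u, Q (fst u) + snd u) \<notin> K"
      proof
        assume "(fst u, Q (fst u) + snd u) \<in> K"
        then have "(fst u, P (fst u, Q (fst u) + snd u)) \<in> ?L" by force
        then show False using that by simp
      qed
      then show ?thesis using K(3) by simp
    qed
    show "continuous_on UNIV ?G"
    proof (rule continuous_on_extend_zero[OF V compact_imp_closed[OF L]])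
      show "?L \<subseteq> \<Omega> \<times> UNIV" using K(2) by auto
      have ch: "continuous_on UNIV ?h" using h test_functions_smooth smooth_on_continuous by blast
      show "continuous_on (\<Omega> \<times> UNIV) ?G"
        by (intro continuous_intros continuous_on_compose2[OF ck] continuous_on_compose2[OF c]
            continuous_on_compose2[OF ch] continuous_on_compose2[OF Q]) auto
    qed (use z in auto)
  qed
  have "(LINT \<theta>|lborel. \<sigma> \<theta> * ft g \<theta>) = (LINT \<theta>|lborel. \<sigma> \<theta> / of_real ((1 + \<theta>\<^sup>2)\<^sup>2) * ft ?h \<theta>)"
    by (intro Bochner_Integration.integral_cong refl) (simp only: ft_twice[OF g] times_divide_eq_left times_divide_eq_right)
  also have "\<dots> = (LINT u|lborel. ?F u)"
    unfolding k_def by (rule osc_fourier_Fubini[OF V P supp[OF h] osc_weight_integrable[OF \<sigma>]])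
  also have "\<dots> = (LINT y|lborel. LINT t|lborel. ?F (y, t))"
    using iF lborel_pair.integral_fst'[of ?F] by (simp add: lborel_prod)
  also have "\<dots> = (LINT y|lborel. LINT t|lborel. ?G (y, t))"
  proof (rule Bochner_Integration.integral_cong[OF refl])
    fix y
    show "(LINT t|lborel. ?F (y, t)) = (LINT t|lborel. ?G (y, t))"
      using lborel_integral_real_affine[of 1 "\<lambda>t. ?F (y, t)" "Q y"] by simp
  qed
  also have "\<dots> = (LINT u|lborel. ?G u)"
    using iG lborel_pair.integral_fst'[of ?G] by (simp add: lborel_prod)
  finally show ?thesis .
qed

end

section \<open>Smooth dependence on parameters\<close>

text \<open>
  In \<open>J c h x\<close> only the factors \<open>c\<close> and \<open>h\<close> depend on the parameter \<open>x\<close>, and differentiation in \<open>x\<close>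
  either differentiates \<open>c\<close> or replaces \<open>c\<close> by \<open>c \<partial>Q\<close> and \<open>h\<close> by its time derivative.
\<close>

locale param_setup =
  fixes D :: "('x::euclidean_space \<times> 'y::euclidean_space) set" and Q :: "'x \<times> 'y \<Rightarrow> real"
    and k :: "real \<Rightarrow> complex" and W :: "'x set" and Kc :: "('y \<times> real) set"
  assumes D: "open D" and Q: "smooth_on D Q" and k: "continuous_on UNIV k"
    and W: "open W" and Kc: "compact Kc" and WD: "W \<times> fst ` Kc \<subseteq> D"
begin

text \<open>
  The test functions with support in \<open>Kc\<close>; the estimates below are uniform over them.
\<close>

definition H :: "('y \<times> real \<Rightarrow> complex) set" where
  "H = {h. smooth_on UNIV h \<and> (\<forall>u. u \<notin> Kc \<longrightarrow> h u = 0)}"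

definition \<Phi> :: "('x \<times> 'y \<Rightarrow> complex) \<Rightarrow> ('y \<times> real \<Rightarrow> complex) \<Rightarrow> 'x \<Rightarrow> 'y \<times> real \<Rightarrow> complex" where
  "\<Phi> c h x u = k (snd u) * (c (x, fst u) * h (fst u, Q (x, fst u) + snd u))"

definition J :: "('x \<times> 'y \<Rightarrow> complex) \<Rightarrow> ('y \<times> real \<Rightarrow> complex) \<Rightarrow> 'x \<Rightarrow> complex" where
  "J c h x = (LINT u|lborel. \<Phi> c h x u)"

definition tder :: "nat \<Rightarrow> ('y \<times> real \<Rightarrow> complex) \<Rightarrow> 'y \<times> real \<Rightarrow> complex" where
  "tder m = iter_pd (replicate m time_unit)"

abbreviation dc :: "'x \<Rightarrow> ('x \<times> 'y \<Rightarrow> complex) \<Rightarrow> 'x \<times> 'y \<Rightarrow> complex" where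
  "dc v c p \<equiv> frechet_derivative c (at p) (v, 0)"

abbreviation dQ :: "'x \<Rightarrow> ('x \<times> 'y \<Rightarrow> complex) \<Rightarrow> 'x \<times> 'y \<Rightarrow> complex" where
  "dQ v c p \<equiv> c p * of_real (frechet_derivative Q (at p) (v, 0))"

lemma Hz: "h \<in> H \<Longrightarrow> y \<notin> fst ` Kc \<Longrightarrow> h (y, t) = 0"
  unfolding H_def by force

lemma H_tder: "h \<in> H \<Longrightarrow> tder m h \<in> H"
proof -
  assume h: "h \<in> H"
  have "set (replicate m time_unit) \<subseteq> (Basis :: ('y \<times> real) set)" using time_unit_Basis by (cases m) auto
  then show "tder m h \<in> H"
    using h smooth_on_iter_pd[of UNIV h "replicate m time_unit"] iter_pd_zero_off[OF compact_imp_closed[OF Kc], of h]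
    unfolding H_def tder_def by blast
qed

lemma closed_base: "closed (fst ` Kc)" "compact (fst ` Kc)"
  using Kc by (auto intro!: compact_imp_closed compact_continuous_image continuous_intros)

lemma \<Phi>_continuous:
  assumes c: "continuous_on D c" and h: "h \<in> H"
  shows "continuous_on (W \<times> UNIV) (\<lambda>(x, u). \<Phi> c h x u)"
proof -
  have ch: "continuous_on UNIV h" using h smooth_on_continuous unfolding H_def by blast
  let ?A = "{p :: 'x \<times> 'y \<times> real. fst p \<in> W \<and> (fst p, fst (snd p)) \<in> D}" and ?B = "{p :: 'x \<times> 'y \<times> real. fst p \<in> W \<and> fst (snd p) \<notin> fst ` Kc}"
  have "open (fst -` W :: ('x \<times> 'y \<times> real) set)" by (rule open_vimage_fst[OF W])
  moreover have "open ((\<lambda>p :: 'x \<times> 'y \<times> real. (fst p, fst (snd p))) -` D)"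
    by (rule open_vimage[OF D]) (intro continuous_intros)
  moreover have "open ((\<lambda>p :: 'x \<times> 'y \<times> real. fst (snd p)) -` (- fst ` Kc))"
    by (rule open_vimage) (use closed_base in \<open>auto intro!: continuous_intros\<close>)
  moreover have "?A = fst -` W \<inter> (\<lambda>p. (fst p, fst (snd p))) -` D"
    "?B = fst -` W \<inter> (\<lambda>p. fst (snd p)) -` (- fst ` Kc)" by auto
  ultimately have o: "open ?A" "open ?B" by (simp_all only: open_Int)
  have "continuous_on ?A (\<lambda>(x, u). \<Phi> c h x u)"
  proof -
    have b: "continuous_on ?A (\<lambda>p :: 'x \<times> 'y \<times> real. (fst p, fst (snd p)))"
      "continuous_on ?A (\<lambda>p :: 'x \<times> 'y \<times> real. fst (snd p))"
      "continuous_on ?A (\<lambda>p :: 'x \<times> 'y \<times> real. snd (snd p))" by (intro continuous_intros)+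
    have D': "(\<lambda>p. (fst p, fst (snd p))) ` ?A \<subseteq> D" by auto
    note q = continuous_on_compose2[OF smooth_on_continuous[OF Q] b(1) D']
    have "continuous_on ?A (\<lambda>p. h (fst (snd p), Q (fst p, fst (snd p)) + snd (snd p)))"
      by (rule continuous_on_compose2[OF ch continuous_on_Pair[OF b(2) continuous_on_add[OF q b(3)]] subset_UNIV])
    from continuous_on_mult[OF continuous_on_compose2[OF k b(3) subset_UNIV]
        continuous_on_mult[OF continuous_on_compose2[OF c b(1) D'] this]]
    show ?thesis unfolding \<Phi>_def case_prod_beta .
  qed
  moreover have "continuous_on ?B (\<lambda>(x, u). \<Phi> c h x u)"
    by (rule continuous_on_eq[OF continuous_on_const[of _ 0]]) (auto simp: \<Phi>_def Hz[OF h])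
  ultimately have "continuous_on (?A \<union> ?B) (\<lambda>(x, u). \<Phi> c h x u)" using o by (intro continuous_on_open_Un)
  moreover have "?A \<union> ?B = W \<times> UNIV" using WD by auto
  ultimately show ?thesis by simp
qed

lemma \<Phi>_continuous_slice:
  assumes "continuous_on D c" "h \<in> H" "x \<in> W"
  shows "continuous_on UNIV (\<Phi> c h x)"
proof -
  have "continuous_on UNIV (\<lambda>u :: 'y \<times> real. (x, u))" by (intro continuous_intros)
  from continuous_on_compose2[OF \<Phi>_continuous[OF assms(1,2)] this] show ?thesis using assms(3) by auto
qed

text \<open>
  For \<open>x\<close> in a compact set the values of \<open>Q\<close> over the base of \<open>Kc\<close> are bounded, so the shift in time
  moves the support by a bounded amount, the same for all \<open>h\<close>.
\<close>

lemma support_bound: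
  assumes "compact K'" "K' \<subseteq> W"
  obtains S where "compact S" "S \<subseteq> fst ` Kc \<times> UNIV" "\<And>c h x u. x \<in> K' \<Longrightarrow> h \<in> H \<Longrightarrow> u \<notin> S \<Longrightarrow> \<Phi> c h x u = 0"
proof -
  have KD: "K' \<times> fst ` Kc \<subseteq> D" using assms WD by auto
  have "compact (Q ` (K' \<times> fst ` Kc))"
    by (rule compact_continuous_image[OF continuous_on_subset[OF smooth_on_continuous[OF Q] KD]
        compact_Times[OF assms(1) closed_base(2)]])
  then obtain R0 where R0: "\<And>p. p \<in> K' \<times> fst ` Kc \<Longrightarrow> \<bar>Q p\<bar> \<le> R0"
    by (force dest!: compact_imp_bounded simp: bounded_iff)
  have "compact (snd ` Kc)" using Kc by (intro compact_continuous_image continuous_intros)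
  then obtain R1 where R1: "\<And>u. u \<in> Kc \<Longrightarrow> \<bar>snd u\<bar> \<le> R1"
    by (force dest!: compact_imp_bounded simp: bounded_iff)
  show thesis
  proof (rule that[of "fst ` Kc \<times> cball (0::real) (R0 + R1)"])
    show "compact (fst ` Kc \<times> cball (0::real) (R0 + R1))" by (rule compact_Times[OF closed_base(2) compact_cball])
    fix c h x u assume *: "x \<in> K'" "h \<in> H" "u \<notin> fst ` Kc \<times> cball (0::real) (R0 + R1)"
    show "\<Phi> c h x u = 0"
    proof (cases "(fst u, Q (x, fst u) + snd u) \<in> Kc")
      case True
      from imageI[OF this, of fst] have y: "fst u \<in> fst ` Kc" by simp
      have "\<bar>snd u\<bar> \<le> R0 + R1" using R1[OF True] R0[of "(x, fst u)"] y *(1) by auto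
      then show ?thesis using * y by (cases u) (auto simp: dist_real_def)
    next
      case False
      then show ?thesis using *(2) by (auto simp: \<Phi>_def H_def)
    qed
  qed auto
qed

lemma \<Phi>_integrable:
  assumes "continuous_on D c" "h \<in> H" "x \<in> W"
  shows "integrable lborel (\<Phi> c h x)"
proof -
  have "{x} \<subseteq> W" using assms(3) by simp
  then obtain S where "compact S" "\<And>c h x' u. x' \<in> {x} \<Longrightarrow> h \<in> H \<Longrightarrow> u \<notin> S \<Longrightarrow> \<Phi> c h x' u = 0"
    using support_bound[of "{x}"] by (metis compact_sing)
  then show ?thesis
    using integrable_continuous_compact[OF \<Phi>_continuous_slice[OF assms]] assms(2) by blast
qed

definition DJ :: "('x \<times> 'y \<Rightarrow> complex) \<Rightarrow> ('y \<times> real \<Rightarrow> complex) \<Rightarrow> 'x \<Rightarrow> 'x \<Rightarrow> complex" where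
  "DJ c h x v = J (dc v c) h x + J (dQ v c) (tder 1 h) x"

lemma smooth_dc: "smooth_on D c \<Longrightarrow> smooth_on D (dc v c)"
  by (rule smooth_on_pd_any[OF D])

lemma smooth_dQ:
  assumes "smooth_on D c"
  shows "smooth_on D (dQ v c)"
  by (rule smooth_on_mult[OF D assms smooth_on_linear_compose[OF D bounded_linear_of_real smooth_on_pd_any[OF D Q]]])

lemma J_has_derivative:
  assumes c: "smooth_on D c" and h: "h \<in> H" and x0: "x0 \<in> W"
  shows "(J c h has_derivative DJ c h x0) (at x0)"
proof -
  obtain \<delta> where \<delta>: "\<delta> > 0" "cball x0 \<delta> \<subseteq> W" using W x0 open_contains_cball by blast
  obtain S where S: "compact S" "\<And>c h x u. x \<in> cball x0 \<delta> \<Longrightarrow> h \<in> H \<Longrightarrow> u \<notin> S \<Longrightarrow> \<Phi> c h x u = 0"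
    using support_bound[OF compact_cball \<delta>(2)] by metis
  let ?\<Phi>' = "\<lambda>x u v. \<Phi> (dc v c) h x u + \<Phi> (dQ v c) (tder 1 h) x u"
  have h1: "tder 1 h \<in> H" using H_tder[OF h] .
  have cont: "continuous_on D (dc v c)" "continuous_on D (dQ v c)" for v
    using smooth_dc[OF c] smooth_dQ[OF c] smooth_on_continuous by blast+
  have der: "((\<lambda>x. \<Phi> c h x u) has_derivative ?\<Phi>' x u) (at x)" if x: "x \<in> ball x0 \<delta>" for x u
  proof (cases "fst u \<in> fst ` Kc")
    case False
    then show ?thesis unfolding \<Phi>_def using Hz[OF h False] Hz[OF h1 False] by simp
  next
    case True
    obtain y \<tau> where u: "u = (y, \<tau>)" by force
    have "x \<in> W" using x \<delta>(2) by auto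
    moreover have "y \<in> fst ` Kc" using True u by simp
    ultimately have p: "(x, y) \<in> D" using WD by blast
    have i: "((\<lambda>x. (x, y)) has_derivative (\<lambda>v. (v, 0))) (at x)" by (auto intro!: derivative_eq_intros)
    have 1: "((\<lambda>x. c (x, y)) has_derivative (\<lambda>v. dc v c (x, y))) (at x)"
      using has_derivative_compose[OF i smooth_on_has_derivative[OF c D p]] .
    have 2: "((\<lambda>x. Q (x, y) + \<tau>) has_derivative (\<lambda>v. frechet_derivative Q (at (x, y)) (v, 0))) (at x)"
      using has_derivative_add[OF has_derivative_compose[OF i smooth_on_has_derivative[OF Q D p]]
          has_derivative_const[of \<tau>]] by simp
    have 3: "((\<lambda>t. h (y, t)) has_derivative (\<lambda>s. s *\<^sub>R tder 1 h (y, Q (x, y) + \<tau>))) (at (Q (x, y) + \<tau>))"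
      using time_derivative[of h y "Q (x, y) + \<tau>"] h
      by (simp add: H_def tder_def has_vector_derivative_def)
    have 4: "((\<lambda>x. h (y, Q (x, y) + \<tau>)) has_derivative
       (\<lambda>v. frechet_derivative Q (at (x, y)) (v, 0) *\<^sub>R tder 1 h (y, Q (x, y) + \<tau>))) (at x)"
      using has_derivative_compose[OF 2 3] .
    have "((\<lambda>x. k \<tau> * (c (x, y) * h (y, Q (x, y) + \<tau>))) has_derivative
       (\<lambda>v. k \<tau> * (c (x, y) * (frechet_derivative Q (at (x, y)) (v, 0) *\<^sub>R tder 1 h (y, Q (x, y) + \<tau>))
             + dc v c (x, y) * h (y, Q (x, y) + \<tau>)))) (at x)"
      by (rule has_derivative_mult_right[OF has_derivative_mult[OF 1 4]])
    then show ?thesis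
      unfolding u \<Phi>_def fst_conv snd_conv scaleR_conv_of_real by (simp add: algebra_simps)
  qed
  have "((\<lambda>x. LINT u|lborel. \<Phi> c h x u) has_derivative (\<lambda>v. LINT u|lborel. ?\<Phi>' x0 u v)) (at x0)"
  proof (rule has_derivative_integral_param[where X = "ball x0 \<delta>", OF _ _ S(1)])
    show "\<Phi> c h x u = 0" if "x \<in> ball x0 \<delta>" "u \<notin> S" for x u using S(2)[OF _ h that(2)] that(1) by auto
    show "continuous_on UNIV (\<Phi> c h x)" if "x \<in> ball x0 \<delta>" for x
      using \<Phi>_continuous_slice[OF smooth_on_continuous[OF c] h] \<delta>(2) that by (meson ball_subset_cball subsetD)
    have "continuous_on (W \<times> UNIV) (\<lambda>p. (\<lambda>(x, u). \<Phi> (dc v c) h x u) p + (\<lambda>(x, u). \<Phi> (dQ v c) (tder 1 h) x u) p)" for v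
      by (rule continuous_on_add[OF \<Phi>_continuous[OF cont(1) h] \<Phi>_continuous[OF cont(2) h1]])
    then have "continuous_on (ball x0 \<delta> \<times> UNIV) (\<lambda>p. (\<lambda>(x, u). \<Phi> (dc v c) h x u) p + (\<lambda>(x, u). \<Phi> (dQ v c) (tder 1 h) x u) p)" for v
      by (rule continuous_on_subset) (use \<delta>(2) in auto)
    then show "continuous_on (ball x0 \<delta> \<times> UNIV) (\<lambda>(x, u). ?\<Phi>' x u v)" for v
      by (simp add: case_prod_beta)
  qed (use \<delta> der in auto)
  moreover have "(LINT u|lborel. ?\<Phi>' x0 u v) = DJ c h x0 v" for v
    unfolding DJ_def J_def
    by (rule Bochner_Integration.integral_add[OF \<Phi>_integrable[OF cont(1) h x0] \<Phi>_integrable[OF cont(2) h1 x0]])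
  ultimately show ?thesis unfolding J_def[abs_def] by simp
qed

text \<open>
  A finite sum of terms \<open>J c\<close> applied to time derivatives of \<open>h\<close>, given by the list of coefficients and
  orders. The list is kept apart from \<open>h\<close> because it determines the constants in the estimates.
\<close>

definition Jsum :: "(('x \<times> 'y \<Rightarrow> complex) \<times> nat) list \<Rightarrow> ('y \<times> real \<Rightarrow> complex) \<Rightarrow> 'x \<Rightarrow> complex" where
  "Jsum L h x = (\<Sum>(c, m)\<leftarrow>L. J c (tder m h) x)"

definition deriv_terms :: "'x \<Rightarrow> (('x \<times> 'y \<Rightarrow> complex) \<times> nat) list \<Rightarrow> (('x \<times> 'y \<Rightarrow> complex) \<times> nat) list" where
  "deriv_terms v L = concat (map (\<lambda>(c, m). [(dc v c, m), (dQ v c, Suc m)]) L)"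

lemma Jsum_simps: "Jsum [] h x = 0" "Jsum ((c, m) # L) h x = J c (tder m h) x + Jsum L h x"
  by (simp_all add: Jsum_def)

lemma deriv_terms_simps: "deriv_terms v [] = []"
  "deriv_terms v ((c, m) # L) = (dc v c, m) # (dQ v c, Suc m) # deriv_terms v L"
  by (simp_all add: deriv_terms_def)

lemma tder_Suc: "tder 1 (tder m h) = tder (Suc m) h"
  by (simp add: tder_def)

lemma Jsum_has_derivative:
  assumes "\<forall>(c, m)\<in>set L. smooth_on D c" "h \<in> H" "x \<in> W"
  shows "(Jsum L h has_derivative (\<lambda>v. Jsum (deriv_terms v L) h x)) (at x)"
  using assms(1)
proof (induction L)
  case Nil
  then show ?case by (simp add: Jsum_def[abs_def] deriv_terms_simps)
next
  case (Cons a L)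
  obtain c m where a: "a = (c, m)" by force
  have "(J c (tder m h) has_derivative DJ c (tder m h) x) (at x)"
    using J_has_derivative H_tder[OF assms(2)] Cons.prems assms(3) a by auto
  moreover have "(Jsum L h has_derivative (\<lambda>v. Jsum (deriv_terms v L) h x)) (at x)"
    using Cons by simp
  ultimately have "((\<lambda>x. J c (tder m h) x + Jsum L h x) has_derivative
      (\<lambda>v. DJ c (tder m h) x v + Jsum (deriv_terms v L) h x)) (at x)"
    by (rule has_derivative_add)
  moreover have "Jsum (a # L) h = (\<lambda>x. J c (tder m h) x + Jsum L h x)"
    by (simp add: a Jsum_simps fun_eq_iff)
  moreover have "Jsum (deriv_terms v (a # L)) h x = DJ c (tder m h) x v + Jsum (deriv_terms v L) h x" for v
    unfolding a deriv_terms_simps Jsum_simps DJ_def tder_Suc by simp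
  ultimately show ?case by simp
qed

lemma deriv_terms_smooth:
  "\<forall>(c, m)\<in>set L. smooth_on D c \<Longrightarrow> \<forall>(c, m)\<in>set (deriv_terms v L). smooth_on D c"
  by (induction L) (auto simp: deriv_terms_simps intro: smooth_dc smooth_dQ)

text \<open>
  The terms of the derivative depend on \<open>bs\<close> and on the terms of the function but not on \<open>h\<close>. This is
  what makes the bounds on the derivatives uniform in \<open>h\<close>.
\<close>

lemma iter_pd_Jsum:
  assumes L: "\<forall>(c, m)\<in>set L. smooth_on D c" and h: "h \<in> H"
  shows "x \<in> W \<Longrightarrow> iter_pd bs (Jsum L h) x = Jsum (foldr deriv_terms bs L) h x"
    and "\<forall>(c, m)\<in>set (foldr deriv_terms bs L). smooth_on D c"
proof -
  show sm: "\<forall>(c, m)\<in>set (foldr deriv_terms bs L). smooth_on D c" for bs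
    by (induction bs) (use L deriv_terms_smooth in auto)
  show "iter_pd bs (Jsum L h) x = Jsum (foldr deriv_terms bs L) h x" if "x \<in> W"
    using that
  proof (induction bs arbitrary: x)
    case (Cons b bs)
    have "iter_pd (b # bs) (Jsum L h) x = frechet_derivative (Jsum (foldr deriv_terms bs L) h) (at x) b"
      using frechet_derivative_cong_open[OF W Cons.prems Cons.IH] by simp
    also have "\<dots> = Jsum (foldr deriv_terms (b # bs) L) h x"
      using frechet_derivative_eqI[OF Jsum_has_derivative[OF sm h Cons.prems]] by simp
    finally show ?case .
  qed simp
qed

lemma smooth_on_Jsum:
  assumes "\<forall>(c, m)\<in>set L. smooth_on D c" "h \<in> H"
  shows "smooth_on W (Jsum L h)"
proof -
  have "iter_pd bs (Jsum L h) differentiable_on W" for bs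
  proof (rule differentiable_on_cong)
    show "Jsum (foldr deriv_terms bs L) h differentiable_on W"
      by (rule differentiable_onI[OF Jsum_has_derivative[OF iter_pd_Jsum(2)[OF assms] assms(2)]])
  qed (use iter_pd_Jsum(1)[OF assms] in auto)
  then show ?thesis by (simp add: smooth_on_open_iff[OF W])
qed

lemma J_bound:
  assumes c: "smooth_on D c" and K': "compact K'" "K' \<subseteq> W"
  obtains B where "B \<ge> 0"
    "\<And>h x M. h \<in> H \<Longrightarrow> x \<in> K' \<Longrightarrow> 0 \<le> M \<Longrightarrow> (\<And>u. u \<in> Kc \<Longrightarrow> norm (h u) \<le> M) \<Longrightarrow> norm (J c h x) \<le> B * M"
proof -
  obtain S where S: "compact S" "S \<subseteq> fst ` Kc \<times> UNIV"
    "\<And>c h x u. x \<in> K' \<Longrightarrow> h \<in> H \<Longrightarrow> u \<notin> S \<Longrightarrow> \<Phi> c h x u = 0"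
    using support_bound[OF K'] by metis
  let ?f = "\<lambda>p. k (snd (snd p)) * c (fst p, fst (snd p))"
  have sub: "(x, fst u) \<in> D" if "x \<in> K'" "u \<in> S" for x u
  proof -
    have "fst u \<in> fst ` Kc" using S(2) that(2) by (metis mem_Times_iff subsetD)
    then show ?thesis using WD K'(2) that(1) by blast
  qed
  have "continuous_on (K' \<times> S) ?f"
    using sub
    by (intro continuous_intros continuous_on_compose2[OF k] continuous_on_compose2[OF smooth_on_continuous[OF c]]) auto
  then have "compact (?f ` (K' \<times> S))" using K' S by (intro compact_continuous_image compact_Times)
  then obtain b0 where b0: "\<And>p. p \<in> K' \<times> S \<Longrightarrow> norm (?f p) \<le> b0"
    by (force dest!: compact_imp_bounded simp: bounded_iff)
  define b where "b = max b0 0"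
  have b: "b \<ge> 0" "\<And>x u. x \<in> K' \<Longrightarrow> u \<in> S \<Longrightarrow> norm (k (snd u)) * norm (c (x, fst u)) \<le> b"
    using b0 by (force simp: b_def norm_mult)+
  have fin: "emeasure lborel S < \<infinity>" using S(1) emeasure_compact_finite by blast
  have Sm: "S \<in> sets lborel" using S(1) by (simp add: borel_compact)
  show thesis
  proof (rule that[of "measure lborel S * b"])
    show "0 \<le> measure lborel S * b" using b(1) by simp
    fix h x M assume h: "h \<in> H" and x: "x \<in> K'" and M: "0 \<le> M" "\<And>u. u \<in> Kc \<Longrightarrow> norm (h u) \<le> M"
    have hM: "norm (h u) \<le> M" for u
    proof (cases "u \<in> Kc")
      case False
      then have "h u = 0" using h unfolding H_def by blast
      then show ?thesis using M(1) by simp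
    qed (rule M(2))
    have bd: "norm (\<Phi> c h x u) \<le> indicator S u * (b * M)" for u
    proof (cases "u \<in> S")
      case True
      have "norm (\<Phi> c h x u) = (norm (k (snd u)) * norm (c (x, fst u))) * norm (h (fst u, Q (x, fst u) + snd u))"
        by (simp add: \<Phi>_def norm_mult)
      also have "\<dots> \<le> b * M" using b x True hM by (intro mult_mono) auto
      finally show ?thesis using True by simp
    next
      case False
      then show ?thesis using S(3)[OF x h] by simp
    qed
    have "norm (J c h x) \<le> (LINT u|lborel. norm (\<Phi> c h x u))" unfolding J_def by (rule integral_norm_bound)
    also have "\<dots> \<le> (LINT u|lborel. indicator S u * (b * M))"
    proof (rule integral_mono)
      show "integrable lborel (\<lambda>u. norm (\<Phi> c h x u))"
        using \<Phi>_integrable[OF smooth_on_continuous[OF c] h] x K'(2) by (intro integrable_norm) auto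
      show "integrable lborel (\<lambda>u. indicator S u * (b * M))"
        using fin Sm by (intro integrable_mult_left integrable_real_indicator)
    qed (rule bd)
    also have "\<dots> = measure lborel S * b * M" using Sm fin by simp
    finally show "norm (J c h x) \<le> measure lborel S * b * M" .
  qed
qed

lemma Jsum_bound:
  assumes L: "\<forall>(c, m)\<in>set L. smooth_on D c" and K': "compact K'" "K' \<subseteq> W"
  shows "\<exists>B\<ge>0. \<exists>N. \<forall>h\<in>H. \<forall>M\<ge>0. derivs_bounded N Kc h M \<longrightarrow> (\<forall>x\<in>K'. norm (Jsum L h x) \<le> B * M)"
  using L
proof (induction L)
  case Nil
  then show ?case by (auto simp: Jsum_simps)
next
  case (Cons a L)
  obtain c m where a: "a = (c, m)" by force
  obtain B1 where B1: "B1 \<ge> 0" 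
    "\<And>h x M. h \<in> H \<Longrightarrow> x \<in> K' \<Longrightarrow> 0 \<le> M \<Longrightarrow> (\<And>u. u \<in> Kc \<Longrightarrow> norm (h u) \<le> M) \<Longrightarrow> norm (J c h x) \<le> B1 * M"
    using J_bound[OF _ K', of c] Cons.prems a by auto
  obtain B2 N2 where B2: "B2 \<ge> 0"
    "\<And>h M x. h \<in> H \<Longrightarrow> M \<ge> 0 \<Longrightarrow> derivs_bounded N2 Kc h M \<Longrightarrow> x \<in> K' \<Longrightarrow> norm (Jsum L h x) \<le> B2 * M"
  proof -
    have "\<forall>(c, m)\<in>set L. smooth_on D c" using Cons.prems by simp
    from Cons.IH[OF this] show ?thesis using that by blast
  qed
  show ?case
  proof (intro exI[of _ "B1 + B2"] exI[of _ "max m N2"] conjI ballI allI impI)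
    fix h x and M :: real assume h: "h \<in> H" and M: "0 \<le> M" and d: "derivs_bounded (max m N2) Kc h M" and x: "x \<in> K'"
    have "norm (tder m h u) \<le> M" if "u \<in> Kc" for u
    proof -
      have "set (replicate m time_unit) \<subseteq> (Basis :: ('y \<times> real) set)" using time_unit_Basis by (cases m) auto
      then show ?thesis using d that unfolding derivs_bounded_def tder_def by simp
    qed
    then have "norm (J c (tder m h) x) \<le> B1 * M" using B1(2) H_tder[OF h] x M by blast
    moreover have "norm (Jsum L h x) \<le> B2 * M"
    proof -
      have "derivs_bounded N2 Kc h M" using d unfolding derivs_bounded_def by (meson max.coboundedI2)
      from B2(2)[OF h M this x] show ?thesis .
    qed
    ultimately show "norm (Jsum (a # L) h x) \<le> (B1 + B2) * M"
      using norm_triangle_ineq[of "J c (tder m h) x" "Jsum L h x"] by (simp add: a Jsum_simps distrib_right)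
  qed (use B1 B2 in simp)
qed

text \<open>
  There are only finitely many lists of basis vectors of length at most \<open>N\<close>, so the constants and
  orders for the single derivatives can be added up.
\<close>

lemma Jsum_derivs_bounded:
  assumes L: "\<forall>(c, m)\<in>set L. smooth_on D c" and K': "compact K'" "K' \<subseteq> W"
  shows "\<exists>B\<ge>0. \<exists>N'. \<forall>h\<in>H. \<forall>M\<ge>0. derivs_bounded N' Kc h M \<longrightarrow> derivs_bounded N K' (Jsum L h) (B * M)"
proof (cases "H = {}")
  case False
  then obtain h0 where h0: "h0 \<in> H" by blast
  let ?T = "{bs. set bs \<subseteq> (Basis :: 'x set) \<and> length bs \<le> N}"
  have T: "finite ?T" by (rule finite_lists_length_le) simp
  have "\<exists>B N'. B \<ge> 0 \<and> (\<forall>h\<in>H. \<forall>M\<ge>0. derivs_bounded N' Kc h M \<longrightarrow>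
           (\<forall>x\<in>K'. norm (Jsum (foldr deriv_terms bs L) h x) \<le> B * M))" for bs
    using Jsum_bound[OF iter_pd_Jsum(2)[OF L h0] K', of bs] by blast
  then obtain B N' where BN: "\<And>bs. B bs \<ge> 0"
    "\<And>bs h M x. h \<in> H \<Longrightarrow> M \<ge> 0 \<Longrightarrow> derivs_bounded (N' bs) Kc h M \<Longrightarrow> x \<in> K' \<Longrightarrow>
           norm (Jsum (foldr deriv_terms bs L) h x) \<le> B bs * M"
    by metis
  show ?thesis
  proof (intro exI[of _ "sum B ?T"] exI[of _ "sum N' ?T"] conjI ballI allI impI)
    show "0 \<le> sum B ?T" using BN(1) by (intro sum_nonneg)
    fix h and M :: real assume h: "h \<in> H" and M: "0 \<le> M" and d: "derivs_bounded (sum N' ?T) Kc h M"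
    show "derivs_bounded N K' (Jsum L h) (sum B ?T * M)"
      unfolding derivs_bounded_def
    proof (intro allI impI ballI)
      fix bs x assume bs: "set bs \<subseteq> (Basis :: 'x set) \<and> length bs \<le> N" and x: "x \<in> K'"
      have "N' bs \<le> sum N' ?T" using T bs by (intro member_le_sum) auto
      then have "derivs_bounded (N' bs) Kc h M" using d unfolding derivs_bounded_def by auto
      then have "norm (Jsum (foldr deriv_terms bs L) h x) \<le> B bs * M" using BN(2)[OF h M _ x] by blast
      also have "\<dots> \<le> sum B ?T * M"
        using T bs BN(1) M by (intro mult_right_mono member_le_sum) auto
      finally show "norm (iter_pd bs (Jsum L h) x) \<le> sum B ?T * M"
        using iter_pd_Jsum(1)[OF L h] x K'(2) by auto
    qed
  qed
qed auto

end

section \<open>The phase function of the Radon transform\<close>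

lemma grad_eqI: "(f has_derivative (\<lambda>v. v \<bullet> g)) (at x) \<Longrightarrow> grad f x = g"
  unfolding grad_def using frechet_derivative_eqI[of f "\<lambda>v. v \<bullet> g" x]
  by (simp add: euclidean_representation inner_commute[of _ g])

lemma smooth_on_fst: "smooth_on W fst" and smooth_on_snd: "smooth_on W snd"
  by (intro smooth_on_linear bounded_linear_fst bounded_linear_snd)+

text \<open>The tangent vector of the graph that lies over \<open>\<eta>\<close> when the graph function has derivative \<open>l\<close>.\<close>

definition graph_tangent :: "(real ^ 'm \<Rightarrow> real) \<Rightarrow> real ^ 'm \<Rightarrow> real ^ ('m::finite option)" where
  "graph_tangent l \<eta> = (\<chi> i. case i of None \<Rightarrow> l \<eta> | Some j \<Rightarrow> \<eta> $ j)"

definition base_part :: "real ^ ('m::finite option) \<Rightarrow> real ^ 'm" where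
  "base_part z = (\<chi> j. z $ Some j)"

lemma sum_option:
  fixes f :: "'m::finite option \<Rightarrow> 'b::comm_monoid_add"
  shows "(\<Sum>i\<in>UNIV. f i) = f None + (\<Sum>j\<in>UNIV. f (Some j))"
  unfolding UNIV_option_conv by (subst sum.insert) (auto simp: sum.reindex)

lemma inner_option: "(a :: real ^ ('m::finite option)) \<bullet> b = a $ None * b $ None + base_part a \<bullet> base_part b"
  by (simp add: inner_vec_def sum_option base_part_def)

lemma graph_tangent_components [simp]:
  "graph_tangent l \<eta> $ None = l \<eta>" "base_part (graph_tangent l \<eta>) = \<eta>"
  by (simp_all add: graph_tangent_def base_part_def vec_eq_iff)

lemma graph_point_components [simp]:
  "graph_point q y $ None = q y" "base_part (graph_point q y) = y"
  by (simp_all add: graph_point_def base_part_def vec_eq_iff)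

lemma vec_option_eqI: "a $ None = b $ None \<Longrightarrow> base_part a = base_part b \<Longrightarrow> a = b"
  by (simp add: vec_eq_iff base_part_def) (metis not_None_eq)

lemma base_part_linear: "bounded_linear base_part"
  by (auto intro!: linear_conv_bounded_linear[THEN iffD1] linearI simp: base_part_def vec_eq_iff)

lemma graph_point_has_derivative:
  assumes "(q has_derivative l) (at y)"
  shows "(graph_point q has_derivative graph_tangent l) (at y)"
proof -
  have "((\<lambda>y. graph_point q y $ i) has_derivative (\<lambda>\<eta>. graph_tangent l \<eta> $ i)) (at y)" for i
    by (cases i)
       (auto simp: graph_point_def graph_tangent_def intro!: assms bounded_linear_imp_has_derivative bounded_linear_vec_nth)
  then show ?thesis
    by (subst has_derivative_componentwise_within)
       (auto simp: Basis_vec_def inner_axis)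
qed

lemma smooth_on_graph_point:
  assumes "open W" "open \<Omega>" "smooth_on \<Omega> q" "smooth_on W f" "f ` W \<subseteq> \<Omega>"
  shows "smooth_on W (\<lambda>w. graph_point q (f w) :: real ^ ('m::finite option))"
proof (rule smooth_on_componentwise[OF assms(1)])
  fix b :: "real ^ ('m option)" assume "b \<in> Basis"
  then obtain i where b: "b = axis i 1" by (auto simp: Basis_vec_def)
  show "smooth_on W (\<lambda>w. graph_point q (f w) \<bullet> b)"
  proof (cases i)
    case None
    then show ?thesis
      using smooth_on_compose[OF assms(1,2,3,4,5)] by (simp add: b inner_axis)
  next
    case (Some j)
    have "smooth_on W (\<lambda>w. f w $ j)"
      by (rule smooth_on_linear_compose[OF assms(1) bounded_linear_vec_nth assms(4)])
    then show ?thesis by (simp add: b inner_axis Some graph_point_def)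
  qed
qed

locale radon_geometry =
  fixes \<Omega> :: "(real ^ 'm) set"
    and q :: "real ^ 'm \<Rightarrow> real"
    and A :: "real ^ ('m option) ^ ('m::finite option)"
  assumes \<Omega>: "open \<Omega>" and q: "smooth_on \<Omega> q" and sym: "transpose A = A" and inv: "invertible A"
begin

abbreviation \<gamma> :: "real ^ 'm \<Rightarrow> real ^ ('m option)" where "\<gamma> \<equiv> graph_point q"

abbreviation dq :: "real ^ 'm \<Rightarrow> real ^ 'm \<Rightarrow> real" where "dq y \<equiv> frechet_derivative q (at y)"

abbreviation d\<gamma> :: "real ^ 'm \<Rightarrow> real ^ 'm \<Rightarrow> real ^ ('m option)" where "d\<gamma> y \<equiv> graph_tangent (dq y)"

definition amp :: "real ^ 'm \<Rightarrow> real ^ ('m option) \<Rightarrow> real" where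
  "amp y x = norm (2 *\<^sub>R (A *v (x - \<gamma> y)))"

lemma A_sym: "(A *v a) \<bullet> b = a \<bullet> (A *v b)"
  by (metis dot_lmul_matrix sym vector_transpose_matrix)

lemma A_inj: "A *v a = A *v b \<longleftrightarrow> a = b"
  using inv by (metis invertible_def matrix_vector_mul_assoc matrix_vector_mul_lid)

lemma A_nz: "A *v a = 0 \<longleftrightarrow> a = 0"
  using A_inj[of a 0] by simp

lemma A_linear: "bounded_linear ((*v) A)"
  by (rule matrix_vector_mul_bounded_linear)

lemma q_der: "y \<in> \<Omega> \<Longrightarrow> (q has_derivative dq y) (at y)"
  using smooth_on_has_derivative[OF q \<Omega>] .

lemma \<gamma>_der: "y \<in> \<Omega> \<Longrightarrow> (\<gamma> has_derivative d\<gamma> y) (at y)"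
  by (rule graph_point_has_derivative[OF q_der])

lemma dq_grad: "y \<in> \<Omega> \<Longrightarrow> dq y \<eta> = \<eta> \<bullet> grad q y"
proof -
  assume "y \<in> \<Omega>"
  then have l: "linear (dq y)" using has_derivative_linear q_der by blast
  have "dq y \<eta> = dq y (\<Sum>b\<in>Basis. (\<eta> \<bullet> b) *\<^sub>R b)" by (simp add: euclidean_representation)
  also have "\<dots> = (\<Sum>b\<in>Basis. (\<eta> \<bullet> b) * dq y b)" by (simp add: linear_sum[OF l] linear_scale[OF l])
  also have "\<dots> = \<eta> \<bullet> grad q y" unfolding grad_def by (simp add: inner_sum_right mult.commute)
  finally show ?thesis .
qed

lemma \<gamma>_continuous: "continuous_on \<Omega> \<gamma>"
  using smooth_on_continuous[OF smooth_on_graph_point[OF \<Omega> \<Omega> q smooth_on_ident]] by simp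

lemma quad_der:
  assumes "(f has_derivative f') (at w)" "(g has_derivative g') (at w)" "f w \<in> \<Omega>"
  shows "((\<lambda>w. quad q A (f w) (g w)) has_derivative
    (\<lambda>v. 2 * ((g' v - d\<gamma> (f w) (f' v)) \<bullet> (A *v (g w - \<gamma> (f w)))))) (at w)"
proof -
  have "((\<lambda>w. g w - \<gamma> (f w)) has_derivative (\<lambda>v. g' v - d\<gamma> (f w) (f' v))) (at w)"
    by (rule has_derivative_diff[OF assms(2) has_derivative_compose[OF assms(1) \<gamma>_der[OF assms(3)]]])
  from has_derivative_inner[OF this bounded_linear.has_derivative[OF A_linear this]]
  show ?thesis
    unfolding quad_def
    by (rule has_derivative_eq_rhs) (simp add: fun_eq_iff A_sym[symmetric] inner_commute)
qed

lemma quad_der_x: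
  "((\<lambda>x. quad q A y x) has_derivative (\<lambda>v. 2 * (v \<bullet> (A *v (x - \<gamma> y))))) (at x)"
proof -
  have "((\<lambda>x. x - \<gamma> y) has_derivative (\<lambda>v. v)) (at x)" by (auto intro!: derivative_eq_intros)
  from has_derivative_inner[OF this bounded_linear.has_derivative[OF A_linear this]]
  show ?thesis
    unfolding quad_def
    by (rule has_derivative_eq_rhs) (simp add: fun_eq_iff A_sym[symmetric] inner_commute)
qed

lemma grad_phase_x: "grad (\<lambda>x. radon_phase q A u x \<omega>) x = (- 2 * \<omega>) *\<^sub>R (A *v (x - \<gamma> (fst u)))"
proof (rule grad_eqI)
  obtain y t where u: "u = (y, t)" by force
  have "((\<lambda>x. \<omega> * (t - quad q A y x)) has_derivative (\<lambda>v. \<omega> * (0 - 2 * (v \<bullet> (A *v (x - \<gamma> y)))))) (at x)"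
    by (intro has_derivative_mult_right has_derivative_diff has_derivative_const quad_der_x)
  then show "((\<lambda>x. radon_phase q A u x \<omega>) has_derivative (\<lambda>v. v \<bullet> ((- 2 * \<omega>) *\<^sub>R (A *v (x - \<gamma> (fst u)))))) (at x)"
    unfolding radon_phase_def u prod.case fst_conv
    by (rule has_derivative_eq_rhs) (simp add: fun_eq_iff)
qed

lemma norm_grad_phase_x: "norm (grad (\<lambda>x. radon_phase q A u x \<omega>) x) = \<bar>\<omega>\<bar> * amp (fst u) x"
  unfolding grad_phase_x amp_def by (simp add: abs_mult)

text \<open>
  The transpose of \<open>d\<gamma> y\<close>; the base component of the left covector is \<open>2 \<omega> pull y (A z)\<close>.
\<close>

definition pull :: "real ^ 'm \<Rightarrow> real ^ ('m option) \<Rightarrow> real ^ 'm" where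
  "pull y w = base_part w + (w $ None) *\<^sub>R grad q y"

lemma pull_inner: "y \<in> \<Omega> \<Longrightarrow> \<eta> \<bullet> pull y w = d\<gamma> y \<eta> \<bullet> w"
  by (simp add: pull_def inner_option dq_grad inner_add_right)

lemma grad_phase_u:
  assumes "y \<in> \<Omega>"
  shows "grad (\<lambda>u. radon_phase q A u x \<omega>) (y, t) = ((2 * \<omega>) *\<^sub>R pull y (A *v (x - \<gamma> y)), \<omega>)"
proof (rule grad_eqI)
  have "((\<lambda>u. snd u - quad q A (fst u) x) has_derivative
      (\<lambda>v. snd v - 2 * ((0 - d\<gamma> (fst (y, t)) (fst v)) \<bullet> (A *v (x - \<gamma> (fst (y, t))))))) (at (y, t))"
    using assms by (intro has_derivative_diff has_derivative_snd has_derivative_ident quad_der has_derivative_fst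
        has_derivative_const) auto
  from has_derivative_mult_right[OF this, of \<omega>]
  show "((\<lambda>u. radon_phase q A u x \<omega>) has_derivative
      (\<lambda>v. v \<bullet> ((2 * \<omega>) *\<^sub>R pull y (A *v (x - \<gamma> y)), \<omega>))) (at (y, t))"
    unfolding radon_phase_def case_prod_beta
    by (rule has_derivative_eq_rhs)
       (auto simp: fun_eq_iff inner_prod_def pull_inner[OF assms] algebra_simps)
qed

lemma grad_phase_\<omega>: "grad (radon_phase q A u x) \<omega> = snd u - quad q A (fst u) x"
proof (rule grad_eqI)
  show "(radon_phase q A u x has_derivative (\<lambda>v. v \<bullet> (snd u - quad q A (fst u) x))) (at \<omega>)"
    unfolding radon_phase_def case_prod_beta by (auto intro!: derivative_eq_intros)
qed

lemma smooth_on_offset: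
  assumes "open W" "smooth_on W f" "f ` W \<subseteq> \<Omega>" "smooth_on W g"
  shows "smooth_on W (\<lambda>w. A *v (g w - \<gamma> (f w)))"
  by (rule smooth_on_linear_compose[OF assms(1) A_linear
        smooth_on_diff[OF assms(1,4) smooth_on_graph_point[OF assms(1) \<Omega> q assms(2,3)]]])

lemma smooth_on_quad:
  assumes "open W" "smooth_on W f" "f ` W \<subseteq> \<Omega>" "smooth_on W g"
  shows "smooth_on W (\<lambda>w. quad q A (f w) (g w))"
  unfolding quad_def
  by (rule smooth_on_inner[OF assms(1) smooth_on_diff[OF assms(1,4) smooth_on_graph_point[OF assms(1) \<Omega> q assms(2,3)]]
        smooth_on_offset[OF assms]])

lemma smooth_on_amp:
  assumes "open W" "smooth_on W f" "f ` W \<subseteq> \<Omega>" "smooth_on W g" "\<And>w. w \<in> W \<Longrightarrow> g w \<noteq> \<gamma> (f w)"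
  shows "smooth_on W (\<lambda>w. amp (f w) (g w))"
  unfolding amp_def
  by (rule smooth_on_norm[OF assms(1) smooth_on_scaleR[OF assms(1) smooth_on_const smooth_on_offset[OF assms(1-4)]]])
     (use assms(5) A_nz in auto)

lemma open_off_graph:
  assumes "open W" "continuous_on W f" "f ` W \<subseteq> \<Omega>" "continuous_on W g"
  shows "open {w \<in> W. g w \<noteq> \<gamma> (f w)}"
proof -
  have "continuous_on W (\<lambda>w. g w - \<gamma> (f w))"
    by (intro continuous_on_diff assms continuous_on_compose2[OF \<gamma>_continuous assms(2,3)])
  from continuous_open_preimage[OF this assms(1), of "- {0}"]
  have "open (W \<inter> (\<lambda>w. g w - \<gamma> (f w)) -` (- {0}))" using open_Compl[OF closed_singleton] by blast
  moreover have "W \<inter> (\<lambda>w. g w - \<gamma> (f w)) -` (- {0}) = {w \<in> W. g w \<noteq> \<gamma> (f w)}" by auto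
  ultimately show ?thesis by simp
qed

section \<open>The Fourier integral operator\<close>

text \<open>
  The pairs at which the amplitude is smooth. They form an open set also when the graph is not
  closed and the domain of the operator is not open.
\<close>

definition WF :: "(((real ^ 'm) \<times> real) \<times> (real ^ ('m option))) set" where
  "WF = {w \<in> (\<Omega> \<times> {0<..}) \<times> UNIV. snd w \<noteq> \<gamma> (fst (fst w))}"

lemma open_WF: "open WF"
  unfolding WF_def
  by (rule open_off_graph) (auto intro!: open_Times \<Omega> continuous_intros)

lemma WF_iff: "((y, t), x) \<in> WF \<longleftrightarrow> y \<in> \<Omega> \<and> t > 0 \<and> x \<noteq> \<gamma> y"
  by (auto simp: WF_def)

lemma WF_base: "(\<lambda>w. fst (fst w)) ` WF \<subseteq> \<Omega>"
  by (auto simp: WF_def)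

lemma smooth_fst_fst: "open W \<Longrightarrow> smooth_on W (\<lambda>w. fst (fst w))" "open W \<Longrightarrow> smooth_on W (\<lambda>w. snd (fst w))"
  by (rule smooth_on_linear_compose[OF _ bounded_linear_fst smooth_on_fst]
      smooth_on_linear_compose[OF _ bounded_linear_snd smooth_on_fst]; assumption)+

lemma smooth_WF:
  "smooth_on WF (\<lambda>w. amp (fst (fst w)) (snd w))"
  "smooth_on WF (\<lambda>w. snd (fst w) - quad q A (fst (fst w)) (snd w))"
  by (rule smooth_on_amp[OF open_WF smooth_fst_fst(1)[OF open_WF] WF_base smooth_on_snd]
      smooth_on_diff[OF open_WF smooth_fst_fst(2)[OF open_WF]
        smooth_on_quad[OF open_WF smooth_fst_fst(1)[OF open_WF] WF_base smooth_on_snd]];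
      auto simp: WF_def)+

text \<open>
  The term \<open>\<omega> t\<close> gives the derivative \<open>\<omega>\<close> in \<open>t\<close> and the derivative 1 of \<open>\<partial>\<psi>/\<partial>\<omega>\<close> in \<open>t\<close>; the derivative in \<open>x\<close> is
  a nonzero multiple of \<open>A z\<close>, and \<open>z \<noteq> 0\<close>.
\<close>

lemma nondegenerate_radon_phase: "nondegenerate_phase WF (radon_phase q A)"
  unfolding nondegenerate_phase_def
proof (intro conjI ballI)
  let ?W = "WF \<times> (UNIV - {0 :: real})"
  have o: "open ?W" using open_WF by (intro open_Times) auto
  have "smooth_on ?W (\<lambda>p. snd p * ((\<lambda>w. snd (fst w) - quad q A (fst (fst w)) (snd w)) (fst p)))"
    by (rule smooth_on_mult[OF o smooth_on_snd smooth_on_compose[OF o open_WF smooth_WF(2) smooth_on_fst]]) auto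
  then show "smooth_on ?W (\<lambda>((u, v), \<theta>). radon_phase q A u v \<theta>)"
    by (simp add: radon_phase_def case_prod_unfold)
  fix w assume "w \<in> WF"
  then obtain y t x where w: "w = ((y, t), x)" and yt: "y \<in> \<Omega>" "t > 0" "x \<noteq> \<gamma> y"
    by (metis WF_iff prod.collapse)
  have indep: "c = 0" if "\<forall>w. (\<Sum>b\<in>Basis. (c \<bullet> b) *
        frechet_derivative (\<lambda>((u, v), \<theta>). grad (radon_phase q A u v) \<theta> \<bullet> b) (at (((y, t), x), \<theta>)) w) = 0" for c \<theta> :: real
  proof -
    let ?F = "\<lambda>p :: (((real ^ 'm) \<times> real) \<times> (real ^ ('m option))) \<times> real. snd (fst (fst p)) - quad q A (fst (fst (fst p))) (snd (fst p))"
    have "(?F has_derivative (\<lambda>v. snd (fst (fst v)) - 2 * ((snd (fst v) - d\<gamma> (fst (fst (fst (((y, t), x), \<theta>)))) (fst (fst (fst v))))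
         \<bullet> (A *v (snd (fst (((y, t), x), \<theta>)) - \<gamma> (fst (fst (fst (((y, t), x), \<theta>))))))))) (at (((y, t), x), \<theta>))"
      using yt(1)
      by (intro has_derivative_diff has_derivative_snd has_derivative_fst has_derivative_ident quad_der) auto
    from frechet_derivative_eqI[OF this]
    have "frechet_derivative ?F (at (((y, t), x), \<theta>)) (((0, 1), 0), 0) = 1"
      using yt(1) has_derivative_linear[OF \<gamma>_der] by (simp add: linear_0)
    moreover have "c * frechet_derivative ?F (at (((y, t), x), \<theta>)) (((0, 1), 0), 0) = 0"
      using that[rule_format, of "(((0, 1), 0), 0)"] by (simp add: grad_phase_\<omega> case_prod_unfold)
    ultimately show ?thesis by simp
  qed
  show "case w of (u, v) \<Rightarrow> \<forall>\<theta>. \<theta> \<noteq> 0 \<longrightarrow>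
        (\<forall>l>0. radon_phase q A u v (l *\<^sub>R \<theta>) = l * radon_phase q A u v \<theta>) \<and>
        (grad (\<lambda>u. radon_phase q A u v \<theta>) u \<noteq> 0 \<or> grad (radon_phase q A u v) \<theta> \<noteq> 0) \<and>
        (grad (\<lambda>v. radon_phase q A u v \<theta>) v \<noteq> 0 \<or> grad (radon_phase q A u v) \<theta> \<noteq> 0) \<and>
        (grad (radon_phase q A u v) \<theta> = 0 \<longrightarrow>
           (\<forall>c. (\<forall>w. (\<Sum>b\<in>Basis. (c \<bullet> b) *
                        frechet_derivative (\<lambda>((u, v), \<theta>). grad (radon_phase q A u v) \<theta> \<bullet> b)
                          (at ((u, v), \<theta>)) w) = 0) \<longrightarrow> c = 0))"
    unfolding w prod.case
  proof (intro allI impI conjI)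
    fix \<theta> :: real assume "\<theta> \<noteq> 0"
    show "radon_phase q A (y, t) x (l *\<^sub>R \<theta>) = l * radon_phase q A (y, t) x \<theta>" for l
      by (simp add: radon_phase_def)
    show "grad (\<lambda>u. radon_phase q A u x \<theta>) (y, t) \<noteq> 0 \<or> grad (radon_phase q A (y, t) x) \<theta> \<noteq> 0"
      using \<open>\<theta> \<noteq> 0\<close> by (simp add: grad_phase_u[OF yt(1)] zero_prod_def)
    show "grad (\<lambda>v. radon_phase q A (y, t) v \<theta>) x \<noteq> 0 \<or> grad (radon_phase q A (y, t) x) \<theta> \<noteq> 0"
      using \<open>\<theta> \<noteq> 0\<close> yt(3) by (simp add: grad_phase_x A_nz)
  qed (rule indep)
qed

lemma iter_pd_product_symbol:
  fixes \<sigma> :: "real \<Rightarrow> complex" and n :: "'w::euclidean_space \<Rightarrow> complex"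
  assumes W: "open W" and n: "smooth_on W n" and \<sigma>: "smooth_on UNIV \<sigma>"
    and as: "set as \<subseteq> Basis" and bs: "set bs \<subseteq> Basis" and w: "w \<in> W"
  shows "iter_pd (map (\<lambda>b. (0, b)) as @ map (\<lambda>b. (b, 0)) bs) (\<lambda>(w, \<theta>). \<sigma> \<theta> * n w) (w, \<theta>)
       = iter_pd as \<sigma> \<theta> * iter_pd bs n w"
proof -
  have WO: "open (W \<times> (UNIV :: real set))" using W by (intro open_Times) auto
  have der: "frechet_derivative (\<lambda>(w, \<theta>). s \<theta> * m w) (at (w, \<theta>)) (b, a)
      = frechet_derivative s (at \<theta>) a * m w + s \<theta> * frechet_derivative m (at w) b"
    if "smooth_on W m" "smooth_on UNIV s" "w \<in> W" for s :: "real \<Rightarrow> complex" and m :: "'w \<Rightarrow> complex" and w \<theta> a b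
  proof -
    have s: "((\<lambda>p :: 'w \<times> real. s (snd p)) has_derivative (\<lambda>v. frechet_derivative s (at (snd (w, \<theta>))) (snd v))) (at (w, \<theta>))"
      using smooth_on_has_derivative[OF that(2) open_UNIV]
      by (intro has_derivative_compose[OF has_derivative_snd[OF has_derivative_ident]]) auto
    have m: "((\<lambda>p :: 'w \<times> real. m (fst p)) has_derivative (\<lambda>v. frechet_derivative m (at (fst (w, \<theta>))) (fst v))) (at (w, \<theta>))"
      using smooth_on_has_derivative[OF that(1) W] that(3)
      by (intro has_derivative_compose[OF has_derivative_fst[OF has_derivative_ident]]) auto
    show ?thesis
      using frechet_derivative_eqI[OF has_derivative_mult[OF s m]] by (simp add: case_prod_unfold)
  qed
  have 1: "iter_pd (map (\<lambda>b. (b, 0)) bs) (\<lambda>(w, \<theta>). \<sigma> \<theta> * n w) p = (\<lambda>(w, \<theta>). \<sigma> \<theta> * iter_pd bs n w) p"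
    if "p \<in> W \<times> UNIV" for p
    using bs that
  proof (induction bs arbitrary: p)
    case (Cons b bs)
    obtain w \<theta> where p: "p = (w, \<theta>)" "w \<in> W" using Cons.prems by force
    have sb: "set bs \<subseteq> Basis" using Cons.prems by simp
    have "iter_pd (map (\<lambda>b. (b, 0)) (b # bs)) (\<lambda>(w, \<theta>). \<sigma> \<theta> * n w) p
       = frechet_derivative (\<lambda>(w, \<theta>). \<sigma> \<theta> * iter_pd bs n w) (at p) (b, 0)"
      using frechet_derivative_cong_open[OF WO Cons.prems(2) Cons.IH[OF sb]] by simp
    also have "\<dots> = \<sigma> \<theta> * iter_pd (b # bs) n w"
      using der[OF smooth_on_iter_pd[OF n sb] \<sigma> p(2), of \<theta> b 0] smooth_on_has_derivative[OF \<sigma> open_UNIV, of \<theta>]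
      by (simp add: p(1) linear_0[OF has_derivative_linear])
    finally show ?case by (simp add: p(1))
  qed simp
  have "iter_pd (map (\<lambda>b. (0, b)) as) (iter_pd (map (\<lambda>b. (b, 0)) bs) (\<lambda>(w, \<theta>). \<sigma> \<theta> * n w)) p
      = (\<lambda>(w, \<theta>). iter_pd as \<sigma> \<theta> * iter_pd bs n w) p" if "p \<in> W \<times> UNIV" for p
    using as that
  proof (induction as arbitrary: p)
    case Nil
    then show ?case using 1 by simp
  next
    case (Cons a as)
    obtain w \<theta> where p: "p = (w, \<theta>)" "w \<in> W" using Cons.prems by force
    have sa: "set as \<subseteq> Basis" using Cons.prems by simp
    have "iter_pd (map (\<lambda>b. (0, b)) (a # as)) (iter_pd (map (\<lambda>b. (b, 0)) bs) (\<lambda>(w, \<theta>). \<sigma> \<theta> * n w)) p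
       = frechet_derivative (\<lambda>(w, \<theta>). iter_pd as \<sigma> \<theta> * iter_pd bs n w) (at p) (0, a)"
      using frechet_derivative_cong_open[OF WO Cons.prems(2) Cons.IH[OF sa]] by simp
    also have "\<dots> = iter_pd (a # as) \<sigma> \<theta> * iter_pd bs n w"
      using der[OF smooth_on_iter_pd[OF n bs] smooth_on_iter_pd[OF \<sigma> sa] p(2), of \<theta> 0 a]
        smooth_on_has_derivative[OF smooth_on_iter_pd[OF n bs] W p(2)]
      by (simp add: p(1) linear_0[OF has_derivative_linear])
    finally show ?case by (simp add: p(1))
  qed
  from this[of "(w, \<theta>)"] show ?thesis using w by (simp add: iter_pd_append)
qed

definition radon_symbol :: "(((real ^ 'm) \<times> real) \<times> (real ^ ('m option))) \<times> real \<Rightarrow> complex" where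
  "radon_symbol = (\<lambda>(w, \<theta>). high_freq \<theta> * of_real (amp (fst (fst w)) (snd w)))"

lemma radon_symbol_class: "radon_symbol \<in> symbol_class 1 WF"
proof -
  have n: "smooth_on WF (\<lambda>w. complex_of_real (amp (fst (fst w)) (snd w)))"
    by (rule smooth_on_linear_compose[OF open_WF bounded_linear_of_real smooth_WF(1)])
  have o: "open (WF \<times> (UNIV :: real set))" using open_WF by (intro open_Times) auto
  have "smooth_on (WF \<times> UNIV) radon_symbol"
  proof -
    have "smooth_on (WF \<times> (UNIV :: real set)) (\<lambda>p. high_freq (snd p) * (\<lambda>w. complex_of_real (amp (fst (fst w)) (snd w))) (fst p))"
      by (rule smooth_on_mult[OF o smooth_on_compose[OF o open_UNIV smooth_on_high_freq smooth_on_snd]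
            smooth_on_compose[OF o open_WF n smooth_on_fst]]) auto
    then show ?thesis unfolding radon_symbol_def by (simp add: case_prod_unfold)
  qed
  moreover have "\<exists>C. \<forall>w\<in>K. \<forall>\<theta>. norm (iter_pd (map (\<lambda>b. (0, b)) as @ map (\<lambda>b. (b, 0)) bs) radon_symbol (w, \<theta>))
                 \<le> C * (1 + norm \<theta>) powr (1 - real (length as))"
    if K: "compact K" "K \<subseteq> WF" and as: "set as \<subseteq> Basis" and bs: "set bs \<subseteq> Basis" for K as bs
  proof -
    obtain C where C: "C \<ge> 0" "\<And>\<theta>. norm (iter_pd as high_freq \<theta>) \<le> C * (1 + norm \<theta>) powr (1 - real (length as))"
      by (rule high_freq_symbol_estimate[OF as]) blast
    obtain C' where C': "C' \<ge> 0"
      "\<And>w. w \<in> K \<Longrightarrow> norm (iter_pd bs (\<lambda>w. complex_of_real (amp (fst (fst w)) (snd w))) w) \<le> C'"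
      by (rule iter_pd_bounded_compact[OF n K bs]) blast
    have "norm (iter_pd (map (\<lambda>b. (0, b)) as @ map (\<lambda>b. (b, 0)) bs) radon_symbol (w, \<theta>))
        \<le> C' * C * (1 + norm \<theta>) powr (1 - real (length as))" if "w \<in> K" for w \<theta>
    proof -
      have w: "w \<in> WF" using that K by blast
      have "norm (iter_pd as high_freq \<theta>) * norm (iter_pd bs (\<lambda>w. complex_of_real (amp (fst (fst w)) (snd w))) w)
          \<le> (C * (1 + norm \<theta>) powr (1 - real (length as))) * C'"
        using C'(2)[OF that] C by (intro mult_mono) auto
      then show ?thesis
        unfolding radon_symbol_def iter_pd_product_symbol[OF open_WF n smooth_on_high_freq as bs w] norm_mult
        by (simp only: mult_ac)
    qed
    then show ?thesis by (intro exI[of _ "C' * C"] ballI allI)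
  qed
  ultimately show ?thesis unfolding symbol_class_def by simp
qed

definition low_freq :: "real \<Rightarrow> complex" where
  "low_freq \<theta> = complex_of_real (\<bar>\<theta>\<bar> * cutoff \<theta>)"

lemma low_freq: "of_real \<bar>\<theta>\<bar> = high_freq \<theta> + low_freq \<theta>"
  by (simp add: low_freq_def high_freq_def algebra_simps)

lemma low_freq_continuous: "continuous_on UNIV low_freq"
  unfolding low_freq_def by (intro continuous_intros smooth_on_continuous[OF smooth_on_cutoff])

lemma low_freq_support: "\<theta> \<notin> {-2..2} \<Longrightarrow> low_freq \<theta> = 0"
proof -
  assume "\<theta> \<notin> {-2..2}"
  then have "2 \<le> \<bar>\<theta>\<bar>" by auto
  then show ?thesis by (simp add: low_freq_def cutoff_eq_0)
qed

lemma low_freq_integrable: "integrable lborel low_freq"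
  using integrable_continuous_compact[OF low_freq_continuous compact_Icc low_freq_support] .

definition low_kernel :: "real \<Rightarrow> complex" where
  "low_kernel s = (LINT \<theta>|lborel. low_freq \<theta> * exp (\<i> * of_real (\<theta> * s)))"

lemma smooth_on_low_kernel: "smooth_on UNIV low_kernel"
  unfolding low_kernel_def[abs_def]
  by (rule smooth_on_fourier_compact[OF low_freq_continuous compact_Icc low_freq_support])

text \<open>
  The kernel formed by the frequencies that \<open>radon_symbol\<close> leaves out.
\<close>

definition radon_remainder :: "((real ^ 'm) \<times> real) \<times> (real ^ ('m option)) \<Rightarrow> complex" where
  "radon_remainder w = low_kernel (snd (fst w) - quad q A (fst (fst w)) (snd w)) * of_real (amp (fst (fst w)) (snd w))"

lemma smooth_on_radon_remainder: "smooth_on WF radon_remainder"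
  unfolding radon_remainder_def[abs_def]
  by (rule smooth_on_mult[OF open_WF smooth_on_compose[OF open_WF open_UNIV smooth_on_low_kernel smooth_WF(2)]
        smooth_on_linear_compose[OF open_WF bounded_linear_of_real smooth_WF(1)]]) auto

end

lemma iter_pd_diff:
  assumes "smooth_on UNIV f" "smooth_on UNIV g" "set bs \<subseteq> Basis"
  shows "iter_pd bs (\<lambda>x. f x - g x) = (\<lambda>x. iter_pd bs f x - iter_pd bs g x)"
  using assms(3)
proof (induction bs)
  case (Cons b bs)
  have d: "(iter_pd bs h has_derivative frechet_derivative (iter_pd bs h) (at x)) (at x)" if "smooth_on UNIV h" for h and x
    using smooth_on_has_derivative[OF smooth_on_iter_pd[OF that] open_UNIV, of bs] Cons.prems by simp
  have "iter_pd bs (\<lambda>x. f x - g x) = (\<lambda>x. iter_pd bs f x - iter_pd bs g x)" using Cons by simp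
  then show ?case
    using frechet_derivative_eqI[OF has_derivative_diff[OF d[OF assms(1)] d[OF assms(2)]]] by simp
qed simp

lemma one_minus_dtt_bounded:
  assumes g: "smooth_on UNIV g" and d: "derivs_bounded (N + 2) K g M"
  shows "derivs_bounded N K (one_minus_dtt g) (2 * M)"
  unfolding derivs_bounded_def
proof (intro allI impI ballI)
  fix bs x assume bs: "set bs \<subseteq> (Basis :: ('a \<times> real) set) \<and> length bs \<le> N" and x: "x \<in> K"
  let ?tt = "[time_unit, time_unit] :: ('a \<times> real) list"
  have tt: "set ?tt \<subseteq> Basis" by (simp add: time_unit_Basis)
  have "iter_pd bs (one_minus_dtt g) x = iter_pd bs g x - iter_pd (bs @ ?tt) g x"
    unfolding one_minus_dtt_def[abs_def] iter_pd_append
    using iter_pd_diff[OF g smooth_on_iter_pd[OF g tt]] bs by simp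
  moreover have "norm (iter_pd bs g x) \<le> M"
    using d bs x unfolding derivs_bounded_def by (meson trans_le_add1)
  moreover have "norm (iter_pd (bs @ ?tt) g x) \<le> M"
  proof -
    have "set (bs @ ?tt) \<subseteq> Basis \<and> length (bs @ ?tt) \<le> N + 2" using bs tt by simp
    then show ?thesis using d x unfolding derivs_bounded_def by blast
  qed
  ultimately show "norm (iter_pd bs (one_minus_dtt g) x) \<le> 2 * M"
    using norm_triangle_ineq4[of "iter_pd bs g x" "iter_pd (bs @ ?tt) g x"] by simp
qed

context radon_geometry
begin

text \<open>
  The growth for which two integrations by parts make the frequency integral converge.
\<close>

definition admissible :: "(real \<Rightarrow> complex) \<Rightarrow> bool" where
  "admissible \<sigma> \<longleftrightarrow> continuous_on UNIV \<sigma> \<and> (\<forall>\<theta>. norm (\<sigma> \<theta>) \<le> 1 + \<bar>\<theta>\<bar>)"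

text \<open>
  The value of the oscillatory integral with frequency factor \<open>\<sigma>\<close>, written without cut-offs since it
  converges absolutely.
\<close>

definition transposed :: "(real \<Rightarrow> complex) \<Rightarrow> ((real ^ 'm) \<times> real \<Rightarrow> complex) \<Rightarrow> real ^ ('m option) \<Rightarrow> complex" where
  "transposed \<sigma> g x = (LINT \<theta>|lborel. \<sigma> \<theta> *
     osc_fourier (\<lambda>u. snd u - quad q A (fst u) x) (\<lambda>u. of_real (amp (fst u) x) * g u) \<theta>)"

lemma osc_setup: "osc_setup \<Omega> (\<lambda>y. quad q A y x) (\<lambda>y. complex_of_real (amp y x))"
proof
  have c: "continuous_on \<Omega> (\<lambda>y. A *v (x - \<gamma> y))"
    by (intro bounded_linear.continuous_on[OF A_linear] continuous_on_diff continuous_on_const \<gamma>_continuous)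
  show "continuous_on \<Omega> (\<lambda>y. quad q A y x)"
    unfolding quad_def by (intro continuous_on_inner continuous_on_diff continuous_on_const \<gamma>_continuous c)
  show "continuous_on \<Omega> (\<lambda>y. complex_of_real (amp y x))"
    unfolding amp_def by (intro continuous_on_of_real continuous_on_norm continuous_on_scaleR continuous_on_const c)
qed (rule \<Omega>)

lemma osc_transpose_eq:
  assumes g: "g \<in> test_functions (\<Omega> \<times> UNIV)" and \<sigma>: "admissible \<sigma>"
  shows "osc_transpose (radon_phase q A) (\<lambda>(w, \<theta>). \<sigma> \<theta> * of_real (amp (fst (fst w)) (snd w))) g = transposed \<sigma> g"
proof
  fix x
  interpret osc_setup \<Omega> "\<lambda>y. quad q A y x" "\<lambda>y. complex_of_real (amp y x)" by (rule osc_setup)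
  have "has_osc_integral (\<lambda>u \<theta>. \<theta> * P u) (\<lambda>u \<theta>. \<sigma> \<theta> * of_real (amp (fst u) x) * g u) (transposed \<sigma> g x)"
    unfolding transposed_def using has_osc_integral_ft[OF g] \<sigma> unfolding admissible_def by blast
  moreover have "(\<lambda>u \<theta>. radon_phase q A u x \<theta>) = (\<lambda>u \<theta>. \<theta> * P u)"
    by (simp add: radon_phase_def case_prod_unfold)
  ultimately show "osc_transpose (radon_phase q A) (\<lambda>(w, \<theta>). \<sigma> \<theta> * of_real (amp (fst (fst w)) (snd w))) g x = transposed \<sigma> g x"
    unfolding osc_transpose_def using osc_integral_unique by simp
qed

definition pairs_off :: "((real ^ ('m option)) \<times> (real ^ 'm)) set" where
  "pairs_off = {p \<in> UNIV \<times> \<Omega>. fst p \<noteq> \<gamma> (snd p)}"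

lemma open_pairs_off: "open pairs_off"
  unfolding pairs_off_def
  by (rule open_off_graph) (auto intro!: open_Times \<Omega> continuous_intros)

lemma pairs_off_base: "snd ` pairs_off \<subseteq> \<Omega>"
  by (auto simp: pairs_off_def)

definition amp_pair :: "(real ^ ('m option)) \<times> (real ^ 'm) \<Rightarrow> complex" where
  "amp_pair p = of_real (amp (snd p) (fst p))"

lemma smooth_on_amp_pair: "smooth_on pairs_off amp_pair"
  unfolding amp_pair_def[abs_def]
  by (rule smooth_on_linear_compose[OF open_pairs_off bounded_linear_of_real
        smooth_on_amp[OF open_pairs_off smooth_on_snd pairs_off_base smooth_on_fst]])
     (auto simp: pairs_off_def)

definition kern :: "(real \<Rightarrow> complex) \<Rightarrow> real \<Rightarrow> complex" where
  "kern \<sigma> s = (LINT \<theta>|lborel. \<sigma> \<theta> / of_real ((1 + \<theta>\<^sup>2)\<^sup>2) * exp (\<i> * of_real (\<theta> * s)))"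

text \<open>
  The graph over a compact set is closed, whether or not the whole graph is.
\<close>

lemma base_closed:
  assumes "compact K" "K \<subseteq> \<Omega> \<times> UNIV"
  shows "open (- \<gamma> ` fst ` K)" "fst ` K \<subseteq> \<Omega>"
proof -
  show s: "fst ` K \<subseteq> \<Omega>" using assms(2) by auto
  have "compact (fst ` K)" using assms(1) by (intro compact_continuous_image continuous_intros)
  then have "compact (\<gamma> ` fst ` K)"
    by (rule compact_continuous_image[OF continuous_on_subset[OF \<gamma>_continuous s]])
  then show "open (- \<gamma> ` fst ` K)" by (simp add: compact_imp_closed open_Compl)
qed

lemma param_setup:
  assumes "admissible \<sigma>" "compact K" "K \<subseteq> \<Omega> \<times> UNIV"
  shows "param_setup pairs_off (\<lambda>p. quad q A (snd p) (fst p)) (kern \<sigma>) (- \<gamma> ` fst ` K) K"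
proof
  show "smooth_on pairs_off (\<lambda>p. quad q A (snd p) (fst p))"
    by (rule smooth_on_quad[OF open_pairs_off smooth_on_snd pairs_off_base smooth_on_fst])
  show "continuous_on UNIV (kern \<sigma>)"
    unfolding kern_def[abs_def] using assms(1) osc_weight_integrable[of \<sigma>]
    by (intro fourier_integrable_continuous) (simp add: admissible_def)
  show "(- \<gamma> ` fst ` K) \<times> fst ` K \<subseteq> pairs_off"
  proof
    fix p assume "p \<in> (- \<gamma> ` fst ` K) \<times> fst ` K"
    then obtain x y where p: "p = (x, y)" "x \<notin> \<gamma> ` fst ` K" "y \<in> fst ` K" by blast
    then have "x \<noteq> \<gamma> y" by blast
    then show "p \<in> pairs_off" using base_closed(2)[OF assms(2,3)] p by (auto simp: pairs_off_def)
  qed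
qed (use open_pairs_off assms base_closed in auto)

text \<open>
  In this form the integral can be differentiated in \<open>x\<close>, on the open set of points off the part of
  the graph over the support of \<open>g\<close>.
\<close>

lemma transposed_eq_Jsum:
  assumes \<sigma>: "admissible \<sigma>" and K: "compact K" "K \<subseteq> \<Omega> \<times> UNIV"
    and g: "g \<in> test_functions K"
  shows "one_minus_dtt (one_minus_dtt g) \<in> param_setup.H K"
    and "transposed \<sigma> g = param_setup.Jsum (\<lambda>p. quad q A (snd p) (fst p)) (kern \<sigma>) [(amp_pair, 0)] (one_minus_dtt (one_minus_dtt g))"
proof -
  interpret par: param_setup pairs_off "\<lambda>p. quad q A (snd p) (fst p)" "kern \<sigma>" "- \<gamma> ` fst ` K" K
    by (rule param_setup[OF \<sigma> K])
  let ?h = "one_minus_dtt (one_minus_dtt g)"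
  have h: "?h \<in> test_functions K" using g by (intro one_minus_dtt_test)
  obtain L where "L \<subseteq> K" "\<forall>x. x \<notin> L \<longrightarrow> ?h x = 0" using test_functions_support[OF h] by blast
  then show "?h \<in> par.H" unfolding par.H_def using test_functions_smooth[OF h] by blast
  show "transposed \<sigma> g = par.Jsum [(amp_pair, 0)] ?h"
  proof
    fix x
    interpret osc_setup \<Omega> "\<lambda>y. quad q A y x" "\<lambda>y. complex_of_real (amp y x)" by (rule osc_setup)
    have "g \<in> test_functions (\<Omega> \<times> UNIV)" using g test_functions_mono[OF K(2)] by blast
    from osc_value_shifted[OF this, of \<sigma>] \<sigma>
    have "transposed \<sigma> g x = (LINT u|lborel. kern \<sigma> (snd u) * (of_real (amp (fst u) x) * ?h (fst u, quad q A (fst u) x + snd u)))"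
      unfolding transposed_def admissible_def kern_def[abs_def] by blast
    also have "\<dots> = par.Jsum [(amp_pair, 0)] ?h x"
      by (simp add: par.Jsum_simps par.J_def par.\<Phi>_def par.tder_def amp_pair_def)
    finally show "transposed \<sigma> g x = par.Jsum [(amp_pair, 0)] ?h x" .
  qed
qed

lemma smooth_on_transposed:
  assumes \<sigma>: "admissible \<sigma>" and K: "compact K" "K \<subseteq> \<Omega> \<times> UNIV" and g: "g \<in> test_functions K"
  shows "smooth_on (- \<gamma> ` fst ` K) (transposed \<sigma> g)"
proof -
  interpret par: param_setup pairs_off "\<lambda>p. quad q A (snd p) (fst p)" "kern \<sigma>" "- \<gamma> ` fst ` K" K
    by (rule param_setup[OF \<sigma> K])
  show ?thesis
    unfolding transposed_eq_Jsum(2)[OF assms]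
    by (rule par.smooth_on_Jsum[OF _ transposed_eq_Jsum(1)[OF assms]]) (simp add: smooth_on_amp_pair)
qed

lemma transposed_bounded:
  assumes \<sigma>: "admissible \<sigma>" and K: "compact K" "K \<subseteq> \<Omega> \<times> UNIV"
    and K': "compact K'" "K' \<subseteq> - \<gamma> ` fst ` K"
  shows "\<exists>B\<ge>0. \<exists>N'. \<forall>g\<in>test_functions K. \<forall>M\<ge>0. derivs_bounded N' K g M \<longrightarrow> derivs_bounded N K' (transposed \<sigma> g) (B * M)"
proof -
  interpret par: param_setup pairs_off "\<lambda>p. quad q A (snd p) (fst p)" "kern \<sigma>" "- \<gamma> ` fst ` K" K
    by (rule param_setup[OF \<sigma> K])
  have "\<forall>(c, m)\<in>set [(amp_pair, 0 :: nat)]. smooth_on pairs_off c" by (simp add: smooth_on_amp_pair)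
  from par.Jsum_derivs_bounded[OF this K', of N]
  obtain B N' where B: "B \<ge> 0" and bd: "\<And>h M. h \<in> par.H \<Longrightarrow> M \<ge> 0 \<Longrightarrow> derivs_bounded N' K h M \<Longrightarrow>
      derivs_bounded N K' (par.Jsum [(amp_pair, 0)] h) (B * M)" by blast
  show ?thesis
  proof (intro exI[of _ "B * 4"] exI[of _ "N' + 2 + 2"] conjI ballI allI impI)
    fix g and M :: real assume g: "g \<in> test_functions K" and M: "0 \<le> M" and d: "derivs_bounded (N' + 2 + 2) K g M"
    have "derivs_bounded N' K (one_minus_dtt (one_minus_dtt g)) (2 * (2 * M))"
      by (intro one_minus_dtt_bounded test_functions_smooth[OF g] test_functions_smooth[OF one_minus_dtt_test[OF g]] d)
    from bd[OF transposed_eq_Jsum(1)[OF \<sigma> K g] _ this] M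
    show "derivs_bounded N K' (transposed \<sigma> g) (B * 4 * M)"
      unfolding transposed_eq_Jsum(2)[OF \<sigma> K g] by (simp add: mult.assoc)
  qed (use B in simp)
qed

lemma hypersurface_off: "- hypersurface \<Omega> q \<subseteq> - \<gamma> ` fst ` K" if "K \<subseteq> \<Omega> \<times> UNIV"
  using that unfolding hypersurface_def by auto

lemma smooth_on_transposed_off:
  assumes \<sigma>: "admissible \<sigma>" and g: "g \<in> test_functions (\<Omega> \<times> T)"
  shows "smooth_on (- hypersurface \<Omega> q) (transposed \<sigma> g)"
proof -
  let ?K = "closure {x. g x \<noteq> 0}"
  have K: "compact ?K" "?K \<subseteq> \<Omega> \<times> UNIV" "g \<in> test_functions ?K"
    using g by (auto simp: test_functions_def)
  show ?thesis
    by (rule smooth_on_subset[OF smooth_on_transposed[OF \<sigma> K] hypersurface_off[OF K(2)]])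
qed

lemma transposed_linear:
  assumes \<sigma>: "admissible \<sigma>" and g: "g \<in> test_functions (\<Omega> \<times> UNIV)" and h: "h \<in> test_functions (\<Omega> \<times> UNIV)"
  shows "transposed \<sigma> (\<lambda>u. g u + h u) = (\<lambda>x. transposed \<sigma> g x + transposed \<sigma> h x)"
    and "transposed \<sigma> (\<lambda>u. c * g u) = (\<lambda>x. c * transposed \<sigma> g x)"
proof -
  show "transposed \<sigma> (\<lambda>u. g u + h u) = (\<lambda>x. transposed \<sigma> g x + transposed \<sigma> h x)"
  proof
    fix x
    interpret osc_setup \<Omega> "\<lambda>y. quad q A y x" "\<lambda>y. complex_of_real (amp y x)" by (rule osc_setup)
    have "ft (\<lambda>u. g u + h u) \<theta> = ft g \<theta> + ft h \<theta>" for \<theta>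
      unfolding osc_fourier_def distrib_left
      by (rule Bochner_Integration.integral_add)
         (rule compactly_supported_integrable[OF osc_integrand_supported[OF V P supp]]; fact)+
    then show "transposed \<sigma> (\<lambda>u. g u + h u) x = transposed \<sigma> g x + transposed \<sigma> h x"
      unfolding transposed_def distrib_left
      using weighted_ft_integrable[OF g, of \<sigma>] weighted_ft_integrable[OF h, of \<sigma>] \<sigma>
      by (simp add: admissible_def distrib_left)
  qed
  show "transposed \<sigma> (\<lambda>u. c * g u) = (\<lambda>x. c * transposed \<sigma> g x)"
  proof
    fix x
    interpret osc_setup \<Omega> "\<lambda>y. quad q A y x" "\<lambda>y. complex_of_real (amp y x)" by (rule osc_setup)
    have "ft (\<lambda>u. c * g u) \<theta> = c * ft g \<theta>" for \<theta>
      unfolding osc_fourier_def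
      by (subst integral_mult_right_zero[symmetric]) (simp add: mult_ac)
    then show "transposed \<sigma> (\<lambda>u. c * g u) x = c * transposed \<sigma> g x"
      unfolding transposed_def
      by (subst integral_mult_right_zero[symmetric]) (simp add: mult_ac)
  qed
qed

lemma admissible_abs: "admissible (\<lambda>\<theta>. of_real \<bar>\<theta>\<bar>)"
  unfolding admissible_def by (intro conjI continuous_intros) auto

lemma admissible_high_freq: "admissible high_freq"
  unfolding admissible_def
proof (intro conjI allI smooth_on_continuous smooth_on_high_freq)
  fix \<theta>
  have "\<bar>\<theta>\<bar> * (1 - cutoff \<theta>) \<le> \<bar>\<theta>\<bar> * 1"
    using cutoff_range[of \<theta>] by (intro mult_left_mono) auto
  moreover have "0 \<le> \<bar>\<theta>\<bar> * (1 - cutoff \<theta>)" using cutoff_range[of \<theta>] by simp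
  ultimately show "norm (high_freq \<theta>) \<le> 1 + \<bar>\<theta>\<bar>"
    unfolding high_freq_def norm_of_real by linarith
qed

lemma radon_transform_eq:
  assumes "g \<in> test_functions (\<Omega> \<times> UNIV)"
  shows "radon_transform q A f g = f (transposed (\<lambda>\<theta>. of_real \<bar>\<theta>\<bar>) g)"
proof -
  have "(\<lambda>((u, x), \<omega>). complex_of_real (norm (grad (\<lambda>x. radon_phase q A u x \<omega>) x)))
      = (\<lambda>(w, \<theta>). of_real \<bar>\<theta>\<bar> * of_real (amp (fst (fst w)) (snd w)))"
    by (simp add: norm_grad_phase_x fun_eq_iff)
  then show ?thesis
    unfolding radon_transform_def using osc_transpose_eq[OF assms admissible_abs] by simp
qed

text \<open>
  The low frequencies contribute a smooth kernel: their part of the frequency integral has compact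
  support, so Fubini applies without any cut-off.
\<close>

lemma transposed_split:
  assumes g: "g \<in> test_functions (\<Omega> \<times> UNIV)"
  shows "transposed (\<lambda>\<theta>. of_real \<bar>\<theta>\<bar>) g x = transposed high_freq g x + (LINT u|lborel. radon_remainder (u, x) * g u)"
proof -
  interpret osc_setup \<Omega> "\<lambda>y. quad q A y x" "\<lambda>y. complex_of_real (amp y x)" by (rule osc_setup)
  have i: "integrable lborel (\<lambda>\<theta>. \<sigma> \<theta> * ft g \<theta>)" if "admissible \<sigma>" for \<sigma>
    using that weighted_ft_integrable[OF g, of \<sigma>] by (simp add: admissible_def)
  have "(LINT u|lborel. radon_remainder (u, x) * g u)
      = (LINT u|lborel. low_kernel (P u) * (of_real (amp (fst u) x) * g u))"
    by (simp add: radon_remainder_def mult.assoc)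
  also have "\<dots> = (LINT \<theta>|lborel. low_freq \<theta> * ft g \<theta>)"
    unfolding low_kernel_def by (rule osc_fourier_Fubini[OF V P supp[OF g] low_freq_integrable, symmetric])
  also have "(\<lambda>\<theta>. low_freq \<theta> * ft g \<theta>) = (\<lambda>\<theta>. of_real \<bar>\<theta>\<bar> * ft g \<theta> - high_freq \<theta> * ft g \<theta>)"
    by (simp add: low_freq algebra_simps)
  also have "(LINT \<theta>|lborel. of_real \<bar>\<theta>\<bar> * ft g \<theta> - high_freq \<theta> * ft g \<theta>)
      = transposed (\<lambda>\<theta>. of_real \<bar>\<theta>\<bar>) g x - transposed high_freq g x"
    unfolding transposed_def
    by (rule Bochner_Integration.integral_diff[OF i[OF admissible_abs] i[OF admissible_high_freq]])
  finally show ?thesis by simp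
qed

text \<open>
  The functional \<open>f\<close> is bounded by derivatives on a compact set off the graph over the base of \<open>K\<close>,
  and there the derivatives of \<open>transposed \<sigma> g\<close> are bounded by those of \<open>g\<close>.
\<close>

lemma radon_transform_distribution:
  assumes f: "f \<in> compact_distributions (- hypersurface \<Omega> q)"
  shows "radon_transform q A f \<in> distributions (\<Omega> \<times> {0<..})"
proof -
  let ?\<sigma> = "\<lambda>\<theta>. complex_of_real \<bar>\<theta>\<bar>"
  let ?V = "- hypersurface \<Omega> q"
  let ?U = "\<Omega> \<times> {0::real<..}"
  have sub: "test_functions ?U \<subseteq> test_functions (\<Omega> \<times> UNIV)" by (rule test_functions_mono) auto
  have fl: "linear_functional_on {h. smooth_on ?V h} f" using f unfolding compact_distributions_def by blast
  have R: "radon_transform q A f g = f (transposed ?\<sigma> g)" if "g \<in> test_functions ?U" for g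
    using radon_transform_eq that sub by blast
  have sm: "smooth_on ?V (transposed ?\<sigma> g)" if "g \<in> test_functions ?U" for g
    by (rule smooth_on_transposed_off[OF admissible_abs that])
  have "linear_functional_on (test_functions ?U) (radon_transform q A f)"
    unfolding linear_functional_on_def
  proof (intro conjI ballI allI)
    fix g h assume g: "g \<in> test_functions ?U" and h: "h \<in> test_functions ?U"
    have gh: "(\<lambda>u. g u + h u) \<in> test_functions ?U" using test_functions_lincomb[OF g h, of 1 1] by simp
    have "transposed ?\<sigma> (\<lambda>u. g u + h u) = (\<lambda>x. transposed ?\<sigma> g x + transposed ?\<sigma> h x)"
      using transposed_linear(1)[OF admissible_abs] g h sub by blast
    then show "radon_transform q A f (\<lambda>u. g u + h u) = radon_transform q A f g + radon_transform q A f h"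
      using fl sm[OF g] sm[OF h] unfolding R[OF gh] R[OF g] R[OF h] linear_functional_on_def by simp
  next
    fix c g assume g: "g \<in> test_functions ?U"
    have cg: "(\<lambda>u. c * g u) \<in> test_functions ?U" using test_functions_lincomb[OF g g, of c 0] by simp
    have "transposed ?\<sigma> (\<lambda>u. c * g u) = (\<lambda>x. c * transposed ?\<sigma> g x)"
      using transposed_linear(2)[OF admissible_abs] g sub by blast
    then show "radon_transform q A f (\<lambda>u. c * g u) = c * radon_transform q A f g"
      using fl sm[OF g] unfolding R[OF cg] R[OF g] linear_functional_on_def by simp
  qed
  moreover have "\<exists>N C. \<forall>g\<in>test_functions K. \<forall>M\<ge>0. derivs_bounded N K g M \<longrightarrow> norm (radon_transform q A f g) \<le> C * M"
    if K: "compact K" "K \<subseteq> ?U" for K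
  proof -
    have K1: "K \<subseteq> \<Omega> \<times> UNIV" using K(2) by auto
    let ?W = "- \<gamma> ` fst ` K"
    have "open ?W \<and> ?V \<subseteq> ?W" using base_closed(1)[OF K(1) K1] hypersurface_off[OF K1] by blast
    moreover have "\<forall>W. open W \<and> ?V \<subseteq> W \<longrightarrow> (\<exists>K' N C. compact K' \<and> K' \<subseteq> W \<and>
               (\<forall>h. smooth_on W h \<longrightarrow> (\<forall>M\<ge>0. derivs_bounded N K' h M \<longrightarrow> norm (f h) \<le> C * M)))"
      using f by (simp add: compact_distributions_def)
    ultimately obtain K' N C where K': "compact K'" "K' \<subseteq> ?W"
      and fb0: "\<forall>h. smooth_on ?W h \<longrightarrow> (\<forall>M\<ge>0. derivs_bounded N K' h M \<longrightarrow> norm (f h) \<le> C * M)"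
      by (elim allE[of _ ?W] impE) auto
    note fb = fb0[rule_format]
    obtain B N' where B: "B \<ge> 0" and B0: "\<forall>g\<in>test_functions K. \<forall>M\<ge>0. derivs_bounded N' K g M \<longrightarrow>
        derivs_bounded N K' (transposed ?\<sigma> g) (B * M)"
      using transposed_bounded[OF admissible_abs K(1) K1 K', of N] by auto
    show ?thesis
    proof (intro exI[of _ N'] exI[of _ "C * B"] ballI allI impI)
      fix g and M :: real assume g: "g \<in> test_functions K" and M: "0 \<le> M" and d: "derivs_bounded N' K g M"
      have "g \<in> test_functions ?U" using g test_functions_mono[OF K(2)] by blast
      then show "norm (radon_transform q A f g) \<le> C * B * M"
        using fb[OF smooth_on_transposed[OF admissible_abs K(1) K1 g] _ B0[rule_format, OF g M d]] B M R
        by (simp add: mult.assoc)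
    qed
  qed
  ultimately show ?thesis unfolding distributions_def by blast
qed

theorem radon_fourier_integral_operator:
  "fourier_integral_operator (\<Omega> \<times> {0<..}) (- hypersurface \<Omega> q) (radon_phase q A) (radon_transform q A)"
  unfolding fourier_integral_operator_def
proof (intro conjI exI[of _ WF] exI[of _ radon_symbol] exI[of _ 1] exI[of _ radon_remainder] ballI)
  show "open (\<Omega> \<times> {0::real<..})" using \<Omega> by (intro open_Times) auto
  show "(\<Omega> \<times> {0<..}) \<times> (- hypersurface \<Omega> q) \<subseteq> WF" unfolding WF_def hypersurface_def by auto
next
  fix f g assume f: "f \<in> compact_distributions (- hypersurface \<Omega> q)" and g: "g \<in> test_functions (\<Omega> \<times> {0::real<..})"
  have g': "g \<in> test_functions (\<Omega> \<times> UNIV)" using g test_functions_mono[of "\<Omega> \<times> {0<..}" "\<Omega> \<times> UNIV"] by blast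
  have t: "osc_transpose (radon_phase q A) radon_symbol g = transposed high_freq g"
    unfolding radon_symbol_def by (rule osc_transpose_eq[OF g' admissible_high_freq])
  show "smooth_on (- hypersurface \<Omega> q) (osc_transpose (radon_phase q A) radon_symbol g)"
    unfolding t by (rule smooth_on_transposed_off[OF admissible_high_freq g])
  show "radon_transform q A f g =
      f (\<lambda>v. osc_transpose (radon_phase q A) radon_symbol g v + (LINT u|lborel. radon_remainder (u, v) * g u))"
    unfolding t radon_transform_eq[OF g'] transposed_split[OF g', symmetric] ..
qed (fact open_WF nondegenerate_radon_phase radon_symbol_class smooth_on_radon_remainder radon_transform_distribution)+

end

section \<open>Determinants of linear maps between Euclidean spaces\<close>

text \<open>
  Enumerating the two bases by a finite type turns \<open>eucl_det\<close> into the determinant of a square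
  matrix, for which the replacement of a row or a column is Cramer's rule.
\<close>

locale basis_enumeration =
  fixes idx :: "'i::finite \<Rightarrow> 'b::euclidean_space" and a :: "'a::euclidean_space itself"
  assumes idx: "bij_betw idx UNIV Basis" and DIM: "DIM('a) = DIM('b)"
begin

definition \<beta> :: "'b \<Rightarrow> 'a" where "\<beta> = (SOME \<beta>. bij_betw \<beta> Basis Basis)"

definition src :: "'i \<Rightarrow> 'a" where "src j = \<beta> (idx j)"

definition mat_of :: "('a \<Rightarrow> 'b) \<Rightarrow> real ^ 'i ^ 'i" where
  "mat_of L = (\<chi> i j. L (src j) \<bullet> idx i)"

lemma src: "bij_betw src UNIV Basis"
proof -
  have "\<exists>\<beta>. bij_betw \<beta> (Basis :: 'b set) (Basis :: 'a set)"
    using DIM by (intro finite_same_card_bij) auto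
  then have "bij_betw \<beta> Basis Basis" unfolding \<beta>_def by (rule someI_ex)
  from bij_betw_trans[OF idx this] show ?thesis unfolding src_def[abs_def] comp_def .
qed

lemma eucl_det_eq: "eucl_det L = det (mat_of L)"
proof -
  let ?F = "\<lambda>\<pi> b. if b \<in> Basis then idx (\<pi> (inv_into UNIV idx b)) else b"
  have inv: "inv_into UNIV idx (idx i) = i" for i using idx by (simp add: bij_betw_def)
  have inB: "idx i \<in> Basis" for i using idx by (auto simp: bij_betw_def)
  have sgn: "sign (?F \<pi>) = sign \<pi>" if "\<pi> permutes UNIV" for \<pi>
  proof -
    have "?F \<pi> = map_permutation UNIV idx \<pi>"
      using idx by (auto simp: map_permutation_def restrict_id_def fun_eq_iff bij_betw_def)
    then show ?thesis using sign_map_permutation[of idx UNIV \<pi>] that idx by (simp add: bij_betw_def)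
  qed
  have "eucl_det L = (\<Sum>\<pi> | \<pi> permutes (Basis :: 'b set). of_int (sign \<pi>) * (\<Prod>b\<in>Basis. L (\<beta> (\<pi> b)) \<bullet> b))"
    unfolding eucl_det_def \<beta>_def by simp
  also have "\<dots> = (\<Sum>\<pi> | \<pi> permutes (UNIV :: 'i set). of_int (sign (?F \<pi>)) * (\<Prod>b\<in>Basis. L (\<beta> (?F \<pi> b)) \<bullet> b))"
    by (rule sum.reindex_bij_betw[OF bij_betw_permutations[OF idx], symmetric])
  also have "\<dots> = (\<Sum>\<pi> | \<pi> permutes (UNIV :: 'i set). of_int (sign \<pi>) * (\<Prod>i\<in>UNIV. mat_of L $ i $ \<pi> i))"
  proof (rule sum.cong[OF refl])
    fix \<pi> :: "'i \<Rightarrow> 'i" assume "\<pi> \<in> {\<pi>. \<pi> permutes UNIV}"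
    moreover have "(\<Prod>b\<in>Basis. L (\<beta> (?F \<pi> b)) \<bullet> b) = (\<Prod>i\<in>UNIV. L (\<beta> (?F \<pi> (idx i))) \<bullet> idx i)"
      by (rule prod.reindex_bij_betw[OF idx, symmetric])
    ultimately show "of_int (sign (?F \<pi>)) * (\<Prod>b\<in>Basis. L (\<beta> (?F \<pi> b)) \<bullet> b)
        = of_int (sign \<pi>) * (\<Prod>i\<in>UNIV. mat_of L $ i $ \<pi> i)"
      using sgn by (simp add: inB inv mat_of_def src_def)
  qed
  finally show ?thesis unfolding det_def .
qed

lemma sum_src: "(\<Sum>j\<in>UNIV. (x \<bullet> src j) *\<^sub>R src j) = x"
  using sum.reindex_bij_betw[OF src, of "\<lambda>b. (x \<bullet> b) *\<^sub>R b"] by (simp add: euclidean_representation)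

lemma src_inner: "src i \<bullet> src j = (if i = j then 1 else 0)"
proof -
  have "src i \<in> Basis" "src j \<in> Basis" "src i = src j \<longleftrightarrow> i = j"
    using src by (auto simp: bij_betw_def inj_eq)
  then show ?thesis by (simp add: inner_Basis)
qed

lemma eucl_det_nonzero:
  fixes L :: "'a \<Rightarrow> 'b"
  assumes L: "linear L" and inj: "\<And>x. L x = 0 \<Longrightarrow> x = 0"
  shows "eucl_det L \<noteq> 0"
proof -
  have "x = 0" if x: "mat_of L *v x = 0" for x
  proof -
    let ?s = "\<Sum>j\<in>UNIV. x $ j *\<^sub>R src j"
    have "L ?s \<bullet> idx i = (mat_of L *v x) $ i" for i
      by (simp add: linear_sum[OF L] linear_scale[OF L] inner_sum_left mat_of_def matrix_vector_mult_def mult.commute)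
    then have i0: "L ?s \<bullet> idx i = 0" for i by (simp only: x zero_index)
    have "L ?s \<bullet> b = 0" if "b \<in> Basis" for b
    proof -
      obtain i where "b = idx i" using idx \<open>b \<in> Basis\<close> unfolding bij_betw_def by blast
      then show ?thesis using i0 by simp
    qed
    then have "L ?s = 0" using euclidean_all_zero_iff by blast
    then have "?s = 0" by (rule inj)
    then have "?s \<bullet> src i = 0" for i by simp
    then show "x = 0" by (simp add: inner_sum_left src_inner vec_eq_iff if_distrib cong: if_cong)
  qed
  then have "invertible (mat_of L)"
    by (meson invertible_left_inverse matrix_left_invertible_ker)
  then show ?thesis by (simp add: eucl_det_eq invertible_det_nz)
qed

lemma eucl_det_replace_column:
  fixes L L' :: "'a \<Rightarrow> 'b"
  assumes L': "linear L'" and e: "e \<in> Basis"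
    and eq: "\<And>b. b \<in> Basis \<Longrightarrow> b \<noteq> e \<Longrightarrow> L b = L' b" and Le: "L e = L' x"
  shows "eucl_det L = (x \<bullet> e) * eucl_det L'"
proof -
  obtain k where k: "src k = e" using src e by (metis bij_betw_def imageE)
  have ne: "src j \<in> Basis" "src j = e \<longleftrightarrow> j = k" for j
    using src k by (auto simp: bij_betw_def inj_eq)
  have "L' x \<bullet> idx i = (mat_of L' *v (\<chi> j. x \<bullet> src j)) $ i" for i
  proof -
    have "L' x = L' (\<Sum>j\<in>UNIV. (x \<bullet> src j) *\<^sub>R src j)" by (simp only: sum_src)
    then show ?thesis
      by (simp add: linear_sum[OF L'] linear_scale[OF L'] inner_sum_left mat_of_def matrix_vector_mult_def mult.commute)
  qed
  then have "mat_of L = (\<chi> i j. if j = k then (mat_of L' *v (\<chi> j. x \<bullet> src j)) $ i else mat_of L' $ i $ j)"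
    using eq Le ne by (simp add: vec_eq_iff mat_of_def k)
  then show ?thesis
    unfolding eucl_det_eq using cramer_lemma[of k "mat_of L'" "\<chi> j. x \<bullet> src j"] by (simp add: k)
qed

lemma eucl_det_replace_row:
  fixes L L' :: "'a \<Rightarrow> 'b"
  assumes e: "e \<in> Basis"
    and eq: "\<And>v b. b \<in> Basis \<Longrightarrow> b \<noteq> e \<Longrightarrow> L v \<bullet> b = L' v \<bullet> b" and Le: "\<And>v. L v \<bullet> e = L' v \<bullet> c"
  shows "eucl_det L = (c \<bullet> e) * eucl_det L'"
proof -
  obtain k where k: "idx k = e" using idx e by (metis bij_betw_def imageE)
  have ne: "idx i \<in> Basis" "idx i = e \<longleftrightarrow> i = k" for i
    using idx k by (auto simp: bij_betw_def inj_eq)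
  have c: "(\<Sum>i\<in>UNIV. (c \<bullet> idx i) *\<^sub>R idx i) = c"
    using sum.reindex_bij_betw[OF idx, of "\<lambda>b. (c \<bullet> b) *\<^sub>R b"] by (simp add: euclidean_representation)
  have "L' v \<bullet> c = (\<Sum>i\<in>UNIV. (c \<bullet> idx i) * (L' v \<bullet> idx i))" for v
    by (subst c[symmetric]) (simp add: inner_sum_right)
  then have "mat_of L = (\<chi> i. if i = k then \<Sum>i\<in>UNIV. (\<chi> i. c \<bullet> idx i) $ i *s row i (mat_of L') else row i (mat_of L'))"
    using eq Le ne by (simp add: vec_eq_iff mat_of_def row_def k)
  then show ?thesis
    unfolding eucl_det_eq using cramer_lemma_transpose[of k "\<chi> i. c \<bullet> idx i" "mat_of L'"] by (simp add: k)
qed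

lemma continuous_on_eucl_det:
  fixes L :: "'p::topological_space \<Rightarrow> 'a \<Rightarrow> 'b"
  assumes "\<And>v b. continuous_on M (\<lambda>p. L p v \<bullet> b)"
  shows "continuous_on M (\<lambda>p. eucl_det (L p))"
  unfolding eucl_det_def Let_def
  by (intro continuous_on_sum continuous_on_mult continuous_on_const continuous_on_prod assms)

end

section \<open>Criteria for folds and cusps\<close>

text \<open>
  At a zero of \<open>h\<close> the product rule sees only the value of \<open>D\<close>, so continuity of \<open>D\<close> is enough.
\<close>

lemma has_derivative_mult_vanishing:
  fixes h D :: "'a::real_normed_vector \<Rightarrow> real"
  assumes h: "(h has_derivative dh) (at p)" and z: "h p = 0" and D: "isCont D p"
  shows "((\<lambda>x. h x * D x) has_derivative (\<lambda>v. D p * dh v)) (at p)"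
  unfolding has_derivative_within
proof
  have bl: "bounded_linear dh" using h by (rule has_derivative_bounded_linear)
  show "bounded_linear (\<lambda>v. D p * dh v)" by (rule bounded_linear_compose[OF bounded_linear_mult_right bl])
  obtain B where B0: "0 \<le> B" and B: "\<And>v. \<bar>dh v\<bar> \<le> norm v * B"
    using bounded_linear.nonneg_bounded[OF bl] by auto
  let ?r = "\<lambda>y. (1 / norm (y - p)) *\<^sub>R (h y - (h p + dh (y - p)))"
  have r: "(?r \<longlongrightarrow> 0) (at p)" using h unfolding has_derivative_within by blast
  have D0: "((\<lambda>y. D y - D p) \<longlongrightarrow> 0) (at p)" using D by (simp add: isCont_def LIM_zero)
  have s: "((\<lambda>y. (D y - D p) * (dh (y - p) / norm (y - p))) \<longlongrightarrow> 0) (at p)"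
  proof (rule Lim_null_comparison)
    show "\<forall>\<^sub>F y in at p. norm ((D y - D p) * (dh (y - p) / norm (y - p))) \<le> \<bar>D y - D p\<bar> * \<bar>B\<bar>"
    proof (rule always_eventually, rule allI)
      fix y
      have "\<bar>dh (y - p) / norm (y - p)\<bar> \<le> \<bar>B\<bar>"
      proof (cases "y = p")
        case True
        then show ?thesis by simp
      next
        case False
        then have "0 < norm (y - p)" by simp
        then have "\<bar>dh (y - p)\<bar> / norm (y - p) \<le> B" using B[of "y - p"] by (simp only: pos_divide_le_eq mult.commute)
        then show ?thesis using B0 by simp
      qed
      then show "norm ((D y - D p) * (dh (y - p) / norm (y - p))) \<le> \<bar>D y - D p\<bar> * \<bar>B\<bar>"
        unfolding real_norm_def abs_mult by (rule mult_left_mono) simp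
    qed
    show "((\<lambda>y. \<bar>D y - D p\<bar> * \<bar>B\<bar>) \<longlongrightarrow> 0) (at p)"
      using tendsto_mult_left_zero[OF tendsto_rabs_zero[OF D0]] .
  qed
  have "((\<lambda>y. D y * ?r y + (D y - D p) * (dh (y - p) / norm (y - p))) \<longlongrightarrow> D p * 0 + 0) (at p)"
    using D by (intro tendsto_add tendsto_mult r s) (simp add: isCont_def)
  moreover have "D y * ?r y + (D y - D p) * (dh (y - p) / norm (y - p))
      = (1 / norm (y - p)) *\<^sub>R (h y * D y - (h p * D p + D p * dh (y - p)))" for y
    using z by (simp add: divide_inverse algebra_simps)
  ultimately show "((\<lambda>y. (1 / norm (y - p)) *\<^sub>R (h y * D y - (h p * D p + D p * dh (y - p)))) \<longlongrightarrow> 0) (at p)"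
    by simp
qed

text \<open>
  In both projections the Jacobian determinant is a nonvanishing continuous multiple of an explicit
  defining function \<open>h\<close>, so that \<open>h\<close> can replace it in the definitions of fold and cusp points.
\<close>

locale defining_function =
  fixes M :: "'a::euclidean_space set" and f :: "'a \<Rightarrow> 'b::euclidean_space" and h D :: "'a \<Rightarrow> real"
    and dh :: "'a \<Rightarrow> 'a \<Rightarrow> real"
  assumes M: "open M"
    and jac: "\<And>s. s \<in> M \<Longrightarrow> jac_det f s = h s * D s"
    and D_nz: "\<And>s. s \<in> M \<Longrightarrow> D s \<noteq> 0" and D_cont: "continuous_on M D"
    and dh: "\<And>s. s \<in> M \<Longrightarrow> (h has_derivative dh s) (at s)"
begin

lemma frechet_jac:
  assumes "p \<in> M" "h p = 0"
  shows "frechet_derivative (jac_det f) (at p) = (\<lambda>v. D p * dh p v)"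
proof -
  have "isCont D p" using D_cont M assms(1) continuous_on_eq_continuous_at by blast
  from has_derivative_mult_vanishing[OF dh[OF assms(1)] assms(2) this]
  have "(jac_det f has_derivative (\<lambda>v. D p * dh p v)) (at p)"
    by (rule has_derivative_transform_within_open[OF _ M assms(1)]) (simp add: jac)
  then show ?thesis by (rule frechet_derivative_eqI)
qed

lemma ker_jac: "p \<in> M \<Longrightarrow> h p = 0 \<Longrightarrow> ker_d (jac_det f) p = {v. dh p v = 0}"
  unfolding ker_d_def using frechet_jac D_nz by simp

lemma jac_zero: "p \<in> M \<Longrightarrow> jac_det f p = 0 \<longleftrightarrow> h p = 0"
  using jac D_nz by simp

lemma S1I: "p \<in> M \<Longrightarrow> h p = 0 \<Longrightarrow> dh p v \<noteq> 0 \<Longrightarrow> p \<in> S1 M f"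
  unfolding S1_def using jac_zero[of p] frechet_jac[of p] D_nz[of p] by (auto simp: fun_eq_iff)

lemma S1D: "p \<in> S1 M f \<Longrightarrow> p \<in> M \<and> h p = 0"
  unfolding S1_def using jac_zero by auto

text \<open>
  The tangent space of the critical set is the hyperplane \<open>dh = 0\<close>, so one kernel vector of \<open>df\<close> off this
  hyperplane gives transversality.
\<close>

lemma fold_pointI:
  assumes p: "p \<in> M" "h p = 0" and v: "v \<in> ker_d f p" "dh p v \<noteq> 0" and lin: "linear (frechet_derivative f (at p))"
  shows "fold_point M f p"
  unfolding fold_point_def
proof
  show "p \<in> S1 M f" using p v by (intro S1I)
  have l: "linear (dh p)" using dh[OF p(1)] has_derivative_linear by blast
  have "w \<in> {a + b |a b. a \<in> ker_d f p \<and> b \<in> ker_d (jac_det f) p}" for w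
  proof -
    let ?c = "dh p w / dh p v"
    have "?c *\<^sub>R v \<in> ker_d f p" using v(1) linear_scale[OF lin] by (simp add: ker_d_def)
    moreover have "w - ?c *\<^sub>R v \<in> ker_d (jac_det f) p"
      using v(2) by (simp add: ker_jac[OF p] linear_diff[OF l] linear_scale[OF l])
    moreover have "w = ?c *\<^sub>R v + (w - ?c *\<^sub>R v)" by simp
    ultimately show ?thesis by blast
  qed
  then show "{a + b |a b. a \<in> ker_d f p \<and> b \<in> ker_d (jac_det f) p} = UNIV" by blast
qed

lemma cusp_pointI:
  assumes p: "p \<in> M" "h p = 0" and ker: "\<And>a. a \<in> ker_d f p \<Longrightarrow> dh p a = 0"
    and v: "smooth_on M v" "\<And>s. s \<in> M \<Longrightarrow> v s \<noteq> 0" "\<And>s. s \<in> M \<Longrightarrow> h s = 0 \<Longrightarrow> v s \<in> ker_d f s"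
    and h: "smooth_on M h" and h_reg: "\<And>s. s \<in> M \<Longrightarrow> \<exists>u. dh s u \<noteq> 0"
    and F: "\<And>s. s \<in> M \<Longrightarrow> dh s (v s) = F s" and dF: "(F has_derivative dF) (at p)"
    and w: "dh p w = 0" "dF w \<noteq> 0"
  shows "cusp_point M f p"
  unfolding cusp_point_def
proof (intro conjI exI[of _ M] exI[of _ v] exI[of _ h] ballI bexI[of _ w])
  obtain u where "dh p u \<noteq> 0" using h_reg p by blast
  then show "p \<in> S1 M f" using p by (intro S1I)
  show "ker_d f p \<subseteq> ker_d (jac_det f) p" using ker ker_jac[OF p] by blast
  have fh: "frechet_derivative h (at s) = dh s" if "s \<in> M" for s
    using frechet_derivative_eqI[OF dh[OF that]] .
  fix s assume s: "s \<in> S1 M f \<inter> M"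
  then have "s \<in> M" "h s = 0" using S1D by auto
  then show "v s \<noteq> 0" "v s \<in> ker_d f s" "h s = 0" using v by auto
  obtain u where "dh s u \<noteq> 0" using h_reg \<open>s \<in> M\<close> by blast
  then show "frechet_derivative h (at s) \<noteq> (\<lambda>_. 0)" using fh[OF \<open>s \<in> M\<close>] by auto
next
  show "w \<in> ker_d (jac_det f) p" using w ker_jac[OF p] by blast
  have "((\<lambda>s. frechet_derivative h (at s) (v s)) has_derivative dF) (at p)"
  proof (rule has_derivative_transform_within_open[OF dF M p(1)])
    show "F s = frechet_derivative h (at s) (v s)" if "s \<in> M" for s
      using frechet_derivative_eqI[OF dh[OF that]] F[OF that] by simp
  qed
  then show "frechet_derivative (\<lambda>s. frechet_derivative h (at s) (v s)) (at p) w \<noteq> 0"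
    using frechet_derivative_eqI w(2) by metis
qed (use M p v h in auto)

end

section \<open>The canonical relation and its projections\<close>

type_synonym 'm params = "(real ^ 'm) \<times> (real ^ ('m option)) \<times> real"
type_synonym 'm left_cotangent = "((real ^ 'm) \<times> real) \<times> ((real ^ 'm) \<times> real)"
type_synonym 'm right_cotangent = "(real ^ ('m option)) \<times> (real ^ ('m option))"

context radon_geometry
begin

text \<open>
  An open neighbourhood of the parameter set on which all constructions stay smooth; the condition
  on the quadratic form keeps \<open>x\<close> away from \<open>\<gamma> y\<close>.
\<close>

definition chart_domain :: "'m params set" where
  "chart_domain = {p. fst p \<in> \<Omega> \<and> snd (snd p) \<noteq> 0 \<and> quad q A (fst p) (fst (snd p)) > 0}"

definition offset :: "'m params \<Rightarrow> real ^ ('m option)" where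
  "offset p = fst (snd p) - \<gamma> (fst p)"

definition left_map :: "'m params \<Rightarrow> 'm left_cotangent" where
  "left_map p = ((fst p, quad q A (fst p) (fst (snd p))), ((2 * snd (snd p)) *\<^sub>R pull (fst p) (A *v offset p), snd (snd p)))"

definition right_map :: "'m params \<Rightarrow> 'm right_cotangent" where
  "right_map p = (fst (snd p), (2 * snd (snd p)) *\<^sub>R (A *v offset p))"

lemma open_chart_domain: "open chart_domain"
proof -
  have o: "open (\<Omega> \<times> (UNIV :: ((real ^ ('m option)) \<times> real) set))" using \<Omega> by (intro open_Times) auto
  have "smooth_on (\<Omega> \<times> (UNIV :: ((real ^ ('m option)) \<times> real) set)) (\<lambda>p. quad q A (fst p) (fst (snd p)))"
    by (rule smooth_on_quad[OF o smooth_on_fst _ smooth_on_linear_compose[OF o bounded_linear_fst smooth_on_snd]]) auto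
  from continuous_open_preimage[OF smooth_on_continuous[OF this] o open_greaterThan[of 0]]
  have 1: "open (\<Omega> \<times> (UNIV :: ((real ^ ('m option)) \<times> real) set) \<inter> (\<lambda>p. quad q A (fst p) (fst (snd p))) -` {0<..})" .
  have 2: "open ((\<lambda>p :: 'm params. snd (snd p)) -` (- {0}))"
    by (rule open_vimage) (auto intro!: continuous_intros)
  have "chart_domain = (\<Omega> \<times> UNIV \<inter> (\<lambda>p. quad q A (fst p) (fst (snd p))) -` {0<..}) \<inter> (\<lambda>p. snd (snd p)) -` (- {0})"
    unfolding chart_domain_def by auto
  then show ?thesis using open_Int[OF 1 2] by simp
qed

lemma chart_domainD:
  assumes "p \<in> chart_domain"
  shows "fst p \<in> \<Omega>" "snd (snd p) \<noteq> 0" "offset p \<noteq> 0" "quad q A (fst p) (fst (snd p)) > 0"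
  using assms by (auto simp: chart_domain_def offset_def quad_def)

lemma chart_base: "fst ` chart_domain \<subseteq> \<Omega>"
  by (auto simp: chart_domain_def)

lemma params_subset: "relation_params \<Omega> q A \<subseteq> chart_domain"
  by (auto simp: relation_params_def chart_domain_def)

lemma relation_chart_eq:
  assumes "p \<in> chart_domain"
  shows "relation_chart q A p = (left_map p, right_map p)"
proof -
  obtain y x \<omega> where p: "p = (y, x, \<omega>)" by (cases p)
  have "y \<in> \<Omega>" using chart_domainD(1)[OF assms] p by simp
  then show ?thesis
    unfolding p relation_chart_def left_map_def right_map_def offset_def
    by (simp add: grad_phase_u grad_phase_x Let_def)
qed

lemma smooth_chart_snd:
  "smooth_on chart_domain (\<lambda>p. fst (snd p))" "smooth_on chart_domain (\<lambda>p. snd (snd p))"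
  by (rule smooth_on_linear_compose[OF open_chart_domain bounded_linear_fst smooth_on_snd]
      smooth_on_linear_compose[OF open_chart_domain bounded_linear_snd smooth_on_snd])+

lemma smooth_on_grad_q: "smooth_on \<Omega> (grad q)"
  unfolding grad_def[abs_def]
  by (intro smooth_on_sum[OF \<Omega>] smooth_on_scaleR[OF \<Omega> smooth_on_pd[OF q] smooth_on_const])

lemma smooth_chart_grad: "smooth_on chart_domain (\<lambda>p. grad q (fst p))"
  by (rule smooth_on_compose[OF open_chart_domain \<Omega> smooth_on_grad_q smooth_on_fst chart_base])

lemma smooth_A_offset: "smooth_on chart_domain (\<lambda>p. A *v offset p)"
  unfolding offset_def by (rule smooth_on_offset[OF open_chart_domain smooth_on_fst chart_base smooth_chart_snd(1)])

lemma smooth_left_map: "smooth_on chart_domain left_map"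
  unfolding left_map_def[abs_def] pull_def
  by (rule smooth_on_Pair[OF open_chart_domain smooth_on_Pair[OF open_chart_domain smooth_on_fst
          smooth_on_quad[OF open_chart_domain smooth_on_fst chart_base smooth_chart_snd(1)]]
        smooth_on_Pair[OF open_chart_domain smooth_on_scaleR[OF open_chart_domain
            smooth_on_mult[OF open_chart_domain smooth_on_const smooth_chart_snd(2)]
            smooth_on_add[OF open_chart_domain smooth_on_linear_compose[OF open_chart_domain base_part_linear smooth_A_offset]
              smooth_on_scaleR[OF open_chart_domain smooth_on_linear_compose[OF open_chart_domain bounded_linear_vec_nth smooth_A_offset]
                smooth_chart_grad]]] smooth_chart_snd(2)]])

lemma smooth_right_map: "smooth_on chart_domain right_map"
  unfolding right_map_def[abs_def]
  by (rule smooth_on_Pair[OF open_chart_domain smooth_chart_snd(1) smooth_on_scaleR[OF open_chart_domain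
            smooth_on_mult[OF open_chart_domain smooth_on_const smooth_chart_snd(2)] smooth_A_offset]])

lemma smooth_relation_chart: "smooth_on chart_domain (relation_chart q A)"
  by (rule smooth_on_cong[OF open_chart_domain smooth_on_Pair[OF open_chart_domain smooth_left_map smooth_right_map]])
     (rule relation_chart_eq)

text \<open>
  Reads \<open>y\<close>, \<open>x\<close> and \<open>\<omega>\<close> off the covectors; a linear left inverse of the parametrization.
\<close>

definition unchart ::
  "'m left_cotangent \<times> 'm right_cotangent \<Rightarrow> 'm params" where
  "unchart c = (fst (fst (fst c)), fst (snd c), snd (snd (fst c)))"

lemma unchart_linear: "bounded_linear unchart"
  unfolding unchart_def[abs_def]
  by (intro bounded_linear_Pair bounded_linear_fst_comp bounded_linear_snd_comp bounded_linear_ident)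

lemma unchart_chart: "p \<in> chart_domain \<Longrightarrow> unchart (relation_chart q A p) = p"
  by (simp add: relation_chart_eq unchart_def left_map_def right_map_def)

theorem radon_smooth_parametrization:
  "smooth_parametrization (relation_params \<Omega> q A) (relation_chart q A)
     (canonical_relation (\<Omega> \<times> {0<..}) (- hypersurface \<Omega> q) (radon_phase q A))"
  unfolding smooth_parametrization_def
proof (intro conjI ballI exI[of _ unchart])
  let ?P = "relation_params \<Omega> q A" and ?C = "canonical_relation (\<Omega> \<times> {0<..}) (- hypersurface \<Omega> q) (radon_phase q A)"
  show sm: "smooth_on ?P (relation_chart q A)" by (rule smooth_on_subset[OF smooth_relation_chart params_subset])
  show "inj (frechet_derivative (relation_chart q A) (at p))" if "p \<in> ?P" for p
  proof -
    have p: "p \<in> chart_domain" using that params_subset by blast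
    have d: "(relation_chart q A has_derivative frechet_derivative (relation_chart q A) (at p)) (at p)"
      by (rule smooth_on_has_derivative[OF smooth_relation_chart open_chart_domain p])
    have "((\<lambda>p. unchart (relation_chart q A p)) has_derivative
        (\<lambda>v. unchart (frechet_derivative (relation_chart q A) (at p) v))) (at p)"
      by (rule bounded_linear.has_derivative[OF unchart_linear d])
    then have "((\<lambda>p. p) has_derivative (\<lambda>v. unchart (frechet_derivative (relation_chart q A) (at p) v))) (at p)"
      by (rule has_derivative_transform_within_open[OF _ open_chart_domain p]) (rule unchart_chart)
    then have "(\<lambda>v. unchart (frechet_derivative (relation_chart q A) (at p) v)) = (\<lambda>v. v)"
      by (rule has_derivative_unique[OF _ has_derivative_ident])
    then show ?thesis by (metis injI)
  qed
  have C: "?C = relation_chart q A ` ?P"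
  proof (rule set_eqI, rule iffI)
    fix c assume "c \<in> ?C"
    then obtain y t x \<omega> where c: "c = (((y, t), grad (\<lambda>u. radon_phase q A u x \<omega>) (y, t)), (x, - grad (\<lambda>x. radon_phase q A (y, t) x \<omega>) x))"
      and *: "y \<in> \<Omega>" "t > 0" "x \<notin> hypersurface \<Omega> q" "\<omega> \<noteq> 0" "t = quad q A y x"
      unfolding canonical_relation_def by (auto simp: grad_phase_\<omega>)
    have "(y, x, \<omega>) \<in> ?P" using * by (simp add: relation_params_def)
    moreover have "c = relation_chart q A (y, x, \<omega>)" unfolding c relation_chart_def using *(5) by (simp add: Let_def)
    ultimately show "c \<in> relation_chart q A ` ?P" by blast
  next
    fix c assume "c \<in> relation_chart q A ` ?P"
    then obtain y x \<omega> where *: "y \<in> \<Omega>" "x \<notin> hypersurface \<Omega> q" "\<omega> \<noteq> 0" "quad q A y x > 0"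
      and c: "c = relation_chart q A (y, x, \<omega>)"
      unfolding relation_params_def by blast
    have "(y, quad q A y x) \<in> \<Omega> \<times> {0<..}" "x \<in> - hypersurface \<Omega> q" "grad (radon_phase q A (y, quad q A y x) x) \<omega> = 0"
      using * by (auto simp: grad_phase_\<omega>)
    then show "c \<in> ?C" unfolding canonical_relation_def c relation_chart_def Let_def prod.case using *(3) by blast
  qed
  show "homeomorphism ?P ?C (relation_chart q A) unchart"
  proof (rule homeomorphismI)
    show "continuous_on ?P (relation_chart q A)" using smooth_on_continuous[OF sm] .
    show "continuous_on ?C unchart" using bounded_linear.continuous_on[OF unchart_linear continuous_on_id] .
    show "relation_chart q A ` ?P \<subseteq> ?C" using C by simp
    show inv: "unchart (relation_chart q A p) = p" if "p \<in> ?P" for p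
      using unchart_chart params_subset that by blast
    show "unchart ` ?C \<subseteq> ?P" unfolding C using inv by auto
    show "relation_chart q A (unchart c) = c" if "c \<in> ?C" for c
      using that inv unfolding C by auto
  qed
qed

section \<open>The critical set\<close>

text \<open>
  The normal \<open>(- \<nabla>q, 1)\<close>. Here and in \<open>vert\<close> the constant function only serves to supply the last
  component.
\<close>

definition normal :: "real ^ 'm \<Rightarrow> real ^ ('m option)" where
  "normal y = graph_tangent (\<lambda>_. 1) (- grad q y)"

definition Hq :: "real ^ 'm \<Rightarrow> real ^ 'm \<Rightarrow> real ^ 'm" where
  "Hq y = frechet_derivative (grad q) (at y)"

definition vert :: "real ^ ('m option)" where
  "vert = graph_tangent (\<lambda>_. 1) 0"

text \<open>The vertical coordinate of the offset relative to the tangent plane at \<open>y\<close>.\<close>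

definition height :: "'m params \<Rightarrow> real" where
  "height p = offset p \<bullet> normal (fst p)"

lemma vert_components [simp]: "vert $ None = 1" "base_part vert = 0"
  by (simp_all add: vert_def)

lemma base_part_simps [simp]:
  "base_part (a + b) = base_part a + base_part b" "base_part (a - b) = base_part a - base_part b"
  "base_part (r *\<^sub>R a) = r *\<^sub>R base_part a" "base_part 0 = 0"
  by (simp_all add: base_part_def vec_eq_iff)

lemma inner_normal: "w \<bullet> normal y = w $ None - base_part w \<bullet> grad q y"
  by (simp add: normal_def inner_option)

lemma tangent_normal: "y \<in> \<Omega> \<Longrightarrow> d\<gamma> y \<eta> \<bullet> normal y = 0"
  by (simp add: inner_normal dq_grad)

lemma normal_nz: "normal y \<noteq> 0"
proof
  assume "normal y = 0"
  then have "normal y $ None = 0" by simp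
  then show False by (simp add: normal_def)
qed

text \<open>
  A vector is the sum of a vertical and a tangent vector. Pairing with the normal, which annihilates
  tangent vectors and has last component 1, identifies the vertical coefficient.
\<close>

lemma offset_split: "fst p \<in> \<Omega> \<Longrightarrow> offset p = height p *\<^sub>R vert + d\<gamma> (fst p) (base_part (offset p))"
  by (rule vec_option_eqI) (simp_all add: height_def inner_normal dq_grad)

text \<open>
  As \<open>pull y\<close> is the transpose of \<open>d\<gamma> y\<close>, its kernel is the normal line.
\<close>

lemma orthogonal_tangents:
  assumes "y \<in> \<Omega>" "pull y w = 0"
  shows "w = (w $ None) *\<^sub>R normal y"
proof (rule vec_option_eqI)
  show "base_part w = base_part ((w $ None) *\<^sub>R normal y)"
    using assms(2) by (simp add: pull_def normal_def eq_neg_iff_add_eq_0)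
qed (simp add: normal_def)

lemma Hq_der: "y \<in> \<Omega> \<Longrightarrow> (grad q has_derivative Hq y) (at y)"
  unfolding Hq_def by (rule smooth_on_has_derivative[OF smooth_on_grad_q \<Omega>])

lemma Hq_linear: "y \<in> \<Omega> \<Longrightarrow> linear (Hq y)"
  using Hq_der has_derivative_linear by blast

lemma hessian_Hq: "y \<in> \<Omega> \<Longrightarrow> hessian q y v w = v \<bullet> Hq y w"
proof -
  assume y: "y \<in> \<Omega>"
  have "((\<lambda>z. v \<bullet> grad q z) has_derivative (\<lambda>w. v \<bullet> Hq y w)) (at y)"
    by (rule has_derivative_inner_right[OF Hq_der[OF y]])
  then have "((\<lambda>z. dq z v) has_derivative (\<lambda>w. v \<bullet> Hq y w)) (at y)"
    by (rule has_derivative_transform_within_open[OF _ \<Omega> y]) (simp add: dq_grad)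
  then show ?thesis unfolding hessian_def by (simp add: frechet_derivative_eqI)
qed

lemma offset_der:
  assumes "fst p \<in> \<Omega>"
  shows "(offset has_derivative (\<lambda>v. fst (snd v) - d\<gamma> (fst p) (fst v))) (at p)"
  unfolding offset_def[abs_def]
  by (rule has_derivative_diff[OF has_derivative_fst[OF has_derivative_snd[OF has_derivative_ident]]
        has_derivative_compose[OF has_derivative_fst[OF has_derivative_ident] \<gamma>_der[OF assms]]])

lemma lower_linear: "bounded_linear (\<lambda>w :: real ^ 'm. graph_tangent (\<lambda>_. 0) (- w) :: real ^ ('m option))"
  by (rule linear_conv_bounded_linear[THEN iffD1, OF linearI]) (rule vec_option_eqI; simp)+

lemma normal_der:
  assumes "y \<in> \<Omega>"
  shows "(normal has_derivative (\<lambda>\<eta>. graph_tangent (\<lambda>_. 0) (- Hq y \<eta>))) (at y)"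
proof -
  let ?l = "\<lambda>w. graph_tangent (\<lambda>_. 0) (- w)"
  have "normal = (\<lambda>y. vert + ?l (grad q y))"
    by (rule ext, rule vec_option_eqI) (simp_all add: normal_def)
  moreover have "((\<lambda>y. vert + ?l (grad q y)) has_derivative (\<lambda>\<eta>. 0 + ?l (Hq y \<eta>))) (at y)"
    by (intro has_derivative_add has_derivative_const bounded_linear.has_derivative[OF lower_linear] Hq_der assms)
  ultimately show ?thesis by simp
qed

definition dheight :: "'m params \<Rightarrow> 'm params \<Rightarrow> real" where
  "dheight p v = fst (snd v) \<bullet> normal (fst p) - base_part (offset p) \<bullet> Hq (fst p) (fst v)"

lemma height_der:
  assumes "p \<in> chart_domain"
  shows "(height has_derivative dheight p) (at p)"
proof -
  have y: "fst p \<in> \<Omega>" by (rule chart_domainD(1)[OF assms])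
  have "((\<lambda>p. normal (fst p)) has_derivative (\<lambda>v. graph_tangent (\<lambda>_. 0) (- Hq (fst p) (fst v)))) (at p)"
    by (rule has_derivative_compose[OF has_derivative_fst[OF has_derivative_ident] normal_der[OF y]])
  from has_derivative_inner[OF offset_der[OF y] this]
  show ?thesis
    unfolding height_def[abs_def]
    by (rule has_derivative_eq_rhs)
       (simp add: fun_eq_iff dheight_def inner_diff_left tangent_normal[OF y] inner_option[of "offset p" "graph_tangent _ _"])
qed

lemma smooth_normal: "smooth_on \<Omega> normal"
proof -
  let ?l = "\<lambda>w. graph_tangent (\<lambda>_. 0) (- w)"
  have "smooth_on \<Omega> (\<lambda>y. vert + ?l (grad q y))"
    by (rule smooth_on_add[OF \<Omega> smooth_on_const smooth_on_linear_compose[OF \<Omega> lower_linear smooth_on_grad_q]])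
  then show ?thesis
    by (rule smooth_on_cong[OF \<Omega>]) (rule vec_option_eqI; simp add: normal_def)
qed

lemma smooth_normal_chart: "smooth_on chart_domain (\<lambda>p. normal (fst p))"
  by (rule smooth_on_compose[OF open_chart_domain \<Omega> smooth_normal smooth_on_fst chart_base])

lemma smooth_offset: "smooth_on chart_domain offset"
  unfolding offset_def[abs_def]
  by (rule smooth_on_diff[OF open_chart_domain smooth_chart_snd(1)
        smooth_on_graph_point[OF open_chart_domain \<Omega> q smooth_on_fst chart_base]])

lemma smooth_height: "smooth_on chart_domain height"
  unfolding height_def[abs_def] by (rule smooth_on_inner[OF open_chart_domain smooth_offset smooth_normal_chart])

lemma dheight_regular: "p \<in> chart_domain \<Longrightarrow> \<exists>v. dheight p v \<noteq> 0"
  using normal_nz Hq_linear[OF chart_domainD(1)]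
  by (intro exI[of _ "(0, normal (fst p), 0)"]) (simp add: dheight_def linear_0)

text \<open>
  At height zero the offset is tangent. If its base part vanished, so would the offset, and the
  quadratic form would not be positive.
\<close>

lemma critical_offset:
  assumes "p \<in> chart_domain" "height p = 0"
  shows "offset p = d\<gamma> (fst p) (base_part (offset p))" "base_part (offset p) \<noteq> 0"
proof -
  show *: "offset p = d\<gamma> (fst p) (base_part (offset p))"
    using offset_split[OF chart_domainD(1)[OF assms(1)]] assms(2) by simp
  show "base_part (offset p) \<noteq> 0"
  proof
    assume "base_part (offset p) = 0"
    moreover have "d\<gamma> (fst p) 0 = 0"
      using linear_0[OF has_derivative_linear[OF \<gamma>_der[OF chart_domainD(1)[OF assms(1)]]]] .
    ultimately show False using * chart_domainD(3)[OF assms(1)] by simp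
  qed
qed

lemma left_basis:
  "\<exists>idx :: 'm option + 'm option \<Rightarrow> 'm left_cotangent. basis_enumeration TYPE('m params) idx"
proof -
  have "\<exists>idx :: 'm option + 'm option \<Rightarrow> 'm left_cotangent. bij_betw idx UNIV Basis"
    by (intro finite_same_card_bij) (simp_all add: card_UNIV_option)
  then show ?thesis by (auto simp: basis_enumeration_def card_UNIV_option)
qed

lemma right_basis:
  "\<exists>idx :: 'm option + 'm option \<Rightarrow> 'm right_cotangent. basis_enumeration TYPE('m params) idx"
proof -
  have "\<exists>idx :: 'm option + 'm option \<Rightarrow> 'm right_cotangent. bij_betw idx UNIV Basis"
    by (intro finite_same_card_bij) (simp_all add: card_UNIV_option)
  then show ?thesis by (auto simp: basis_enumeration_def card_UNIV_option)
qed

end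

context radon_geometry
begin

section \<open>The differentials of the projections\<close>

text \<open>
  The differentials of the two projections at \<open>p\<close>, applied to a variation \<open>v\<close> of \<open>(y, x, \<omega>)\<close>. The
  difference \<open>fst (snd v) - d\<gamma> (fst p) (fst v)\<close> is the variation of the offset.
\<close>

definition dleft where
  "dleft p v = ((fst v, 2 * ((fst (snd v) - d\<gamma> (fst p) (fst v)) \<bullet> (A *v offset p))),
     ((2 * snd (snd v)) *\<^sub>R pull (fst p) (A *v offset p)
      + (2 * snd (snd p)) *\<^sub>R (pull (fst p) (A *v (fst (snd v) - d\<gamma> (fst p) (fst v)))
           + ((A *v offset p) $ None) *\<^sub>R Hq (fst p) (fst v)), snd (snd v)))"

definition dright where
  "dright p v = (fst (snd v), (2 * snd (snd v)) *\<^sub>R (A *v offset p)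
      + (2 * snd (snd p)) *\<^sub>R (A *v (fst (snd v) - d\<gamma> (fst p) (fst v))))"

lemma A_offset_der:
  assumes "p \<in> chart_domain"
  shows "((\<lambda>p. A *v offset p) has_derivative (\<lambda>v. A *v (fst (snd v) - d\<gamma> (fst p) (fst v)))) (at p)"
  by (rule bounded_linear.has_derivative[OF A_linear offset_der[OF chart_domainD(1)[OF assms]]])

lemma freq_der: "((\<lambda>p :: 'm params. 2 * snd (snd p)) has_derivative (\<lambda>v. 2 * snd (snd v))) (at p)"
  by (intro has_derivative_mult_right has_derivative_snd has_derivative_ident)

lemma left_map_der:
  assumes p: "p \<in> chart_domain"
  shows "(left_map has_derivative dleft p) (at p)"
proof -
  have y: "fst p \<in> \<Omega>" by (rule chart_domainD(1)[OF p])
  have g: "((\<lambda>p. grad q (fst p)) has_derivative (\<lambda>v. Hq (fst p) (fst v))) (at p)"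
    by (rule has_derivative_compose[OF has_derivative_fst[OF has_derivative_ident] Hq_der[OF y]])
  note a = A_offset_der[OF p]
  have pl: "((\<lambda>p. pull (fst p) (A *v offset p)) has_derivative
      (\<lambda>v. pull (fst p) (A *v (fst (snd v) - d\<gamma> (fst p) (fst v))) + ((A *v offset p) $ None) *\<^sub>R Hq (fst p) (fst v))) (at p)"
    unfolding pull_def
    by (rule has_derivative_eq_rhs[OF has_derivative_add[OF bounded_linear.has_derivative[OF base_part_linear a]
          has_derivative_scaleR[OF bounded_linear.has_derivative[OF bounded_linear_vec_nth a] g]]])
       (simp add: fun_eq_iff)
  have qd: "((\<lambda>p. quad q A (fst p) (fst (snd p))) has_derivative
      (\<lambda>v. 2 * ((fst (snd v) - d\<gamma> (fst p) (fst v)) \<bullet> (A *v offset p)))) (at p)"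
    unfolding offset_def
    by (rule quad_der[OF has_derivative_fst[OF has_derivative_ident]
          has_derivative_fst[OF has_derivative_snd[OF has_derivative_ident]] y])
  show ?thesis
    unfolding left_map_def[abs_def]
    by (rule has_derivative_eq_rhs[OF has_derivative_Pair[OF has_derivative_Pair[OF has_derivative_fst[OF has_derivative_ident] qd]
          has_derivative_Pair[OF has_derivative_scaleR[OF freq_der pl] has_derivative_snd[OF has_derivative_snd[OF has_derivative_ident]]]]])
       (simp add: fun_eq_iff dleft_def add.commute)
qed

lemma right_map_der:
  assumes p: "p \<in> chart_domain"
  shows "(right_map has_derivative dright p) (at p)"
  unfolding right_map_def[abs_def]
  by (rule has_derivative_eq_rhs[OF has_derivative_Pair[OF has_derivative_fst[OF has_derivative_snd[OF has_derivative_ident]]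
        has_derivative_scaleR[OF freq_der A_offset_der[OF p]]]])
     (simp add: fun_eq_iff dright_def add.commute)

lemma projection_derivatives:
  assumes "p \<in> chart_domain"
  shows "frechet_derivative (fst \<circ> relation_chart q A) (at p) = dleft p"
    and "frechet_derivative (snd \<circ> relation_chart q A) (at p) = dright p"
proof -
  have "frechet_derivative (fst \<circ> relation_chart q A) (at p) = frechet_derivative left_map (at p)"
    by (rule frechet_derivative_cong_open[OF open_chart_domain assms]) (simp add: relation_chart_eq)
  then show "frechet_derivative (fst \<circ> relation_chart q A) (at p) = dleft p"
    using frechet_derivative_eqI[OF left_map_der[OF assms]] by simp
  have "frechet_derivative (snd \<circ> relation_chart q A) (at p) = frechet_derivative right_map (at p)"
    by (rule frechet_derivative_cong_open[OF open_chart_domain assms]) (simp add: relation_chart_eq)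
  then show "frechet_derivative (snd \<circ> relation_chart q A) (at p) = dright p"
    using frechet_derivative_eqI[OF right_map_der[OF assms]] by simp
qed

text \<open>
  Replacing the row of \<open>dt\<close> in the differential of the left map, respectively the column of \<open>d\<omega>\<close> in
  that of the right map, by one in which the offset is replaced by the vertical unit vector gives an
  invertible map.
\<close>

definition dleft_reg where
  "dleft_reg p v = ((fst v, 2 * (A *v (fst (snd v) - d\<gamma> (fst p) (fst v))) $ None), snd (dleft p v))"

definition dright_reg where
  "dright_reg p v = (fst (snd v), (2 * snd (snd v)) *\<^sub>R (A *v vert)
      + (2 * snd (snd p)) *\<^sub>R (A *v (fst (snd v) - d\<gamma> (fst p) (fst v))))"

lemma d\<gamma>_linear: "y \<in> \<Omega> \<Longrightarrow> linear (d\<gamma> y)"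
  using \<gamma>_der has_derivative_linear by blast

lemma A_add: "A *v (a + b) = A *v a + A *v b" and A_diff: "A *v (a - b) = A *v a - A *v b"
  and A_scale: "A *v (r *\<^sub>R a) = r *\<^sub>R (A *v a)"
  by (simp_all add: matrix_vector_right_distrib matrix_vector_mult_diff_distrib matrix_vector_mult_scaleR)

lemma A_minus: "A *v (- a) = - (A *v a)"
  using A_scale[of "-1" a] by simp

lemma pull_add: "pull y (a + b) = pull y a + pull y b" and pull_diff: "pull y (a - b) = pull y a - pull y b"
  and pull_scale: "pull y (r *\<^sub>R a) = r *\<^sub>R pull y a"
  by (simp_all add: pull_def algebra_simps scaleR_add_left scaleR_diff_left)

lemmas d\<gamma>_simps = linear_add[OF d\<gamma>_linear] linear_scale[OF d\<gamma>_linear] linear_0[OF d\<gamma>_linear]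
lemmas Hq_simps = linear_add[OF Hq_linear] linear_scale[OF Hq_linear] linear_0[OF Hq_linear]

lemma dleft_reg_linear:
  assumes "fst p \<in> \<Omega>"
  shows "linear (dleft_reg p)"
proof (rule linearI)
  show "dleft_reg p (a + b) = dleft_reg p a + dleft_reg p b" for a b
    by (simp add: dleft_reg_def dleft_def d\<gamma>_simps[OF assms] Hq_simps[OF assms] A_add A_diff pull_add pull_diff algebra_simps)
  show "dleft_reg p (r *\<^sub>R a) = r *\<^sub>R dleft_reg p a" for r a
    by (simp add: dleft_reg_def dleft_def d\<gamma>_simps[OF assms] Hq_simps[OF assms] A_scale A_diff pull_scale pull_diff algebra_simps)
qed

lemma dright_reg_linear:
  assumes "fst p \<in> \<Omega>"
  shows "linear (dright_reg p)"
proof (rule linearI)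
  show "dright_reg p (a + b) = dright_reg p a + dright_reg p b" for a b
    by (simp add: dright_reg_def d\<gamma>_simps[OF assms] A_add A_diff algebra_simps)
  show "dright_reg p (r *\<^sub>R a) = r *\<^sub>R dright_reg p a" for r a
    by (simp add: dright_reg_def d\<gamma>_simps[OF assms] A_scale A_diff algebra_simps)
qed

lemma dleft_reg_inj:
  assumes p: "p \<in> chart_domain" and z: "dleft_reg p v = 0"
  shows "v = 0"
proof -
  note y = chart_domainD(1)[OF p]
  have 1: "fst v = 0" "snd (snd v) = 0" using z by (auto simp: dleft_reg_def dleft_def zero_prod_def)
  have 2: "(A *v fst (snd v)) $ None = 0" "pull (fst p) (A *v fst (snd v)) = 0"
    using z 1 chart_domainD(2)[OF p]
    by (auto simp: dleft_reg_def dleft_def zero_prod_def d\<gamma>_simps[OF y] Hq_simps[OF y])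
  have "A *v fst (snd v) = 0" using orthogonal_tangents[OF y 2(2)] 2(1) by simp
  then show "v = 0" using 1 A_nz by (simp add: prod_eq_iff zero_prod_def)
qed

lemma dright_reg_inj:
  assumes p: "p \<in> chart_domain" and z: "dright_reg p v = 0"
  shows "v = 0"
proof -
  note y = chart_domainD(1)[OF p]
  have 1: "fst (snd v) = 0" using z by (simp add: dright_reg_def zero_prod_def)
  have "A *v ((2 * snd (snd v)) *\<^sub>R vert - (2 * snd (snd p)) *\<^sub>R d\<gamma> (fst p) (fst v)) = 0"
    using z 1 by (simp add: dright_reg_def zero_prod_def A_scale A_diff A_minus)
  then have 2: "(2 * snd (snd v)) *\<^sub>R vert = (2 * snd (snd p)) *\<^sub>R d\<gamma> (fst p) (fst v)" using A_nz by simp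
  from arg_cong[OF this, of base_part] have "fst v = 0" using chart_domainD(2)[OF p] by simp
  moreover from arg_cong[OF 2, of "\<lambda>w. w $ None"] this have "snd (snd v) = 0"
    by (simp add: d\<gamma>_simps[OF y] linear_0[OF has_derivative_linear[OF q_der[OF y]]])
  ultimately show "v = 0" using 1 by (simp add: prod_eq_iff zero_prod_def)
qed

lemma d\<gamma>_continuous: "continuous_on \<Omega> (\<lambda>y. d\<gamma> y \<eta>)"
proof (rule continuous_on_eq)
  show "continuous_on \<Omega> (\<lambda>y. graph_tangent (\<lambda>_. 0) \<eta> + (\<eta> \<bullet> grad q y) *\<^sub>R vert)"
    by (intro continuous_intros smooth_on_continuous[OF smooth_on_grad_q])
  show "graph_tangent (\<lambda>_. 0) \<eta> + (\<eta> \<bullet> grad q y) *\<^sub>R vert = d\<gamma> y \<eta>" if "y \<in> \<Omega>" for y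
    by (rule vec_option_eqI) (simp_all add: dq_grad[OF that])
qed

lemma d\<gamma>_chart_continuous: "continuous_on chart_domain (\<lambda>p. A *v (w - d\<gamma> (fst p) \<eta>))"
  by (intro bounded_linear.continuous_on[OF A_linear] continuous_on_diff continuous_on_const
      continuous_on_compose2[OF d\<gamma>_continuous continuous_on_fst[OF continuous_on_id] chart_base])

lemma pull_chart_continuous:
  assumes "continuous_on chart_domain w"
  shows "continuous_on chart_domain (\<lambda>p. pull (fst p) (w p))"
  unfolding pull_def
  by (intro continuous_on_add continuous_on_scaleR bounded_linear.continuous_on[OF base_part_linear]
      bounded_linear.continuous_on[OF bounded_linear_vec_nth] assms smooth_on_continuous[OF smooth_chart_grad])

lemma Hq_chart_continuous: "continuous_on chart_domain (\<lambda>p. Hq (fst p) \<eta>)"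
  unfolding Hq_def
  by (rule continuous_on_compose2[OF smooth_on_continuous[OF smooth_on_pd_any[OF \<Omega> smooth_on_grad_q]]
        continuous_on_fst[OF continuous_on_id] chart_base])

lemma dleft_reg_continuous: "continuous_on chart_domain (\<lambda>p. dleft_reg p v)"
  unfolding dleft_reg_def dleft_def snd_conv
  by (intro continuous_on_Pair continuous_on_add continuous_on_scaleR continuous_on_mult continuous_on_const
      d\<gamma>_chart_continuous pull_chart_continuous Hq_chart_continuous smooth_on_continuous[OF smooth_A_offset]
      bounded_linear.continuous_on[OF bounded_linear_vec_nth] smooth_on_continuous[OF smooth_chart_snd(2)])

lemma dright_reg_continuous: "continuous_on chart_domain (\<lambda>p. dright_reg p v)"
  unfolding dright_reg_def
  by (intro continuous_on_Pair continuous_on_add continuous_on_scaleR continuous_on_mult continuous_on_const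
      d\<gamma>_chart_continuous smooth_on_continuous[OF smooth_chart_snd(2)])

lemma Hq_transpose:
  assumes "y \<in> \<Omega>"
  shows "u \<bullet> Hq y \<eta> = \<eta> \<bullet> (\<Sum>b\<in>Basis. (u \<bullet> Hq y b) *\<^sub>R b)"
proof -
  have "u \<bullet> Hq y \<eta> = u \<bullet> Hq y (\<Sum>b\<in>Basis. (\<eta> \<bullet> b) *\<^sub>R b)" by (simp add: euclidean_representation)
  also have "\<dots> = (\<Sum>b\<in>Basis. (\<eta> \<bullet> b) * (u \<bullet> Hq y b))"
    by (simp add: linear_sum[OF Hq_linear[OF assms]] Hq_simps[OF assms] inner_sum_right)
  finally show ?thesis by (simp add: inner_sum_right mult.commute)
qed

text \<open>
  With \<open>\<xi>\<close> the variation of the offset and \<open>z = h e + d\<gamma> u\<close>, the row of \<open>dt\<close> is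
  \<open>2 \<xi> \<bullet> A z = 2 h (A \<xi>)\<^sub>n + 2 u \<bullet> pull (A \<xi>)\<close>. The second term is a combination of the rows of the base
  covector, up to multiples of the rows of \<open>dy\<close> and \<open>d\<omega>\<close>.
\<close>

lemma left_determinant:
  assumes p: "p \<in> chart_domain"
  shows "eucl_det (dleft p) = height p * eucl_det (dleft_reg p)" "eucl_det (dleft_reg p) \<noteq> 0"
proof -
  note y = chart_domainD(1)[OF p]
  obtain idx :: "'m option + 'm option \<Rightarrow> 'm left_cotangent" where "basis_enumeration TYPE('m params) idx"
    using left_basis by blast
  then interpret basis_enumeration idx "TYPE('m params)" .
  show "eucl_det (dleft_reg p) \<noteq> 0"
    by (rule eucl_det_nonzero[OF dleft_reg_linear[OF y] dleft_reg_inj[OF p]])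
  let ?z = "offset p" and ?u = "base_part (offset p)" and ?\<omega> = "snd (snd p)"
  let ?e = "((0, 1), (0, 0)) :: 'm left_cotangent"
  let ?w = "\<Sum>b\<in>Basis. (?u \<bullet> Hq (fst p) b) *\<^sub>R b"
  \<comment> \<open>The coefficients of this combination; \<open>?w\<close> is the transposed Hessian applied to \<open>u\<close>.\<close>
  let ?c = "((- (2 * (A *v ?z) $ None) *\<^sub>R ?w, height p), ((1 / ?\<omega>) *\<^sub>R ?u, - (2 * (?u \<bullet> pull (fst p) (A *v ?z))) / ?\<omega>))"
  have "eucl_det (dleft p) = (?c \<bullet> ?e) * eucl_det (dleft_reg p)"
  proof (rule eucl_det_replace_row)
    show "?e \<in> Basis" by (simp add: Basis_prod_def zero_prod_def)
    fix v b
    show "dleft p v \<bullet> b = dleft_reg p v \<bullet> b" if "b \<in> Basis" "b \<noteq> ?e"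
    proof -
      have "snd (fst b) = 0" using that by (auto simp: Basis_prod_def zero_prod_def)
      then show ?thesis by (simp add: dleft_reg_def dleft_def inner_prod_def)
    qed
    let ?\<xi> = "fst (snd v) - d\<gamma> (fst p) (fst v)"
    have "?\<xi> \<bullet> (A *v ?z) = (A *v ?\<xi>) \<bullet> ?z" by (simp add: A_sym)
    also have "\<dots> = (A *v ?\<xi>) \<bullet> (height p *\<^sub>R vert + d\<gamma> (fst p) ?u)"
      by (rule arg_cong[OF offset_split[OF y]])
    also have "(A *v ?\<xi>) \<bullet> (height p *\<^sub>R vert + d\<gamma> (fst p) ?u) = height p * (A *v ?\<xi>) $ None + ?u \<bullet> pull (fst p) (A *v ?\<xi>)"
      by (simp add: inner_add_right pull_inner[OF y] inner_commute[of "A *v _" "d\<gamma> _ _"] inner_option[of "A *v _" vert])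
    finally have *: "?\<xi> \<bullet> (A *v ?z) = height p * (A *v ?\<xi>) $ None + ?u \<bullet> pull (fst p) (A *v ?\<xi>)" .
    show "dleft p v \<bullet> ?e = dleft_reg p v \<bullet> ?c"
      using chart_domainD(2)[OF p] Hq_transpose[OF y, of ?u "fst v"]
      by (simp add: dleft_reg_def dleft_def inner_prod_def * inner_add_left inner_commute[of "pull _ _"]
          inner_commute[of "Hq _ _"] field_simps)
  qed
  then show "eucl_det (dleft p) = height p * eucl_det (dleft_reg p)" by (simp add: inner_prod_def)
qed

text \<open>
  Since \<open>A z = h A e + A d\<gamma> u\<close>, the column of \<open>d\<omega>\<close> is \<open>h\<close> times the regular one minus \<open>1 / \<omega>\<close> times
  the image of the variation \<open>u\<close> of \<open>y\<close>.
\<close>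

lemma right_determinant:
  assumes p: "p \<in> chart_domain"
  shows "eucl_det (dright p) = height p * eucl_det (dright_reg p)" "eucl_det (dright_reg p) \<noteq> 0"
proof -
  note y = chart_domainD(1)[OF p]
  obtain idx :: "'m option + 'm option \<Rightarrow> 'm right_cotangent" where "basis_enumeration TYPE('m params) idx"
    using right_basis by blast
  then interpret basis_enumeration idx "TYPE('m params)" .
  show "eucl_det (dright_reg p) \<noteq> 0"
    by (rule eucl_det_nonzero[OF dright_reg_linear[OF y] dright_reg_inj[OF p]])
  let ?z = "offset p" and ?u = "base_part (offset p)" and ?\<omega> = "snd (snd p)"
  let ?e = "(0, 0, 1) :: 'm params"
  let ?x = "(- (1 / ?\<omega>) *\<^sub>R ?u, 0, height p) :: 'm params"
  have "eucl_det (dright p) = (?x \<bullet> ?e) * eucl_det (dright_reg p)"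
  proof (rule eucl_det_replace_column[OF dright_reg_linear[OF y]])
    show "?e \<in> Basis" by (simp add: Basis_prod_def)
    show "dright p b = dright_reg p b" if "b \<in> Basis" "b \<noteq> ?e" for b
    proof -
      have "snd (snd b) = 0" using that by (auto simp: Basis_prod_def)
      then show ?thesis by (simp add: dright_reg_def dright_def)
    qed
    have "A *v ?z = height p *\<^sub>R (A *v vert) + A *v d\<gamma> (fst p) ?u"
      by (subst offset_split[OF y]) (simp only: A_add A_scale)
    then show "dright p ?e = dright_reg p ?x"
      using chart_domainD(2)[OF p]
      by (simp add: dright_reg_def dright_def d\<gamma>_simps[OF y] A_scale A_diff algebra_simps)
         (simp add: A_scale[symmetric] linear_neg[OF d\<gamma>_linear[OF y]] linear_scale[OF d\<gamma>_linear[OF y]])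
  qed
  then show "eucl_det (dright p) = height p * eucl_det (dright_reg p)" by (simp add: inner_prod_def)
qed

lemma left_defining_function:
  "defining_function chart_domain (fst \<circ> relation_chart q A) height (\<lambda>p. eucl_det (dleft_reg p)) dheight"
proof
  obtain idx :: "'m option + 'm option \<Rightarrow> 'm left_cotangent" where "basis_enumeration TYPE('m params) idx"
    using left_basis by blast
  then interpret basis_enumeration idx "TYPE('m params)" .
  show "continuous_on chart_domain (\<lambda>p. eucl_det (dleft_reg p))"
    by (rule continuous_on_eucl_det) (intro continuous_on_inner dleft_reg_continuous continuous_on_const)
  fix s assume s: "s \<in> chart_domain"
  show "jac_det (fst \<circ> relation_chart q A) s = height s * eucl_det (dleft_reg s)"
    unfolding jac_det_def projection_derivatives(1)[OF s] by (rule left_determinant(1)[OF s])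
qed (use open_chart_domain left_determinant height_der in auto)

lemma right_defining_function:
  "defining_function chart_domain (snd \<circ> relation_chart q A) height (\<lambda>p. eucl_det (dright_reg p)) dheight"
proof
  obtain idx :: "'m option + 'm option \<Rightarrow> 'm right_cotangent" where "basis_enumeration TYPE('m params) idx"
    using right_basis by blast
  then interpret basis_enumeration idx "TYPE('m params)" .
  show "continuous_on chart_domain (\<lambda>p. eucl_det (dright_reg p))"
    by (rule continuous_on_eucl_det) (intro continuous_on_inner dright_reg_continuous continuous_on_const)
  fix s assume s: "s \<in> chart_domain"
  show "jac_det (snd \<circ> relation_chart q A) s = height s * eucl_det (dright_reg s)"
    unfolding jac_det_def projection_derivatives(2)[OF s] by (rule right_determinant(1)[OF s])
qed (use open_chart_domain right_determinant height_der in auto)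

section \<open>Fold and cusp\<close>

lemma smooth_projections:
  "smooth_on chart_domain (fst \<circ> relation_chart q A)" "smooth_on chart_domain (snd \<circ> relation_chart q A)"
  unfolding comp_def
  by (rule smooth_on_linear_compose[OF open_chart_domain bounded_linear_fst smooth_relation_chart]
      smooth_on_linear_compose[OF open_chart_domain bounded_linear_snd smooth_relation_chart])+

text \<open>
  At a critical point \<open>z = d\<gamma> u\<close>, so moving \<open>y\<close> along \<open>u\<close> and rescaling \<open>\<omega>\<close> accordingly leaves \<open>x\<close> and
  \<open>\<omega> A z\<close> unchanged to first order. The height changes at the rate \<open>- u \<bullet> Hess q u\<close>.
\<close>

theorem radon_right_fold:
  assumes definite: "\<And>y v. y \<in> \<Omega> \<Longrightarrow> v \<noteq> 0 \<Longrightarrow> v \<bullet> Hq y v \<noteq> 0"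
  shows "fold_singularity (relation_params \<Omega> q A) (snd \<circ> relation_chart q A)"
  unfolding fold_singularity_def
proof (intro conjI exI[of _ chart_domain] ballI impI)
  interpret defining_function chart_domain "snd \<circ> relation_chart q A" height "\<lambda>p. eucl_det (dright_reg p)" dheight
    by (rule right_defining_function)
  fix p assume "p \<in> relation_params \<Omega> q A" and j: "jac_det (snd \<circ> relation_chart q A) p = 0"
  then have p: "p \<in> chart_domain" using params_subset by blast
  note y = chart_domainD(1)[OF p]
  have h: "height p = 0" using jac_zero[OF p] j by simp
  let ?u = "base_part (offset p)"
  have "A *v d\<gamma> (fst p) ?u = A *v offset p" using critical_offset(1)[OF p h] by simp
  then have "dright p (?u, 0, snd (snd p)) = 0"
    by (simp add: dright_def zero_prod_def A_minus)
  then have k: "(?u, 0, snd (snd p)) \<in> ker_d (snd \<circ> relation_chart q A) p"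
    by (simp add: ker_d_def projection_derivatives(2)[OF p])
  have "dheight p (?u, 0, snd (snd p)) \<noteq> 0"
    using definite[OF y critical_offset(2)[OF p h]] by (simp add: dheight_def)
  then show "fold_point chart_domain (snd \<circ> relation_chart q A) p"
    using fold_pointI[OF p h k] has_derivative_linear[OF smooth_on_has_derivative[OF smooth_projections(2) open_chart_domain p]]
    by blast
qed (simp add: card_UNIV_option, (rule open_chart_domain params_subset smooth_projections)+)

lemma matrix_inv_A: "A *v (matrix_inv A *v w) = w"
proof -
  have "A ** matrix_inv A = mat 1" using inv unfolding invertible_def matrix_inv_def by (rule someI2_ex) blast
  then show ?thesis by (simp add: matrix_vector_mul_assoc)
qed

lemma matrix_inv_sym: "(matrix_inv A *v a) \<bullet> b = a \<bullet> (matrix_inv A *v b)"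
  using A_sym[of "matrix_inv A *v a" "matrix_inv A *v b"] by (simp add: matrix_inv_A)

text \<open>
  At a critical point the kernel is spanned by the variation \<open>A\<^sup>-\<^sup>1 \<nu>\<close> of \<open>x\<close>, along which the height has the
  derivative \<open>F = \<nu> \<bullet> A\<^sup>-\<^sup>1 \<nu>\<close>. Where \<open>F\<close> vanishes, \<open>A\<^sup>-\<^sup>1 \<nu>\<close> is not vertical, and the definite Hessian makes
  the derivative of \<open>F\<close> along its base component nonzero.
\<close>

theorem radon_left_cusp:
  assumes definite: "\<And>y v. y \<in> \<Omega> \<Longrightarrow> v \<noteq> 0 \<Longrightarrow> v \<bullet> Hq y v \<noteq> 0"
  shows "cusp_singularity (relation_params \<Omega> q A) (fst \<circ> relation_chart q A)"
  unfolding cusp_singularity_def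
proof (intro conjI exI[of _ chart_domain] ballI impI)
  interpret defining_function chart_domain "fst \<circ> relation_chart q A" height "\<lambda>p. eucl_det (dleft_reg p)" dheight
    by (rule left_defining_function)
  define v where "v s = (0 :: real ^ 'm, matrix_inv A *v normal (fst s), 0 :: real)"
    for s :: "'m params"
  define F where "F s = (matrix_inv A *v normal (fst s)) \<bullet> normal (fst s)"
    for s :: "'m params"
  have v_nz: "v s \<noteq> 0" for s
  proof
    assume "v s = 0"
    then have "A *v (matrix_inv A *v normal (fst s)) = A *v 0" by (simp add: v_def zero_prod_def)
    then show False using normal_nz by (simp add: matrix_inv_A)
  qed
  have pull_normal: "pull y (normal y) = 0" for y by (simp add: pull_def normal_def)
  have v_ker: "v s \<in> ker_d (fst \<circ> relation_chart q A) s" if s: "s \<in> chart_domain" "height s = 0" for s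
  proof -
    note y = chart_domainD(1)[OF s(1)]
    have "(matrix_inv A *v normal (fst s)) \<bullet> (A *v offset s) = 0"
      using s(2) A_sym[of "matrix_inv A *v normal (fst s)" "offset s"]
      by (simp add: matrix_inv_A height_def inner_commute)
    then have "dleft s (v s) = 0"
      by (simp add: dleft_def v_def zero_prod_def d\<gamma>_simps[OF y] Hq_simps[OF y] matrix_inv_A pull_normal)
    then show ?thesis by (simp add: ker_d_def projection_derivatives(1)[OF s(1)])
  qed
  have F: "dheight s (v s) = F s" if "s \<in> chart_domain" for s
    using Hq_simps[OF chart_domainD(1)[OF that]] by (simp add: dheight_def v_def F_def)
  fix p assume "p \<in> relation_params \<Omega> q A" and j: "jac_det (fst \<circ> relation_chart q A) p = 0"
  then have p: "p \<in> chart_domain" using params_subset by blast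
  note y = chart_domainD(1)[OF p]
  have h: "height p = 0" using jac_zero[OF p] j by simp
  show "fold_point chart_domain (fst \<circ> relation_chart q A) p \<or> cusp_point chart_domain (fst \<circ> relation_chart q A) p"
  proof (cases "F p = 0")
    case False
    then show ?thesis
      using fold_pointI[OF p h v_ker[OF p h]] F[OF p]
        has_derivative_linear[OF smooth_on_has_derivative[OF smooth_projections(1) open_chart_domain p]] by simp
  next
    case True
    let ?n = "normal (fst p)" and ?a = "matrix_inv A *v normal (fst p)"
    let ?u = "base_part ?a"
    have u: "?u \<noteq> 0"
    proof
      assume u0: "?u = 0"
      have "F p = ?a $ None" by (simp add: F_def inner_normal u0)
      then have "?a = 0" using True u0 by (intro vec_option_eqI) simp_all
      then show False using v_nz[of p] by (simp add: v_def zero_prod_def)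
    qed
    have "cusp_point chart_domain (fst \<circ> relation_chart q A) p"
    proof (rule cusp_pointI[OF p h _ _ v_nz v_ker smooth_height dheight_regular F])
      show "dheight p a = 0" if "a \<in> ker_d (fst \<circ> relation_chart q A) p" for a
      proof -
        have z: "dleft p a = 0" using that by (simp add: ker_d_def projection_derivatives(1)[OF p])
        have 1: "fst a = 0" "snd (snd a) = 0" using z by (auto simp: dleft_def zero_prod_def)
        have "pull (fst p) (A *v fst (snd a)) = 0"
          using z 1 chart_domainD(2)[OF p] by (auto simp: dleft_def zero_prod_def d\<gamma>_simps[OF y] Hq_simps[OF y])
        from orthogonal_tangents[OF y this]
        obtain r where "A *v fst (snd a) = r *\<^sub>R ?n" by blast
        also have "\<dots> = A *v (r *\<^sub>R ?a)" by (simp add: A_scale matrix_inv_A)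
        finally have "fst (snd a) = r *\<^sub>R ?a" by (simp only: A_inj)
        then show ?thesis using True 1 by (simp add: dheight_def F_def Hq_simps[OF y])
      qed
      show "smooth_on chart_domain v"
        unfolding v_def[abs_def]
        by (rule smooth_on_Pair[OF open_chart_domain smooth_on_const smooth_on_Pair[OF open_chart_domain
              smooth_on_linear_compose[OF open_chart_domain matrix_vector_mul_bounded_linear smooth_normal_chart] smooth_on_const]])
      have n: "((\<lambda>s. normal (fst s)) has_derivative (\<lambda>v. graph_tangent (\<lambda>_. 0) (- Hq (fst p) (fst v)))) (at p)"
        by (rule has_derivative_compose[OF has_derivative_fst[OF has_derivative_ident] normal_der[OF y]])
      have "(F has_derivative (\<lambda>v. ?a \<bullet> graph_tangent (\<lambda>_. 0) (- Hq (fst p) (fst v))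
            + (matrix_inv A *v graph_tangent (\<lambda>_. 0) (- Hq (fst p) (fst v))) \<bullet> ?n)) (at p)"
        unfolding F_def[abs_def]
        by (rule has_derivative_inner[OF bounded_linear.has_derivative[OF matrix_vector_mul_bounded_linear n] n])
      then show "(F has_derivative (\<lambda>v. - 2 * (?u \<bullet> Hq (fst p) (fst v)))) (at p)"
        by (rule has_derivative_eq_rhs)
           (simp add: fun_eq_iff matrix_inv_sym inner_commute[of "graph_tangent _ _"] inner_option[of _ "graph_tangent _ _"])
      \<comment> \<open>The vertical variation of \<open>x\<close> makes this variation tangent to the critical set.\<close>
      let ?w = "(?u, (base_part (offset p) \<bullet> Hq (fst p) ?u) *\<^sub>R vert, 0 :: real)"
      show "dheight p ?w = 0" by (simp add: dheight_def inner_normal)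
      show "- 2 * (?u \<bullet> Hq (fst p) (fst ?w)) \<noteq> 0" using definite[OF y u] by simp
    qed
    then show ?thesis ..
  qed
qed (simp add: card_UNIV_option, (rule open_chart_domain params_subset smooth_projections)+)

end

theorem theorem5p1:
  fixes \<Omega> :: "(real ^ 'm) set"
    and q :: "real ^ 'm \<Rightarrow> real"
    and A :: "real ^ ('m option) ^ ('m::finite option)"
    and k :: nat
  assumes "CARD('m option) \<ge> 3"
    and "open \<Omega>"
    and "smooth_on \<Omega> q"
    and "connected (hypersurface \<Omega> q)"
    and "strictly_convex_graph \<Omega> q"
    and "transpose A = A"
    and "invertible A"
    and "k \<in> {2..CARD('m option) - 1}"
    and "num_pos_eigenvalues A = k"
    and "num_neg_eigenvalues A = CARD('m option) - k"
  shows "fourier_integral_operator (\<Omega> \<times> {0<..}) (- hypersurface \<Omega> q)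
           (radon_phase q A) (radon_transform q A) \<and>
         smooth_parametrization (relation_params \<Omega> q A) (relation_chart q A)
           (canonical_relation (\<Omega> \<times> {0<..}) (- hypersurface \<Omega> q) (radon_phase q A)) \<and>
         cusp_singularity (relation_params \<Omega> q A) (fst \<circ> relation_chart q A) \<and>
         fold_singularity (relation_params \<Omega> q A) (snd \<circ> relation_chart q A)"
proof -
  interpret radon_geometry \<Omega> q A using assms by unfold_locales
  have "v \<bullet> Hq y v \<noteq> 0" if "y \<in> \<Omega>" "v \<noteq> 0" for y v
    using assms(5) that hessian_Hq[OF that(1), of v v] unfolding strictly_convex_graph_def by fastforce
  then show ?thesis
    using radon_fourier_integral_operator radon_smooth_parametrization radon_left_cusp radon_right_fold by blast
qed

end
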